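(* Let $k\in\mathbb{Z}_{\ge0}^{S}$ have exactly one nonzero entry, $k_\sigma=k$, with $0\le k\le q^{2}/2$, and write $k=dq+r$ with $0\le r<q-d$. Let $a\in\mathcal{O}_{C}$ with $0<v_{F}(a)\le e$, and assume that either $0<v_{F}(a)\le1$ or $2v_{F}(a)-1\le r$. Then the pair $(k,a)$ is separated.
   Context: $p$ is a prime; $F$ is a finite extension of $\mathbb{Q}_{p}$ with ring of integers $\mathcal{O}_{F}$, fixed uniformizer $\varpi$, residue field $\kappa_F$ of cardinality $q$, ramification index $e$. $C$ is a finite extension of $\mathbb{Q}_{p}$ such that $S=\mathrm{Hom}_{\mathbb{Q}_p\text{-alg}}(F,C)$ has $[F:\mathbb{Q}_{p}]$ elements and $C$ contains a fixed square root of $\sigma(\varpi)$ for each $\sigma\in S$. $v_F$ is the valuation on $\overline{\mathbb{Q}}_p$ with $v_F(\varpi)=1$. In statements about $\mathcal{O}_C$-modules, $\varpi^{n}$ ($n\in\mathbb{Z}$) means $\sigma(\varpi)^{n}$ for a fixed $\sigma\in S$. $G=GL_{2}(F)$, $K=GL_{2}(\mathcal{O}_{F})$, $Z$ the center, $\alpha=\mathrm{diag}(1,\varpi)$, $\chi(g)=\varpi^{-v_{F}(\det g)}$. For $k\in\mathbb{Z}_{\ge0}^{S}$, $V_{k}=\bigotimes_{\sigma\in S}V^{\sigma}_{k_\sigma}$ with $V^{\sigma}_{k_\sigma}$ the homogeneous polynomials of degree $k_\sigma$ in $x_\sigma,y_\sigma$ over $C$, where $g=\begin{pmatrix}a&b\\c&d\end{pmatrix}$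 acts by $x_\sigma^{k_\sigma-i}y_\sigma^{i}\mapsto \sigma(\chi(g))^{k_\sigma/2}(\sigma(a)x_\sigma+\sigma(c)y_\sigma)^{k_\sigma-i}(\sigma(b)x_\sigma+\sigma(d)y_\sigma)^{i}$, diagonally (representation $\rho_k$); $V_k^0$ is the $\mathcal{O}_C$-span of tensor products of monomials. $U_k$ multiplies $\bigotimes_\sigma x_\sigma^{k_\sigma-i_\sigma}y_\sigma^{i_\sigma}$ by $\prod_\sigma\sigma(\varpi)^{k_\sigma-i_\sigma}$; $\psi$ is the unique function $G\to\mathrm{End}_C(V_k)$ supported on $KZ\alpha^{-1}KZ$ with $\psi(\kappa_1\alpha^{-1}\kappa_2)=\rho_k(\kappa_1)U_k\rho_k(\kappa_2)$ ($\kappa_i\in KZ$). $\mathrm{ind}_{KZ}^{G}W$ ($W=V_k$ or $V_k^0$) consists of $f:G\to W$ with $f(\kappa g)=\rho_k(\kappa)f(g)$ ($\kappa\in KZ$), supported on finitely many cosets $KZg$; $[g,v]$ is supported on $KZg^{-1}$ with value $v$ at $g^{-1}$. $T([g,v])=\sum_{xKZ\in G/KZ}[gx,\psi(x^{-1})v]$. Supports: $I_0=\{0\}$, $I_{n}=\{\sum_{i=0}^{n-1}\varpi^{i}[\mu_{i}]:\mu_i\in\kappa_F\}$; $g_{n,\mu}^{0}=\begin{pmatrix}\varpi^{n}&\mu\\0&1\end{pmatrix}$, $g_{n,\mu}^{1}=\begin{pmatrix}1&0\\\varpi\mu&\varpi^{n+1}\end{pmatrix}$. Every $f$ is uniquely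 a finite sum $\sum_{n,\mu}([g^0_{n,\mu},v^0_{n,\mu}]+[g^1_{n,\mu},v^1_{n,\mu}])$; $f\in B_N$ means $v^0_{n,\mu}=0$ for $n>N$ and $v^1_{n,\mu}=0$ for $n>N-1$; $f\in B^0$ means all $v^1_{n,\mu}=0$. The pair $(k,a)$ is separated if for all sufficiently large $N\in\mathbb{Z}_{>0}$ there is $\epsilon\in\mathbb{Z}_{\ge0}$ depending only on $N,k,a$ such that for all $n\in\mathbb{Z}_{\ge0}$ and all $f\in\mathrm{ind}_{KZ}^GV_k$ with $f\in B^0$: $(T-a)(f)\in B_N+\varpi^n\mathrm{ind}_{KZ}^GV_k^0$ implies $f\in B_{N-1}+\varpi^{n-\epsilon}\mathrm{ind}_{KZ}^GV_k^0$. *)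

theory Defs
  imports
    "HOL-Analysis.Analysis"
    "HOL-Computational_Algebra.Computational_Algebra"
    "HOL-Library.Function_Algebras"
begin

section \<open>Finite extensions of the p-adic numbers\<close>

definition padic_abs_rat :: "nat \<Rightarrow> rat \<Rightarrow> real" where
  "padic_abs_rat p r =
     (if r = 0 then 0
      else real p powi (int (multiplicity (int p) (snd (quotient_of r)))
                      - int (multiplicity (int p) (fst (quotient_of r)))))"

definition nonarch_abs :: "('a::field \<Rightarrow> real) \<Rightarrow> bool" where
  "nonarch_abs N \<longleftrightarrow>
     (\<forall>x. 0 \<le> N x) \<and> (\<forall>x. N x = 0 \<longleftrightarrow> x = 0) \<and>
     (\<forall>x y. N (x * y) = N x * N y) \<and> (\<forall>x y. N (x + y) \<le> max (N x) (N y))"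

text \<open>The field of p-adic numbers, as a completion of the rationals for the p-adic
  absolute value (which determines it up to unique isomorphism).\<close>

definition is_padic_field :: "nat \<Rightarrow> ('k::field_char_0 \<Rightarrow> real) \<Rightarrow> bool" where
  "is_padic_field p N \<longleftrightarrow>
     nonarch_abs N \<and>
     (\<forall>r. N (of_rat r) = padic_abs_rat p r) \<and>
     (\<forall>x. \<forall>\<epsilon>>0. \<exists>r. N (x - of_rat r) < \<epsilon>) \<and>
     Metric_space.mcomplete UNIV (\<lambda>x y. N (x - y))"

definition is_ring_hom :: "('a::field \<Rightarrow> 'b::field) \<Rightarrow> bool" where
  "is_ring_hom \<phi> \<longleftrightarrow>
     \<phi> 1 = 1 \<and> (\<forall>x y. \<phi> (x + y) = \<phi> x + \<phi> y) \<and> (\<forall>x y. \<phi> (x * y) = \<phi> x * \<phi> y)"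

definition ext_degree :: "('k::field \<Rightarrow> 'l::field) \<Rightarrow> nat" where
  "ext_degree \<iota> = vector_space.dim (\<lambda>c x. \<iota> c * x) UNIV"

text \<open>A finite extension of a valued field, given by its structure map, together with
  an absolute value extending the one of the base. Over a complete base that absolute value
  is unique, so it is not additional structure.\<close>

definition finite_valued_ext ::
  "('k::field \<Rightarrow> real) \<Rightarrow> ('k \<Rightarrow> 'l::field) \<Rightarrow> ('l \<Rightarrow> real) \<Rightarrow> bool" where
  "finite_valued_ext N \<iota> N' \<longleftrightarrow>
     is_ring_hom \<iota> \<and>
     (\<exists>B. finite B \<and> module.span (\<lambda>c x. \<iota> c * x) B = UNIV) \<and>
     nonarch_abs N' \<and> (\<forall>x. N' (\<iota> x) = N x)"

definition int_ring :: "('l::field \<Rightarrow> real) \<Rightarrow> 'l set" where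
  "int_ring N = {x. N x \<le> 1}"

definition residue_field :: "('l::field \<Rightarrow> real) \<Rightarrow> 'l set set" where
  "residue_field N =
     int_ring N // {(x, y). x \<in> int_ring N \<and> y \<in> int_ring N \<and> N (x - y) < 1}"

definition is_uniformizer :: "('l::field \<Rightarrow> real) \<Rightarrow> 'l \<Rightarrow> bool" where
  "is_uniformizer N \<pi> \<longleftrightarrow> {x. N x < 1} = (\<lambda>y. \<pi> * y) ` int_ring N"


section \<open>The setting\<close>

text \<open>Type \<open>'k\<close> carries the p-adic numbers, \<open>'f\<close> the field \<open>F\<close> and \<open>'c\<close> the coefficient
  field \<open>C\<close>. The last two components are the chosen square roots of the \<open>\<sigma>(\<pi>)\<close> and the
  embedding through which powers of the uniformizer act on modules over the integers of \<open>C\<close>.\<close>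

record ('k, 'f, 'c) padic_data =
  res_char :: nat
  absQ :: "'k \<Rightarrow> real"
  mapF :: "'k \<Rightarrow> 'f"
  absF :: "'f \<Rightarrow> real"
  mapC :: "'k \<Rightarrow> 'c"
  absC :: "'c \<Rightarrow> real"
  unif :: 'f
  root_unif :: "('f \<Rightarrow> 'c) \<Rightarrow> 'c"
  base_emb :: "'f \<Rightarrow> 'c"

definition embeddings ::
  "('k::field_char_0, 'f::field, 'c::field) padic_data \<Rightarrow> ('f \<Rightarrow> 'c) set" where
  "embeddings D = {\<sigma>. is_ring_hom \<sigma> \<and> (\<forall>x. \<sigma> (mapF D x) = mapC D x)}"

locale padic_setting =
  fixes D :: "('k::field_char_0, 'f::field, 'c::field) padic_data"
  assumes prime_res_char: "prime (res_char D)"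
    and padic_field: "is_padic_field (res_char D) (absQ D)"
    and ext_F: "finite_valued_ext (absQ D) (mapF D) (absF D)"
    and ext_C: "finite_valued_ext (absQ D) (mapC D) (absC D)"
    and card_embeddings: "card (embeddings D) = ext_degree (mapF D)"
    and uniformizer: "is_uniformizer (absF D) (unif D)"
    and root_unif: "\<And>\<sigma>. \<sigma> \<in> embeddings D \<Longrightarrow> (root_unif D \<sigma>)\<^sup>2 = \<sigma> (unif D)"
    and base_emb: "base_emb D \<in> embeddings D"

text \<open>The valuation normalised by the uniformizer of \<open>F\<close>, integer-valued on the nonzero
  elements of \<open>F\<close> and extended-real-valued on \<open>C\<close>.\<close>

definition ordF :: "('k, 'f::field, 'c) padic_data \<Rightarrow> 'f \<Rightarrow> int" where
  "ordF D x = (THE n. absF D x = absF D (unif D) powi n)"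

definition valF :: "('k, 'f, 'c::field) padic_data \<Rightarrow> 'c \<Rightarrow> ereal" where
  "valF D x = (if x = 0 then \<infinity> else ereal (log (absF D (unif D)) (absC D x)))"

definition ram_index :: "('k, 'f::field, 'c) padic_data \<Rightarrow> nat" where
  "ram_index D = nat (ordF D (of_nat (res_char D)))"

definition res_card :: "('k, 'f::field, 'c) padic_data \<Rightarrow> nat" where
  "res_card D = card (residue_field (absF D))"

definition teichmueller :: "('k, 'f::field, 'c) padic_data \<Rightarrow> 'f set \<Rightarrow> 'f" where
  "teichmueller D \<mu> = (THE t. t \<in> \<mu> \<and> t ^ res_card D = t)"


section \<open>The groups and the weights\<close>

definition mat2 :: "'a::zero \<Rightarrow> 'a \<Rightarrow> 'a \<Rightarrow> 'a \<Rightarrow> 'a^2^2" where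
  "mat2 a b c d = vector [vector [a, b], vector [c, d]]"

definition GL2 :: "('f::field^2^2) set" where
  "GL2 = {g. invertible g}"

definition centerGL2 :: "('f::field^2^2) set" where
  "centerGL2 = {z \<in> GL2. \<forall>g\<in>GL2. z ** g = g ** z}"

definition maxcompact :: "('k, 'f::field, 'c) padic_data \<Rightarrow> ('f^2^2) set" where
  "maxcompact D =
     {g. (\<forall>i j. g $ i $ j \<in> int_ring (absF D)) \<and>
         (\<exists>h. (\<forall>i j. h $ i $ j \<in> int_ring (absF D)) \<and> g ** h = mat 1 \<and> h ** g = mat 1)}"

definition KZ :: "('k, 'f::field, 'c) padic_data \<Rightarrow> ('f^2^2) set" where
  "KZ D = {g ** z | g z. g \<in> maxcompact D \<and> z \<in> centerGL2}"

definition alpha :: "('k, 'f::field, 'c) padic_data \<Rightarrow> 'f^2^2" where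
  "alpha D = mat2 1 0 0 (unif D)"

text \<open>The tensor product \<open>V\<^sub>k\<close> is represented in coordinates: \<open>i\<close> in \<open>monomials D k\<close> stands
  for the tensor product over \<open>\<sigma>\<close> of \<open>x\<^sub>\<sigma>^(k \<sigma> - i \<sigma>) y\<^sub>\<sigma>^(i \<sigma>)\<close>, and a vector is the family of
  its coefficients on these basis elements.\<close>

type_synonym ('f, 'c) weight_vec = "(('f \<Rightarrow> 'c) \<Rightarrow> nat) \<Rightarrow> 'c"

definition monomials ::
  "('k::field_char_0, 'f::field, 'c::field) padic_data \<Rightarrow> (('f \<Rightarrow> 'c) \<Rightarrow> nat) \<Rightarrow> (('f \<Rightarrow> 'c) \<Rightarrow> nat) set"
  where
  "monomials D k =
     {i. (\<forall>\<sigma>\<in>embeddings D. i \<sigma> \<le> k \<sigma>) \<and> (\<forall>\<sigma>. \<sigma> \<notin> embeddings D \<longrightarrow> i \<sigma> = 0)}"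

definition weight ::
  "('k::field_char_0, 'f::field, 'c::field) padic_data \<Rightarrow> (('f \<Rightarrow> 'c) \<Rightarrow> nat) \<Rightarrow> ('f, 'c) weight_vec set"
  where
  "weight D k = {v. \<forall>i. i \<notin> monomials D k \<longrightarrow> v i = 0}"

definition weight_lattice ::
  "('k::field_char_0, 'f::field, 'c::field) padic_data \<Rightarrow> (('f \<Rightarrow> 'c) \<Rightarrow> nat) \<Rightarrow> ('f, 'c) weight_vec set"
  where
  "weight_lattice D k = {v \<in> weight D k. \<forall>i. v i \<in> int_ring (absC D)}"

text \<open>A binary form of degree \<open>m\<close> is read as a univariate polynomial whose coefficient of
  index \<open>j\<close> is that of \<open>x^(m - j) y^j\<close>; thus \<open>[:A, B:]\<close> is \<open>A x + B y\<close>. The factor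
  \<open>\<sigma>(\<chi>(g))^(k\<^sub>\<sigma>/2)\<close> is a power of the chosen square root of \<open>\<sigma>(\<pi>)\<close>.\<close>

definition rho ::
  "('k::field_char_0, 'f::field, 'c::field) padic_data \<Rightarrow> (('f \<Rightarrow> 'c) \<Rightarrow> nat) \<Rightarrow> 'f^2^2 \<Rightarrow>
   ('f, 'c) weight_vec \<Rightarrow> ('f, 'c) weight_vec"
  where
  "rho D k g v = (\<lambda>j.
     if j \<in> monomials D k then
       \<Sum>i\<in>monomials D k. v i *
         (\<Prod>\<sigma>\<in>embeddings D.
            root_unif D \<sigma> powi (- ordF D (det g) * int (k \<sigma>)) *
            coeff ([:\<sigma> (g $ 1 $ 1), \<sigma> (g $ 2 $ 1):] ^ (k \<sigma> - i \<sigma>) *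
                   [:\<sigma> (g $ 1 $ 2), \<sigma> (g $ 2 $ 2):] ^ i \<sigma>) (j \<sigma>))
     else 0)"

definition U_op ::
  "('k::field_char_0, 'f::field, 'c::field) padic_data \<Rightarrow> (('f \<Rightarrow> 'c) \<Rightarrow> nat) \<Rightarrow>
   ('f, 'c) weight_vec \<Rightarrow> ('f, 'c) weight_vec"
  where
  "U_op D k v = (\<lambda>i. (\<Prod>\<sigma>\<in>embeddings D. \<sigma> (unif D) ^ (k \<sigma> - i \<sigma>)) * v i)"

definition psi ::
  "('k::field_char_0, 'f::field, 'c::field) padic_data \<Rightarrow> (('f \<Rightarrow> 'c) \<Rightarrow> nat) \<Rightarrow> 'f^2^2 \<Rightarrow>
   ('f, 'c) weight_vec \<Rightarrow> ('f, 'c) weight_vec"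
  where
  "psi D k = (THE \<psi>.
     (\<forall>x. x \<notin> {\<kappa>1 ** matrix_inv (alpha D) ** \<kappa>2 | \<kappa>1 \<kappa>2. \<kappa>1 \<in> KZ D \<and> \<kappa>2 \<in> KZ D}
        \<longrightarrow> \<psi> x = (\<lambda>v. 0)) \<and>
     (\<forall>\<kappa>1\<in>KZ D. \<forall>\<kappa>2\<in>KZ D.
        \<psi> (\<kappa>1 ** matrix_inv (alpha D) ** \<kappa>2) = rho D k \<kappa>1 \<circ> U_op D k \<circ> rho D k \<kappa>2))"


section \<open>Compact induction and the Hecke operator\<close>

type_synonym ('f, 'c) ind_fun = "'f^2^2 \<Rightarrow> ('f, 'c) weight_vec"

text \<open>Functions on the group are extended by zero to all matrices.\<close>

definition c_ind ::
  "('k::field_char_0, 'f::field, 'c::field) padic_data \<Rightarrow> (('f \<Rightarrow> 'c) \<Rightarrow> nat) \<Rightarrow>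
   ('f, 'c) weight_vec set \<Rightarrow> ('f, 'c) ind_fun set"
  where
  "c_ind D k W =
     {f. (\<forall>g\<in>GL2. f g \<in> W) \<and> (\<forall>g. g \<notin> GL2 \<longrightarrow> f g = 0) \<and>
         (\<forall>\<kappa>\<in>KZ D. \<forall>g\<in>GL2. f (\<kappa> ** g) = rho D k \<kappa> (f g)) \<and>
         finite {(\<lambda>\<kappa>. \<kappa> ** g) ` KZ D | g. g \<in> GL2 \<and> f g \<noteq> 0}}"

definition elem ::
  "('k::field_char_0, 'f::field, 'c::field) padic_data \<Rightarrow> (('f \<Rightarrow> 'c) \<Rightarrow> nat) \<Rightarrow> 'f^2^2 \<Rightarrow>
   ('f, 'c) weight_vec \<Rightarrow> ('f, 'c) ind_fun"
  where
  "elem D k g v = (\<lambda>h. if h ** g \<in> KZ D then rho D k (h ** g) v else 0)"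

text \<open>The sum over \<open>G/KZ\<close> has only finitely many nonzero terms and is restricted to these,
  since \<open>sum\<close> vanishes on infinite index sets. A term does not depend on the representative.\<close>

definition hecke_elem ::
  "('k::field_char_0, 'f::field, 'c::field) padic_data \<Rightarrow> (('f \<Rightarrow> 'c) \<Rightarrow> nat) \<Rightarrow> 'f^2^2 \<Rightarrow>
   ('f, 'c) weight_vec \<Rightarrow> ('f, 'c) ind_fun"
  where
  "hecke_elem D k g v =
     (let summand = (\<lambda>X. let x = (SOME x. x \<in> X) in elem D k (g ** x) (psi D k (matrix_inv x) v))
      in \<Sum>X\<in>{X \<in> {(\<lambda>\<kappa>. x ** \<kappa>) ` KZ D | x. x \<in> GL2}. summand X \<noteq> 0}. summand X)"

text \<open>Linear extension to the whole induction, through the expansion of \<open>f\<close> as the sum of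
  \<open>[y\<inverse>, f(y)]\<close> over representatives \<open>y\<close> of the cosets \<open>KZ y\<close> in its support.\<close>

definition hecke ::
  "('k::field_char_0, 'f::field, 'c::field) padic_data \<Rightarrow> (('f \<Rightarrow> 'c) \<Rightarrow> nat) \<Rightarrow>
   ('f, 'c) ind_fun \<Rightarrow> ('f, 'c) ind_fun"
  where
  "hecke D k f =
     (\<Sum>Y\<in>{(\<lambda>\<kappa>. \<kappa> ** g) ` KZ D | g. g \<in> GL2 \<and> f g \<noteq> 0}.
        let y = (SOME y. y \<in> Y) in hecke_elem D k (matrix_inv y) (f y))"


section \<open>Supports and separated pairs\<close>

definition digits :: "('k, 'f::field, 'c) padic_data \<Rightarrow> nat \<Rightarrow> 'f set" where
  "digits D n =
     {\<Sum>i<n. unif D ^ i * teichmueller D (\<mu> i) | \<mu>. \<forall>i<n. \<mu> i \<in> residue_field (absF D)}"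

definition g0 :: "('k, 'f::field, 'c) padic_data \<Rightarrow> nat \<Rightarrow> 'f \<Rightarrow> 'f^2^2" where
  "g0 D n \<mu> = mat2 (unif D ^ n) \<mu> 0 1"

definition g1 :: "('k, 'f::field, 'c) padic_data \<Rightarrow> nat \<Rightarrow> 'f \<Rightarrow> 'f^2^2" where
  "g1 D n \<mu> = mat2 1 0 (unif D * \<mu>) (unif D ^ (n + 1))"

definition is_expansion ::
  "('k::field_char_0, 'f::field, 'c::field) padic_data \<Rightarrow> (('f \<Rightarrow> 'c) \<Rightarrow> nat) \<Rightarrow> ('f, 'c) ind_fun \<Rightarrow>
   (nat \<Rightarrow> 'f \<Rightarrow> ('f, 'c) weight_vec) \<Rightarrow> (nat \<Rightarrow> 'f \<Rightarrow> ('f, 'c) weight_vec) \<Rightarrow> bool"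
  where
  "is_expansion D k f v0 v1 \<longleftrightarrow>
     (\<forall>n \<mu>. v0 n \<mu> \<in> weight D k \<and> v1 n \<mu> \<in> weight D k) \<and>
     (\<forall>n \<mu>. \<mu> \<notin> digits D n \<longrightarrow> v0 n \<mu> = 0 \<and> v1 n \<mu> = 0) \<and>
     finite {(n, \<mu>). v0 n \<mu> \<noteq> 0 \<or> v1 n \<mu> \<noteq> 0} \<and>
     f = (\<Sum>(n, \<mu>)\<in>{(n, \<mu>). v0 n \<mu> \<noteq> 0 \<or> v1 n \<mu> \<noteq> 0}.
            elem D k (g0 D n \<mu>) (v0 n \<mu>) + elem D k (g1 D n \<mu>) (v1 n \<mu>))"

definition ball_supp ::
  "('k::field_char_0, 'f::field, 'c::field) padic_data \<Rightarrow> (('f \<Rightarrow> 'c) \<Rightarrow> nat) \<Rightarrow> nat \<Rightarrow>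
   ('f, 'c) ind_fun set"
  where
  "ball_supp D k N =
     {f \<in> c_ind D k (weight D k). \<exists>v0 v1. is_expansion D k f v0 v1 \<and>
        (\<forall>n \<mu>. n > N \<longrightarrow> v0 n \<mu> = 0) \<and> (\<forall>n \<mu>. int n > int N - 1 \<longrightarrow> v1 n \<mu> = 0)}"

definition zero_supp ::
  "('k::field_char_0, 'f::field, 'c::field) padic_data \<Rightarrow> (('f \<Rightarrow> 'c) \<Rightarrow> nat) \<Rightarrow> ('f, 'c) ind_fun set"
  where
  "zero_supp D k =
     {f \<in> c_ind D k (weight D k). \<exists>v0 v1. is_expansion D k f v0 v1 \<and> (\<forall>n \<mu>. v1 n \<mu> = 0)}"

definition smul :: "'c::field \<Rightarrow> ('f, 'c) ind_fun \<Rightarrow> ('f, 'c) ind_fun" where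
  "smul c f = (\<lambda>g i. c * f g i)"

definition ball_plus_lattice ::
  "('k::field_char_0, 'f::field, 'c::field) padic_data \<Rightarrow> (('f \<Rightarrow> 'c) \<Rightarrow> nat) \<Rightarrow> nat \<Rightarrow> int \<Rightarrow>
   ('f, 'c) ind_fun set"
  where
  "ball_plus_lattice D k N m =
     {b + smul (base_emb D (unif D) powi m) h | b h.
        b \<in> ball_supp D k N \<and> h \<in> c_ind D k (weight_lattice D k)}"

definition separated ::
  "('k::field_char_0, 'f::field, 'c::field) padic_data \<Rightarrow> (('f \<Rightarrow> 'c) \<Rightarrow> nat) \<Rightarrow> 'c \<Rightarrow> bool"
  where
  "separated D k a \<longleftrightarrow>
     (\<exists>N0>0. \<forall>N\<ge>N0. \<exists>\<epsilon>::nat. \<forall>n::nat. \<forall>f\<in>zero_supp D k.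
        hecke D k f - smul a f \<in> ball_plus_lattice D k N (int n) \<longrightarrow>
        f \<in> ball_plus_lattice D k (N - 1) (int n - int \<epsilon>))"

end

theory Submission
  imports Defs
begin

text \<open>
  Words \<open>w\<close> in the Teichmueller digits address the vertices \<open>g\<^sup>0\<^bsub>n,\<mu>\<^esub>\<close> of the tree, and an \<open>f\<close> in \<open>B\<^sup>0\<close>
  becomes a finitely supported family of polynomials \<open>f\<^sub>w\<close> of degree at most \<open>k\<close>. Writing
  \<open>T\<^sup>+\<^sub>t v = v(\<omega> y - t)\<close>, \<open>U v = \<Sum>\<^sub>i \<omega>^(k - i) c\<^sub>i(v) y^i\<close> and \<open>T\<^sup>-\<^sub>s v = (U v)(y + s)\<close>, the value of
  \<open>(T - a) f\<close> at the vertex \<open>t w\<close> is \<open>T\<^sup>+\<^sub>t f\<^sub>w + (\<Sum>\<^sub>s T\<^sup>-\<^sub>s f\<^bsub>s t w\<^esub>) - a f\<^bsub>t w\<^esub>\<close>. Beyond distance \<open>N\<close> from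
  the origin these values are at most \<open>\<eta>\<close>, and in the subtree above each vertex at that distance one has
  to bound the \<open>f\<^sub>w\<close> by \<open>C \<eta>\<close> with \<open>C\<close> independent of the size of the support.

  Let \<open>A\<close> be the largest Gauss norm away from the root of the subtree and suppose \<open>\<eta> < |a|\<^sup>2 A\<close>. Consider
  a longest word \<open>z\<close> at which the Gauss norm of \<open>U f\<^sub>z\<close> attains its maximum \<open>m \<ge> |a| A\<close>. For all words at
  least as long the equation makes \<open>T\<^sup>+ f\<^sub>w\<close> smaller than \<open>m\<close>. As \<open>f\<^sub>w\<close> is divided successively by
  \<open>\<theta> = y^q - (\<plusminus>1) y\<close>, which vanishes at all \<open>- t\<close>, each division costs one factor \<open>\<omega>\<close>, and the
  congruence \<open>p | binom(q, i)\<close> makes the sums over \<open>s\<close> small outside the residues \<open>0, \<dots>, r\<close>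
  modulo \<open>q\<close>; together this bounds \<open>U f\<^sub>z\<close> strictly by \<open>m\<close>, a contradiction. The weight \<open>k = q\<close> escapes
  this argument and is treated by linearising the equation for the top coefficients around an
  approximate root of a quadratic polynomial.
\<close>

section \<open>Nonarchimedean absolute values and the Gauss norm\<close>

locale nonarch =
  fixes N :: "'a::field \<Rightarrow> real"
  assumes nonarch: "nonarch_abs N"
begin

lemma N_nonneg [simp]: "0 \<le> N x"
  and N_eq_0_iff [simp]: "N x = 0 \<longleftrightarrow> x = 0"
  and N_mult: "N (x * y) = N x * N y"
  and N_add_le_max: "N (x + y) \<le> max (N x) (N y)"
  using nonarch unfolding nonarch_abs_def by auto

lemma N_zero [simp]: "N 0 = 0"
  by simp

lemma N_one [simp]: "N 1 = 1"
proof -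
  have "N 1 * N 1 = N 1 * 1" using N_mult[of 1 1] by simp
  then show ?thesis by (simp only: mult_cancel_left) simp
qed

lemma N_pos_iff [simp]: "0 < N x \<longleftrightarrow> x \<noteq> 0"
  using N_nonneg[of x] N_eq_0_iff[of x] by linarith

lemma N_le_0_iff [simp]: "N x \<le> 0 \<longleftrightarrow> x = 0"
  by (simp add: order_antisym_conv)

lemma N_power: "N (x ^ n) = N x ^ n"
  by (induction n) (simp_all add: N_mult)

lemma N_minus [simp]: "N (- x) = N x"
proof -
  have "(N (-1))\<^sup>2 = 1" by (simp flip: N_power)
  then have "N (-1) = 1" using N_nonneg[of "-1"] by (auto simp: power2_eq_1_iff)
  then show ?thesis using N_mult[of "-1" x] by simp
qed

lemma N_minus_commute: "N (x - y) = N (y - x)"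
  using N_minus[of "x - y"] by simp

lemma N_inverse: "N (inverse x) = inverse (N x)"
proof (cases "x = 0")
  case False
  then have "N x * N (inverse x) = 1" using N_mult[of x "inverse x"] by simp
  then show ?thesis using False by (metis inverse_unique)
qed simp

lemma N_divide: "N (x / y) = N x / N y"
  by (simp add: divide_inverse N_mult N_inverse)

lemma N_power_int: "N (x powi n) = N x powi n"
  by (simp add: power_int_def N_power N_inverse)

lemma N_prod: "N (prod g S) = (\<Prod>i\<in>S. N (g i))"
  by (induction S rule: infinite_finite_induct) (simp_all add: N_mult)

lemma N_add_le: "N x \<le> B \<Longrightarrow> N y \<le> B \<Longrightarrow> N (x + y) \<le> B"
  using N_add_le_max[of x y] by linarith

lemma N_add_less: "N x < B \<Longrightarrow> N y < B \<Longrightarrow> N (x + y) < B"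
  using N_add_le_max[of x y] by linarith

lemma N_diff_le: "N x \<le> B \<Longrightarrow> N y \<le> B \<Longrightarrow> N (x - y) \<le> B"
  using N_add_le[of x B "- y"] by simp

lemma N_diff_less: "N x < B \<Longrightarrow> N y < B \<Longrightarrow> N (x - y) < B"
  using N_add_less[of x B "- y"] by simp

lemma N_sum_le:
  assumes "\<And>i. i \<in> S \<Longrightarrow> N (g i) \<le> B" "0 \<le> B"
  shows "N (sum g S) \<le> B"
  using assms
proof (induction S rule: infinite_finite_induct)
  case (insert x F)
  then show ?case by (simp add: N_add_le)
qed auto

lemma N_sum_less:
  assumes "\<And>i. i \<in> S \<Longrightarrow> N (g i) < B" "0 < B"
  shows "N (sum g S) < B"
  using assms
proof (induction S rule: infinite_finite_induct)
  case (insert x F)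
  then show ?case by (simp add: N_add_less)
qed auto

lemma N_add_eq_left: "N y < N x \<Longrightarrow> N (x + y) = N x"
  using N_add_le_max[of x y] N_add_le_max[of "x + y" "- y"] by (simp add: max_def split: if_splits)

lemma N_mult_le: "N x \<le> A \<Longrightarrow> N y \<le> B \<Longrightarrow> N (x * y) \<le> A * B"
  unfolding N_mult using order_trans[OF N_nonneg[of x]] by (auto intro!: mult_mono)

lemma N_mult_le_right: "N c \<le> 1 \<Longrightarrow> N x \<le> B \<Longrightarrow> N (c * x) \<le> B"
  using N_mult_le[of c 1 x B] by simp

lemma N_power_le_one: "N x \<le> 1 \<Longrightarrow> N (x ^ n) \<le> 1"
  by (simp add: N_power power_le_one)

lemma N_prod_le_one: "(\<And>i. i \<in> S \<Longrightarrow> N (g i) \<le> 1) \<Longrightarrow> N (prod g S) \<le> 1"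
  unfolding N_prod by (intro prod_le_1) simp

lemma N_of_nat_le_one: "N (of_nat n) \<le> 1"
  by (induction n) (simp_all add: N_add_le)

lemma N_of_nat_dvd_mono:
  assumes "m dvd n" shows "N (of_nat n) \<le> N (of_nat m)"
proof -
  obtain l where "n = m * l" using assms by blast
  then show ?thesis using mult_left_mono[OF N_of_nat_le_one[of l], of "N (of_nat m)"]
    by (simp add: N_mult)
qed

definition gauss :: "'a poly \<Rightarrow> real" where
  "gauss f = Max ((\<lambda>i. N (coeff f i)) ` {..degree f})"

lemma gauss_attained: obtains i where "N (coeff f i) = gauss f"
proof -
  have "gauss f \<in> (\<lambda>i. N (coeff f i)) ` {..degree f}" unfolding gauss_def by (intro Max_in) auto
  then show thesis using that by auto
qed

lemma gauss_nonneg [simp]: "0 \<le> gauss f"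
proof -
  obtain i where "N (coeff f i) = gauss f" by (rule gauss_attained)
  then show ?thesis using N_nonneg[of "coeff f i"] by simp
qed

lemma N_coeff_le_gauss: "N (coeff f i) \<le> gauss f"
proof (cases "i \<le> degree f")
  case True
  then show ?thesis unfolding gauss_def by (intro Max_ge) auto
qed (simp add: coeff_eq_0)

lemma gauss_le_iff: "gauss f \<le> B \<longleftrightarrow> (\<forall>i. N (coeff f i) \<le> B)"
proof
  assume "\<forall>i. N (coeff f i) \<le> B"
  moreover obtain i where "N (coeff f i) = gauss f" by (rule gauss_attained)
  ultimately show "gauss f \<le> B" by metis
qed (use N_coeff_le_gauss order_trans in blast)

lemma gauss_less_iff: "gauss f < B \<longleftrightarrow> (\<forall>i. N (coeff f i) < B)"
proof
  assume "\<forall>i. N (coeff f i) < B"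
  moreover obtain i where "N (coeff f i) = gauss f" by (rule gauss_attained)
  ultimately show "gauss f < B" by metis
qed (use N_coeff_le_gauss le_less_trans in blast)

lemma gauss_eq_0_iff [simp]: "gauss f = 0 \<longleftrightarrow> f = 0"
proof
  assume "gauss f = 0"
  then have "N (coeff f i) = 0" for i using N_coeff_le_gauss[of f i] N_nonneg[of "coeff f i"] by simp
  then show "f = 0" by (simp add: poly_eq_iff)
qed (simp add: gauss_def)

lemma gauss_zero [simp]: "gauss 0 = 0"
  by simp

lemma gauss_pos_iff [simp]: "0 < gauss f \<longleftrightarrow> f \<noteq> 0"
  using gauss_nonneg[of f] gauss_eq_0_iff[of f] by linarith

lemma gauss_pCons: "gauss (pCons c f) = max (N c) (gauss f)"
proof (rule antisym)
  show "gauss (pCons c f) \<le> max (N c) (gauss f)"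
    unfolding gauss_le_iff by (auto simp: coeff_pCons N_coeff_le_gauss le_max_iff_disj split: nat.split)
  have "N (coeff f i) \<le> gauss (pCons c f)" for i using N_coeff_le_gauss[of "pCons c f" "Suc i"] by simp
  then show "max (N c) (gauss f) \<le> gauss (pCons c f)"
    using N_coeff_le_gauss[of "pCons c f" 0] by (simp add: gauss_le_iff)
qed

lemma gauss_smult: "gauss (smult c f) = N c * gauss f"
proof (rule antisym)
  show "gauss (smult c f) \<le> N c * gauss f"
    by (simp add: gauss_le_iff N_mult N_coeff_le_gauss mult_left_mono)
  obtain i where "N (coeff f i) = gauss f" by (rule gauss_attained)
  then show "N c * gauss f \<le> gauss (smult c f)"
    using N_coeff_le_gauss[of "smult c f" i] by (simp add: N_mult)
qed

lemma gauss_minus: "gauss (- f) = gauss f"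
  using gauss_smult[of "- 1" f] by simp

lemma gauss_add_le: "gauss f \<le> B \<Longrightarrow> gauss g \<le> B \<Longrightarrow> gauss (f + g) \<le> B"
  and gauss_diff_le: "gauss f \<le> B \<Longrightarrow> gauss g \<le> B \<Longrightarrow> gauss (f - g) \<le> B"
  and gauss_add_less: "gauss f < B \<Longrightarrow> gauss g < B \<Longrightarrow> gauss (f + g) < B"
  by (simp_all add: gauss_le_iff gauss_less_iff N_add_le N_diff_le N_add_less)

theorem gauss_mult: "gauss (f * g) = gauss f * gauss g"
proof (cases "f = 0 \<or> g = 0")
  case False
  then have pos: "0 < gauss f" "0 < gauss g" by simp_all
  define i where "i = (LEAST i. N (coeff f i) = gauss f)"
  define j where "j = (LEAST j. N (coeff g j) = gauss g)"
  have ij: "N (coeff f i) = gauss f" "N (coeff g j) = gauss g"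
    unfolding i_def j_def using gauss_attained[of f] gauss_attained[of g]
    by (metis (mono_tags, lifting) LeastI)+
  have below: "N (coeff f l) < gauss f" if "l < i" for l
    using not_less_Least[OF that[unfolded i_def]] N_coeff_le_gauss[of f l] by linarith
  have below': "N (coeff g l) < gauss g" if "l < j" for l
    using not_less_Least[OF that[unfolded j_def]] N_coeff_le_gauss[of g l] by linarith
  have rest: "N (coeff f l * coeff g (i + j - l)) < gauss f * gauss g" if "l \<in> {..i + j} - {i}" for l
  proof (cases "l < i")
    case True
    then have "N (coeff f l) * N (coeff g (i + j - l)) \<le> N (coeff f l) * gauss g"
      by (intro mult_left_mono N_coeff_le_gauss) simp
    also have "\<dots> < gauss f * gauss g" using below[OF True] pos by simp
    finally show ?thesis by (simp add: N_mult)
  next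
    case False
    then have "i + j - l < j" using that by auto
    then have "gauss f * N (coeff g (i + j - l)) < gauss f * gauss g" using below' pos by simp
    moreover have "N (coeff f l) * N (coeff g (i + j - l)) \<le> gauss f * N (coeff g (i + j - l))"
      by (intro mult_right_mono N_coeff_le_gauss) simp
    ultimately show ?thesis by (simp add: N_mult)
  qed
  have "coeff (f * g) (i + j)
      = coeff f i * coeff g j + (\<Sum>l\<in>{..i + j} - {i}. coeff f l * coeff g (i + j - l))"
    by (simp add: coeff_mult sum.remove[of _ i])
  moreover have "N (\<Sum>l\<in>{..i + j} - {i}. coeff f l * coeff g (i + j - l)) < N (coeff f i * coeff g j)"
    using rest pos by (intro N_sum_less) (simp_all add: N_mult ij)
  ultimately have "N (coeff (f * g) (i + j)) = gauss f * gauss g"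
    by (simp add: N_add_eq_left N_mult ij)
  moreover have "gauss (f * g) \<le> gauss f * gauss g"
    unfolding gauss_le_iff coeff_mult
    by (auto intro!: N_sum_le N_mult_le N_coeff_le_gauss)
  ultimately show ?thesis using N_coeff_le_gauss[of "f * g" "i + j"] by simp
qed auto

lemma gauss_power: "gauss (f ^ n) = gauss f ^ n"
  by (induction n) (simp_all add: gauss_mult one_pCons gauss_pCons)

lemma gauss_pcompose_le: "gauss g \<le> 1 \<Longrightarrow> gauss (pcompose f g) \<le> gauss f"
proof (induction f)
  case (pCons c f)
  have "gauss (g * pcompose f g) \<le> 1 * gauss f"
    unfolding gauss_mult using pCons by (intro mult_mono) simp_all
  then show ?case
    by (simp add: pcompose_pCons gauss_pCons) (intro gauss_add_le, simp_all add: gauss_pCons)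
qed simp

lemma N_poly_le_gauss: "N t \<le> 1 \<Longrightarrow> N (poly f t) \<le> gauss f"
  using gauss_pcompose_le[of "[:t:]" f] by (simp add: pcompose_pCons_0 gauss_pCons)

text \<open>Newton interpolation: the points stay distinct in the residue field, so that the divided
  differences do not grow.\<close>

lemma gauss_le_of_values:
  assumes "finite S" "\<And>s t. s \<in> S \<Longrightarrow> t \<in> S \<Longrightarrow> s \<noteq> t \<Longrightarrow> N (s - t) = 1"
    and "\<And>s. s \<in> S \<Longrightarrow> N s \<le> 1" "degree g < card S"
    and "\<And>s. s \<in> S \<Longrightarrow> N (poly g s) \<le> B" "0 \<le> B"
  shows "gauss g \<le> B"
  using assms
proof (induction "card S" arbitrary: S g)
  case 0
  then show ?case by simp
next
  case (Suc n)
  then obtain s where s: "s \<in> S" by (metis card_gt_0_iff ex_in_conv zero_less_Suc)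
  define h where "h = synthetic_div g s"
  have g: "g = [:-s, 1:] * h + [:poly g s:]"
    unfolding h_def by (rule synthetic_div_correct'[symmetric])
  have "gauss h \<le> B"
  proof (cases "degree g = 0")
    case True
    then show ?thesis
      using Suc.prems(6) by (simp add: h_def synthetic_div_eq_0_iff[THEN iffD2])
  next
    case False
    show ?thesis
    proof (rule Suc.hyps(1)[of "S - {s}"])
      show "n = card (S - {s})" using Suc.hyps(2) s Suc.prems(1) by simp
      show "degree h < card (S - {s})"
        using Suc.prems(4) False s Suc.prems(1) by (simp add: h_def degree_synthetic_div)
      fix t assume t: "t \<in> S - {s}"
      have "(t - s) * poly h t = poly g t - poly g s"
        using arg_cong[OF g, of "\<lambda>p. poly p t"] by (simp add: algebra_simps)
      then have "N (t - s) * N (poly h t) \<le> B"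
        using N_diff_le Suc.prems(5) s t by (metis DiffD1 N_mult)
      moreover have "N (t - s) = 1" using Suc.prems(2) s t by blast
      ultimately show "N (poly h t) \<le> B" by simp
    qed (use Suc.prems in auto)
  qed
  moreover have "gauss [:-s, 1:] = 1" using Suc.prems(3)[OF s] by (simp add: gauss_pCons)
  ultimately have "gauss ([:-s, 1:] * h) \<le> B" unfolding gauss_mult by simp
  moreover have "gauss [:poly g s:] \<le> B" using Suc.prems(5)[OF s] Suc.prems(6)
    by (simp add: gauss_pCons)
  ultimately show ?case by (subst g) (rule gauss_add_le)
qed

end

lemma pcompose_conv_sum:
  fixes v :: "'a::comm_ring_1 poly"
  assumes "degree v \<le> n"
  shows "pcompose v g = (\<Sum>i\<le>n. smult (coeff v i) (g ^ i))"
proof -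
  have monom: "pcompose (monom c i) g = smult c (g ^ i)" for c :: 'a and i
    by (induction i) (auto simp: monom_0 monom_Suc pcompose_pCons algebra_simps)
  have "pcompose v g = pcompose (\<Sum>i\<le>n. monom (coeff v i) i) g"
    using assms by (simp add: poly_as_sum_of_monoms')
  then show ?thesis by (simp add: pcompose_sum monom)
qed

lemma degree_linear_power_le: "degree ([:x, y:] ^ n) \<le> n"
  using degree_power_le[of "[:x, y:]" n] by (simp split: if_splits)

lemma coeff_linear_power:
  fixes x y :: "'a::comm_ring_1"
  shows "coeff ([:x, y:] ^ n) j = of_nat (n choose j) * y ^ j * x ^ (n - j)"
proof (cases "j \<le> n")
  case False
  then show ?thesis using degree_linear_power_le[of x y n] by (simp add: coeff_eq_0 binomial_eq_0)
qed (rule coeff_linear_poly_power)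

lemma coeff_pcompose_affine:
  fixes v :: "'a::comm_ring_1 poly"
  assumes "degree v \<le> n"
  shows "coeff (pcompose v [:x, y:]) j = y ^ j * (\<Sum>i\<le>n. coeff v i * of_nat (i choose j) * x ^ (i - j))"
  unfolding pcompose_conv_sum[OF assms]
  by (simp add: coeff_sum coeff_linear_power sum_distrib_left mult_ac)

lemma dvd_binomial_of_mod_less:
  fixes p q :: nat
  assumes "\<And>i. 0 < i \<Longrightarrow> i < q \<Longrightarrow> p dvd (q choose i)" "i mod q < j mod q"
  shows "p dvd (i choose j)"
proof (cases "q = 0")
  case True
  then show ?thesis using assms(2) by (simp add: binomial_eq_0)
next
  case False
  have "p dvd ((d * q + r) choose j)" if "r < j mod q" for d r
    using that
  proof (induction d arbitrary: j)
    case 0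
    then have "r < j" using mod_less_eq_dividend[of j q] by linarith
    then show ?case by (simp add: binomial_eq_0)
  next
    case (Suc d)
    have "((q + (d * q + r)) choose j) = (\<Sum>i\<le>j. (q choose i) * ((d * q + r) choose (j - i)))"
      by (rule vandermonde[symmetric])
    moreover have "p dvd (q choose i) * ((d * q + r) choose (j - i))" if "i \<le> j" for i
    proof -
      consider "0 < i" "i < q" | "i = 0" | "i = q" | "i > q" by linarith
      then show ?thesis
      proof cases
        case 3
        then have "r < (j - i) mod q" using Suc.prems that by (metis le_mod_geq)
        then show ?thesis using Suc.IH by simp
      qed (use assms(1) Suc in \<open>auto simp: binomial_eq_0\<close>)
    qed
    ultimately show ?case by (simp add: add.assoc) (rule dvd_sum, blast)
  qed
  from this[of "i mod q" "i div q"] show ?thesis using assms(2) by simp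
qed

section \<open>Teichmueller digits and division by \<open>\<theta>\<close>\<close>

locale digit_system = nonarch N for N :: "'c::field \<Rightarrow> real" +
  fixes \<omega> :: 'c and L :: "'c set" and q :: nat
  assumes finite_L: "finite L" and card_L: "card L = q" and q_ge_2: "2 \<le> q"
    and L_power_q: "\<And>t. t \<in> L \<Longrightarrow> t ^ q = t"
    and L_separated: "\<And>s t. s \<in> L \<Longrightarrow> t \<in> L \<Longrightarrow> s \<noteq> t \<Longrightarrow> N (s - t) = 1"
    and zero_in_L: "0 \<in> L"
    and N_omega_pos: "0 < N \<omega>" and N_omega_less_one: "N \<omega> < 1"
    and N_q_le_omega: "N (of_nat q) \<le> N \<omega>"
begin

lemma omega_power_mono: "i \<le> j \<Longrightarrow> N \<omega> ^ j \<le> N \<omega> ^ i"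
  using N_omega_pos N_omega_less_one by (intro power_decreasing) auto

lemma omega_power_strict_mono: "i < j \<Longrightarrow> N \<omega> ^ j < N \<omega> ^ i"
  using N_omega_pos N_omega_less_one by (intro power_strict_decreasing) auto

lemma omega_power_le_one: "N \<omega> ^ j \<le> 1"
  using omega_power_mono[of 0 j] by simp

lemma N_digit_le_one: "t \<in> L \<Longrightarrow> N t \<le> 1"
proof (rule ccontr)
  assume t: "t \<in> L" and "\<not> N t \<le> 1"
  then have "N t ^ 1 < N t ^ q" using q_ge_2 by (intro power_strict_increasing) auto
  then show False using arg_cong[OF L_power_q[OF t], of N] by (simp add: N_power)
qed

lemma N_digit_power_le_one: "t \<in> L \<Longrightarrow> N (t ^ n) \<le> 1"
  by (intro N_power_le_one N_digit_le_one)

definition T_plus :: "'c \<Rightarrow> 'c poly \<Rightarrow> 'c poly" where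
  "T_plus t v = pcompose v [:- t, \<omega>:]"

lemma T_plus_add: "T_plus t (u + v) = T_plus t u + T_plus t v"
  and T_plus_diff: "T_plus t (u - v) = T_plus t u - T_plus t v"
  and T_plus_mult: "T_plus t (u * v) = T_plus t u * T_plus t v"
  and T_plus_smult: "T_plus t (smult c v) = smult c (T_plus t v)"
  by (simp_all add: T_plus_def pcompose_add pcompose_diff pcompose_mult pcompose_smult)

lemma coeff_T_plus:
  "degree v \<le> n \<Longrightarrow>
    coeff (T_plus t v) j = \<omega> ^ j * (\<Sum>i\<le>n. coeff v i * of_nat (i choose j) * (- t) ^ (i - j))"
  unfolding T_plus_def by (rule coeff_pcompose_affine)

lemma coeff_T_plus_top:
  assumes "degree v \<le> n" shows "coeff (T_plus t v) n = \<omega> ^ n * coeff v n"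
proof -
  have "(\<Sum>i\<le>n. coeff v i * of_nat (i choose n) * (- t) ^ (i - n))
      = (\<Sum>i\<in>{n}. coeff v i * of_nat (i choose n) * (- t) ^ (i - n))"
    by (intro sum.mono_neutral_right) (auto simp: binomial_eq_0)
  then show ?thesis by (simp add: coeff_T_plus[OF assms])
qed

lemma coeff_T_plus_0_left: "coeff (T_plus 0 v) j = \<omega> ^ j * coeff v j"
  by (simp add: T_plus_def coeff_pcompose_linear)

lemma coeff_T_plus_0: "coeff (T_plus t v) 0 = poly v (- t)"
  by (simp add: T_plus_def pcompose_coeff_0)

lemma N_binomial_term_le:
  assumes "t \<in> L" "N x \<le> B"
  shows "N (x * of_nat n * (- t) ^ m) \<le> B"
  using N_mult_le[OF N_mult_le[OF assms(2) N_of_nat_le_one[of n]], of "(- t) ^ m" 1]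
    N_digit_power_le_one[OF assms(1), of m] by (simp add: N_power)

lemma N_coeff_T_plus_le:
  assumes "t \<in> L"
  shows "N (coeff (T_plus t v) j) \<le> N \<omega> ^ j * gauss v"
  unfolding coeff_T_plus[OF order_refl] N_mult N_power
  by (intro mult_left_mono N_sum_le N_binomial_term_le assms N_coeff_le_gauss) auto

lemma gauss_T_plus_le: "t \<in> L \<Longrightarrow> gauss (T_plus t v) \<le> gauss v"
  unfolding T_plus_def using N_digit_le_one N_omega_less_one
  by (intro gauss_pcompose_le) (simp add: gauss_pCons)

text \<open>The supremum of \<open>v\<close> on the union of the discs of radius \<open>|\<omega>|\<close> around the points \<open>- t\<close>.\<close>

definition disc_norm :: "'c poly \<Rightarrow> real" where
  "disc_norm v = Max ((\<lambda>t. gauss (T_plus t v)) ` L)"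

lemma disc_norm_le_iff: "disc_norm v \<le> B \<longleftrightarrow> (\<forall>t\<in>L. gauss (T_plus t v) \<le> B)"
  and disc_norm_less_iff: "disc_norm v < B \<longleftrightarrow> (\<forall>t\<in>L. gauss (T_plus t v) < B)"
  unfolding disc_norm_def using finite_L zero_in_L by (subst Max_le_iff Max_less_iff; auto)+

lemma gauss_T_plus_le_disc_norm: "t \<in> L \<Longrightarrow> gauss (T_plus t v) \<le> disc_norm v"
  using disc_norm_le_iff by blast

lemma disc_norm_nonneg: "0 \<le> disc_norm v"
  by (rule order_trans[OF gauss_nonneg gauss_T_plus_le_disc_norm[OF zero_in_L]])

lemma N_poly_le_disc_norm: "t \<in> L \<Longrightarrow> N (poly v (- t)) \<le> disc_norm v"
  using gauss_T_plus_le_disc_norm[of t v] N_coeff_le_gauss[of "T_plus t v" 0]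
  by (simp add: coeff_T_plus_0)

lemma gauss_le_of_digit_values:
  assumes "degree g < q" "\<And>t. t \<in> L \<Longrightarrow> N (poly g (- t)) \<le> B"
  shows "gauss g \<le> B"
proof (rule gauss_le_of_values[of "uminus ` L"])
  show "0 \<le> B" by (rule order_trans[OF N_nonneg assms(2)[OF zero_in_L]])
  show "degree g < card (uminus ` L)" using assms(1) card_L by (simp add: card_image)
  show "N (s - t) = 1" if "s \<in> uminus ` L" "t \<in> uminus ` L" "s \<noteq> t" for s t
    using that L_separated N_minus_commute by fastforce
qed (use assms finite_L N_digit_le_one in auto)

lemma gauss_less_of_digit_values:
  assumes "degree g < q" "\<And>t. t \<in> L \<Longrightarrow> N (poly g (- t)) < B"
  shows "gauss g < B"
proof -
  define B' where "B' = Max ((\<lambda>t. N (poly g (- t))) ` L)"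
  have "N (poly g (- t)) \<le> B'" if "t \<in> L" for t unfolding B'_def using finite_L that by simp
  then have "gauss g \<le> B'" by (rule gauss_le_of_digit_values[OF assms(1)])
  also have "B' < B" unfolding B'_def using finite_L zero_in_L assms(2) by (subst Max_less_iff) auto
  finally show ?thesis .
qed

lemma gauss_less_of_digit_values_high_coeffs:
  assumes "\<And>t. t \<in> L \<Longrightarrow> N (poly v (- t)) < B" "\<And>j. q \<le> j \<Longrightarrow> N (coeff v j) < B"
  shows "gauss v < B"
proof -
  define g where "g = poly_cutoff q v"
  have B: "0 < B" by (rule le_less_trans[OF N_nonneg assms(1)[OF zero_in_L]])
  have coeff_g: "coeff g j = (if j < q then coeff v j else 0)" for j
    by (simp add: g_def coeff_poly_cutoff)
  then have high: "gauss (v - g) < B" using assms(2) B by (simp add: gauss_less_iff)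
  have "degree g \<le> q - 1" using q_ge_2 by (intro degree_le) (auto simp: coeff_g)
  then have "degree g < q" using q_ge_2 by linarith
  moreover have "N (poly g (- t)) < B" if t: "t \<in> L" for t
  proof -
    have "N (poly (v - g) (- t)) < B"
      using N_poly_le_gauss[of "- t" "v - g"] N_digit_le_one[OF t] high by simp
    then show ?thesis using N_diff_less[OF assms(1)[OF t]] by fastforce
  qed
  ultimately have "gauss g < B" by (rule gauss_less_of_digit_values)
  from gauss_add_less[OF high this] show ?thesis by simp
qed

definition sign_q :: 'c where "sign_q = (- 1) ^ (q + 1)"

definition theta :: "'c poly" where "theta = monom 1 q - monom sign_q 1"

lemma N_sign_q [simp]: "N sign_q = 1"
  by (simp add: sign_q_def N_power)

lemma sign_q_square [simp]: "sign_q * sign_q = 1"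
  by (simp add: sign_q_def flip: power_mult_distrib)

lemma coeff_theta: "coeff theta j = (if j = q then 1 else if j = 1 then - sign_q else 0)"
  using q_ge_2 by (simp add: theta_def)

lemma degree_theta: "degree theta = q"
proof (rule antisym)
  show "degree theta \<le> q" using q_ge_2 by (intro degree_le) (auto simp: coeff_theta)
  show "q \<le> degree theta" by (intro le_degree) (simp add: coeff_theta)
qed

lemma theta_nonzero [simp]: "theta \<noteq> 0"
  using coeff_theta[of q] by auto

lemma poly_theta: "t \<in> L \<Longrightarrow> poly theta (- t) = 0"
  using L_power_q[of t] by (simp add: theta_def poly_monom sign_q_def power_minus[of t])

lemma coeff_mod_div_theta:
  "coeff v j = coeff (v mod theta) j + (if q \<le> j then coeff (v div theta) (j - q) else 0)
     - (if 1 \<le> j then sign_q * coeff (v div theta) (j - 1) else 0)"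
proof -
  have "theta * (v div theta) = monom 1 q * (v div theta) - monom sign_q 1 * (v div theta)"
    unfolding theta_def[symmetric] by (simp add: theta_def algebra_simps)
  moreover have "coeff v j = coeff (v mod theta) j + coeff (theta * (v div theta)) j"
    using mod_mult_div_eq[of v theta] by (simp flip: coeff_add)
  ultimately show ?thesis by (simp add: coeff_monom_mult not_less)
qed

lemma degree_mod_theta: "degree (v mod theta) < q"
  using degree_mod_less[of theta v] degree_theta q_ge_2 by auto

lemma coeff_mod_theta_eq_0: "q \<le> j \<Longrightarrow> coeff (v mod theta) j = 0"
  using degree_mod_theta[of v] by (simp add: coeff_eq_0)

lemma degree_div_theta:
  assumes "degree v \<le> Suc D * q + s" shows "degree (v div theta) \<le> D * q + s"
proof (cases "v div theta = 0")
  case False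
  then have "q + degree (v div theta) = degree (theta * (v div theta))"
    by (simp add: degree_mult_eq degree_theta)
  also have "\<dots> = degree (v - v mod theta)" by (simp add: minus_mod_eq_mult_div)
  also have "\<dots> \<le> max (degree v) (degree (v mod theta))" by (rule degree_diff_le_max)
  finally show ?thesis using assms degree_mod_theta[of v] by auto
qed simp

lemma poly_mod_theta:
  assumes "t \<in> L" shows "poly (v mod theta) (- t) = poly v (- t)"
proof -
  have "poly (v mod theta) (- t) = poly (v mod theta + theta * (v div theta)) (- t)"
    unfolding poly_add poly_mult by (simp add: poly_theta assms)
  then show ?thesis by simp
qed

lemma gauss_mod_theta_le:
  "(\<And>t. t \<in> L \<Longrightarrow> N (poly v (- t)) \<le> B) \<Longrightarrow> gauss (v mod theta) \<le> B"
  by (intro gauss_le_of_digit_values degree_mod_theta) (simp add: poly_mod_theta)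

lemma gauss_mod_theta_le_disc_norm: "gauss (v mod theta) \<le> disc_norm v"
  by (intro gauss_mod_theta_le N_poly_le_disc_norm)

lemma coeff_T_plus_theta_1:
  "coeff (T_plus t theta) 1 = \<omega> * (of_nat q * (- t) ^ (q - 1) - sign_q)"
proof -
  have "(\<Sum>i\<le>q. coeff theta i * of_nat (i choose 1) * (- t) ^ (i - 1))
      = (\<Sum>i\<in>{q, 1}. coeff theta i * of_nat (i choose 1) * (- t) ^ (i - 1))"
    using q_ge_2 by (intro sum.mono_neutral_right) (auto simp: coeff_theta)
  then show ?thesis
    using q_ge_2 coeff_T_plus[of theta q t 1] by (simp add: degree_theta coeff_theta)
qed

lemma N_coeff_T_plus_theta_1:
  assumes "t \<in> L" shows "N (coeff (T_plus t theta) 1) = N \<omega>"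
proof -
  have "N (of_nat q * (- t) ^ (q - 1)) < N (- sign_q)"
    using N_binomial_term_le[OF assms N_q_le_omega, of 1 "q - 1"] N_omega_less_one by simp
  from N_add_eq_left[OF this] show ?thesis
    unfolding coeff_T_plus_theta_1 by (simp add: N_mult add.commute)
qed

text \<open>On the disc around \<open>- t\<close> the polynomial \<open>\<theta>\<close> is \<open>\<omega> y\<close> times a polynomial with unit
  constant term, so that dividing by \<open>\<theta>\<close> costs exactly one factor \<open>\<omega>\<close>.\<close>

lemma T_plus_theta:
  assumes "t \<in> L"
  obtains E where "T_plus t theta = smult \<omega> (pCons 0 E)" "gauss E = 1"
proof -
  define E where "E = smult (inverse \<omega>) (poly_shift 1 (T_plus t theta))"
  have coeff_E: "\<omega> * coeff E j = coeff (T_plus t theta) (Suc j)" for j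
    using N_omega_pos by (auto simp: E_def coeff_poly_shift simp flip: mult.assoc)
  have eq: "T_plus t theta = smult \<omega> (pCons 0 E)"
  proof (rule poly_eqI)
    show "coeff (T_plus t theta) j = coeff (smult \<omega> (pCons 0 E)) j" for j
      using coeff_T_plus_0[of t theta] poly_theta[OF assms] coeff_E by (cases j) auto
  qed
  have "gauss theta \<le> 1" by (simp add: gauss_le_iff coeff_theta)
  have le: "gauss E \<le> 1" unfolding gauss_le_iff
  proof
    fix j
    have "N (\<omega> * coeff E j) \<le> N \<omega> ^ Suc j * gauss theta"
      unfolding coeff_E by (rule N_coeff_T_plus_le[OF assms])
    also have "\<dots> \<le> N \<omega> ^ 1 * 1"
      using \<open>gauss theta \<le> 1\<close> by (intro mult_mono omega_power_mono) simp_all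
    finally show "N (coeff E j) \<le> 1" using N_omega_pos by (simp add: N_mult)
  qed
  have "N (\<omega> * coeff E 0) = N \<omega>" unfolding coeff_E using N_coeff_T_plus_theta_1[OF assms] by simp
  then have "N (coeff E 0) = 1" using N_omega_pos by (simp add: N_mult)
  then have "gauss E = 1" using le N_coeff_le_gauss[of E 0] by simp
  with eq show thesis by (rule that)
qed

lemma disc_norm_div_theta_le: "N \<omega> * disc_norm (v div theta) \<le> disc_norm v"
proof -
  have "gauss (T_plus t (v div theta)) \<le> disc_norm v / N \<omega>" if t: "t \<in> L" for t
  proof -
    obtain E where E: "T_plus t theta = smult \<omega> (pCons 0 E)" "gauss E = 1"
      by (rule T_plus_theta[OF t])
    have "T_plus t v - T_plus t (v mod theta) = T_plus t theta * T_plus t (v div theta)"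
      by (simp add: minus_mod_eq_mult_div flip: T_plus_diff T_plus_mult)
    also have "gauss \<dots> = N \<omega> * gauss (T_plus t (v div theta))"
      by (simp add: E gauss_smult gauss_pCons gauss_mult)
    finally have "N \<omega> * gauss (T_plus t (v div theta)) = gauss (T_plus t v - T_plus t (v mod theta))" ..
    also have "\<dots> \<le> disc_norm v"
      by (intro gauss_diff_le gauss_T_plus_le_disc_norm t
          order_trans[OF gauss_T_plus_le gauss_mod_theta_le_disc_norm])
    finally show ?thesis using N_omega_pos by (simp add: field_simps)
  qed
  then have "disc_norm (v div theta) \<le> disc_norm v / N \<omega>" unfolding disc_norm_le_iff by blast
  then show ?thesis using N_omega_pos by (simp add: field_simps)
qed

lemma gauss_le_of_mod_div_theta:
  assumes "gauss (v mod theta) \<le> B" "gauss (v div theta) \<le> B"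
  shows "gauss v \<le> B"
  unfolding gauss_le_iff
proof
  fix i
  have "N (coeff (v mod theta) i) \<le> B" "\<And>j. N (coeff (v div theta) j) \<le> B"
    using assms by (simp_all add: gauss_le_iff)
  moreover have "0 \<le> B" using order_trans[OF gauss_nonneg assms(1)] .
  ultimately show "N (coeff v i) \<le> B"
    unfolding coeff_mod_div_theta[of v i] by (auto intro!: N_add_le N_diff_le simp: N_mult)
qed

lemma gauss_le_disc_norm:
  assumes "degree v \<le> D * q + s" "s < q"
  shows "N \<omega> ^ D * gauss v \<le> disc_norm v"
  using assms
proof (induction D arbitrary: v)
  case 0
  then have "gauss v \<le> disc_norm v" by (intro gauss_le_of_digit_values N_poly_le_disc_norm) simp
  then show ?case by simp
next
  case (Suc D)
  define B where "B = disc_norm v / N \<omega> ^ Suc D"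
  have "N \<omega> ^ Suc D * gauss (v div theta) \<le> N \<omega> * disc_norm (v div theta)"
    using mult_left_mono[OF Suc.IH[OF degree_div_theta[OF Suc.prems(1)] Suc.prems(2)], of "N \<omega>"]
    by (simp add: mult.assoc)
  also have "\<dots> \<le> disc_norm v" by (rule disc_norm_div_theta_le)
  finally have "gauss (v div theta) \<le> B"
    unfolding B_def using N_omega_pos by (simp add: pos_le_divide_eq mult.commute)
  moreover have "N \<omega> ^ Suc D * disc_norm v \<le> 1 * disc_norm v"
    by (intro mult_right_mono omega_power_le_one disc_norm_nonneg)
  then have "disc_norm v \<le> B"
    unfolding B_def using N_omega_pos by (simp add: pos_le_divide_eq mult.commute)
  then have "gauss (v mod theta) \<le> B" by (rule order_trans[OF gauss_mod_theta_le_disc_norm])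
  ultimately have "gauss v \<le> B" by (rule gauss_le_of_mod_div_theta[rotated])
  then show ?case unfolding B_def using N_omega_pos by (simp add: pos_le_divide_eq mult.commute)
qed

text \<open>The exponents of the monomials of \<open>y^s \<theta>^D\<close>.\<close>

definition theta_exponent :: "nat \<Rightarrow> nat \<Rightarrow> nat \<Rightarrow> nat" where
  "theta_exponent D s t = (D - t) * q + s + t"

lemma theta_exponent_mod: "s + t < q \<Longrightarrow> theta_exponent D s t mod q = s + t"
  unfolding theta_exponent_def by (metis add.assoc mod_less mod_mult_self3)

lemma coeff_div_theta_top:
  assumes "degree v \<le> Suc D * q + r" "s \<le> r" "r + Suc D < q"
  shows "coeff v (theta_exponent (Suc D) s 0) = coeff (v div theta) (theta_exponent D s 0)"
proof -
  let ?j = "Suc D * q + s"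
  have "degree (v div theta) \<le> D * q + r" by (rule degree_div_theta[OF assms(1)])
  moreover have "D * q + r < ?j - 1" using assms by simp
  ultimately have "coeff (v div theta) (?j - 1) = 0" by (simp add: coeff_eq_0)
  then show ?thesis
    unfolding theta_exponent_def using coeff_mod_div_theta[of v ?j] by (simp add: coeff_mod_theta_eq_0)
qed

lemma N_coeff_div_theta_le:
  assumes "gauss (v mod theta) \<le> C" "N (coeff v (Suc j)) \<le> C"
    and "q \<le> Suc j \<Longrightarrow> N (coeff (v div theta) (Suc j - q)) \<le> C"
  shows "N (coeff (v div theta) j) \<le> C"
proof -
  have "N (coeff (v mod theta) (Suc j)) \<le> C" using assms(1) by (simp add: gauss_le_iff)
  moreover have "sign_q * coeff (v div theta) j = coeff (v mod theta) (Suc j)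
      + (if q \<le> Suc j then coeff (v div theta) (Suc j - q) else 0) - coeff v (Suc j)"
    using coeff_mod_div_theta[of v "Suc j"] by (simp add: algebra_simps)
  ultimately have "N (sign_q * coeff (v div theta) j) \<le> C"
    using assms(2,3) by (cases "q \<le> Suc j") (auto intro!: N_add_le N_diff_le)
  then show ?thesis by (simp add: N_mult)
qed

lemma N_coeff_div_theta_exponent_le:
  assumes "s + Suc D < q" "gauss (v mod theta) \<le> C"
    and "\<And>t. l < t \<Longrightarrow> t \<le> Suc D \<Longrightarrow> N (coeff v (theta_exponent (Suc D) s t)) \<le> C"
    and "l \<le> t" "t \<le> D"
  shows "N (coeff (v div theta) (theta_exponent D s t)) \<le> C"
  using assms(5,4)
proof (induction t rule: inc_induct)
  case base
  show ?case
    by (rule N_coeff_div_theta_le[OF assms(2)])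
      (use base assms(1) assms(3)[of "Suc D"] in \<open>auto simp: theta_exponent_def\<close>)
next
  case (step t)
  obtain m where m: "D = Suc (t + m)" using step.hyps less_iff_Suc_add by auto
  have "Suc (theta_exponent D s t) = theta_exponent (Suc D) s (Suc t)"
    "Suc (theta_exponent D s t) - q = theta_exponent D s (Suc t)"
    by (simp_all add: theta_exponent_def m)
  then show ?case
    using N_coeff_div_theta_le[OF assms(2), of "theta_exponent D s t"]
      assms(3)[of "Suc t"] step by simp
qed

lemma N_top_coeff_le:
  assumes "l < D" "degree v \<le> D * q + r" "s \<le> r" "r + D < q" "disc_norm v \<le> B"
    and "\<And>t. l < t \<Longrightarrow> t \<le> D \<Longrightarrow> N \<omega> ^ l * N (coeff v (theta_exponent D s t)) \<le> B"
  shows "N \<omega> ^ l * N (coeff v (theta_exponent D s 0)) \<le> B"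
  using assms
proof (induction l arbitrary: D v B)
  case (0 D v B)
  obtain D' where D: "D = Suc D'" using 0(1) gr0_implies_Suc by blast
  have "N (coeff (v div theta) (theta_exponent D' s 0)) \<le> B"
    using 0(3-6) gauss_mod_theta_le_disc_norm[of v] unfolding D
    by (intro N_coeff_div_theta_exponent_le[of s D' v B 0]) auto
  then show ?case using coeff_div_theta_top[of v D' r s] 0 D by simp
next
  case (Suc l)
  obtain D' where D: "D = Suc D'" using Suc.prems(1) by (cases D) auto
  define C where "C = B / N \<omega> ^ Suc l"
  have le_C: "x \<le> C \<longleftrightarrow> N \<omega> ^ Suc l * x \<le> B" for x
    unfolding C_def using N_omega_pos by (simp add: pos_le_divide_eq mult.commute)
  have "N \<omega> ^ Suc l * disc_norm v \<le> 1 * disc_norm v"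
    by (intro mult_right_mono omega_power_le_one disc_norm_nonneg)
  then have "disc_norm v \<le> C" using Suc.prems(5) by (simp add: le_C del: power_Suc)
  then have mod_C: "gauss (v mod theta) \<le> C" by (rule order_trans[OF gauss_mod_theta_le_disc_norm])
  have "N \<omega> ^ l * N (coeff (v div theta) (theta_exponent D' s 0)) \<le> B / N \<omega>"
  proof (rule Suc.IH)
    show "l < D'" "r + D' < q" "s \<le> r" using Suc.prems D by auto
    show "degree (v div theta) \<le> D' * q + r" using degree_div_theta Suc.prems(2) D by blast
    have "N \<omega> * disc_norm (v div theta) \<le> B"
      by (rule order_trans[OF disc_norm_div_theta_le Suc.prems(5)])
    then show "disc_norm (v div theta) \<le> B / N \<omega>" using N_omega_pos by (simp add: field_simps)
    show "N \<omega> ^ l * N (coeff (v div theta) (theta_exponent D' s t)) \<le> B / N \<omega>"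
      if "l < t" "t \<le> D'" for t
    proof -
      have "N (coeff (v div theta) (theta_exponent D' s t)) \<le> C"
        using Suc.prems D that mod_C
        by (intro N_coeff_div_theta_exponent_le[of s D' v C "Suc l" t]) (auto simp: le_C simp del: power_Suc)
      then show ?thesis unfolding le_C using N_omega_pos by (simp add: field_simps)
    qed
  qed
  then show ?case
    using coeff_div_theta_top[of v D' r s] Suc.prems D N_omega_pos by (simp add: field_simps)
qed

end

section \<open>The two halves of the Hecke operator on polynomials\<close>

locale hecke_tree = digit_system N \<omega> L q
  for N :: "'c::field \<Rightarrow> real" and \<omega> :: 'c and L :: "'c set" and q :: nat +
  fixes a :: 'c and p d r k :: nat
  assumes N_a_pos: "0 < N a" and N_a_less_one: "N a < 1"
    and N_p_le_a: "N (of_nat p) \<le> N a"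
    and p_dvd_binomial: "\<And>i. 0 < i \<Longrightarrow> i < q \<Longrightarrow> p dvd (q choose i)"
    and k_eq: "k = d * q + r" and r_d_less_q: "r + d < q"
begin

definition U :: "'c poly \<Rightarrow> 'c poly" where
  "U v = (\<Sum>i\<le>k. monom (\<omega> ^ (k - i) * coeff v i) i)"

definition T_minus :: "'c \<Rightarrow> 'c poly \<Rightarrow> 'c poly" where
  "T_minus s v = pcompose (U v) [:s, 1:]"

lemma coeff_U: "coeff (U v) i = (if i \<le> k then \<omega> ^ (k - i) * coeff v i else 0)"
  by (simp add: U_def coeff_sum)

lemma degree_U: "degree (U v) \<le> k"
  by (intro degree_le) (simp add: coeff_U)

lemma U_zero [simp]: "U 0 = 0"
  by (simp add: U_def)

lemma N_coeff_U_le: "l \<le> k - i \<Longrightarrow> N (coeff (U v) i) \<le> N \<omega> ^ l * N (coeff v i)"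
  using omega_power_mono[of l "k - i"] by (simp add: coeff_U N_mult N_power mult_right_mono)

lemma gauss_U_le: "gauss (U v) \<le> gauss v"
  using order_trans[OF N_coeff_U_le[of 0, simplified] N_coeff_le_gauss] by (simp add: gauss_le_iff)

lemma T_minus_add: "T_minus s (u + v) = T_minus s u + T_minus s v"
  and T_minus_smult: "T_minus s (smult c v) = smult c (T_minus s v)"
proof -
  have "U (u + v) = U u + U v" "U (smult c v) = smult c (U v)"
    by (auto intro!: poly_eqI simp: coeff_U algebra_simps)
  then show "T_minus s (u + v) = T_minus s u + T_minus s v"
    "T_minus s (smult c v) = smult c (T_minus s v)"
    by (simp_all add: T_minus_def pcompose_add pcompose_smult)
qed

lemma coeff_T_minus:
  "coeff (T_minus s v) j = (\<Sum>i\<le>k. coeff (U v) i * of_nat (i choose j) * s ^ (i - j))"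
  unfolding T_minus_def coeff_pcompose_affine[OF degree_U] by simp

lemma coeff_T_minus_top: "coeff (T_minus s v) k = coeff v k"
proof -
  have "coeff (T_minus s v) k = (\<Sum>i\<in>{k}. coeff (U v) i * of_nat (i choose k) * s ^ (i - k))"
    unfolding coeff_T_minus by (intro sum.mono_neutral_right) (auto simp: binomial_eq_0)
  then show ?thesis by (simp add: coeff_U)
qed

lemma N_q_le_a: "N (of_nat q) \<le> N a"
  using p_dvd_binomial[of 1] q_ge_2 N_of_nat_dvd_mono[of p q] N_p_le_a by simp

lemma N_binomial_le_a: "i mod q < j mod q \<Longrightarrow> N (of_nat (i choose j)) \<le> N a"
  using dvd_binomial_of_mod_less[OF p_dvd_binomial] N_of_nat_dvd_mono N_p_le_a order_trans by blast

lemma N_a_mult_less: "0 < x \<Longrightarrow> N a * x < x"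
  using N_a_less_one by simp

end

section \<open>Approximate solutions on the tree\<close>

locale hecke_solution = hecke_tree N \<omega> L q a p d r k
  for N :: "'c::field \<Rightarrow> real" and \<omega> :: 'c and L :: "'c set" and q :: nat and a :: 'c
    and p d r k :: nat +
  fixes f :: "'c list \<Rightarrow> 'c poly" and M :: nat and \<eta> :: real
  assumes degree_f: "\<And>w. degree (f w) \<le> k"
    and f_vanish: "\<And>w. M < length w \<Longrightarrow> f w = 0"
    and equation: "\<And>w t. w \<in> lists L \<Longrightarrow> t \<in> L \<Longrightarrow>
      gauss (smult a (f (t # w)) - T_plus t (f w) - (\<Sum>s\<in>L. T_minus s (f (s # t # w)))) \<le> \<eta>"
begin

definition children_sum :: "'c list \<Rightarrow> 'c poly" where
  "children_sum z = (\<Sum>s\<in>L. T_minus s (f (s # z)))"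

definition err :: "'c \<Rightarrow> 'c list \<Rightarrow> 'c poly" where
  "err t w = smult a (f (t # w)) - T_plus t (f w) - children_sum (t # w)"

lemma gauss_err_le: "w \<in> lists L \<Longrightarrow> t \<in> L \<Longrightarrow> gauss (err t w) \<le> \<eta>"
  unfolding err_def children_sum_def by (rule equation)

lemma N_coeff_err_le: "w \<in> lists L \<Longrightarrow> t \<in> L \<Longrightarrow> N (coeff (err t w) j) \<le> \<eta>"
  using gauss_err_le gauss_le_iff by blast

lemma eta_nonneg: "0 \<le> \<eta>"
  by (rule order_trans[OF gauss_nonneg gauss_err_le[OF lists.Nil zero_in_L]])

lemma coeff_child_eq:
  "a * coeff (f (t # w)) j
    = coeff (T_plus t (f w)) j + coeff (children_sum (t # w)) j + coeff (err t w) j"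
  by (simp add: err_def)

lemma coeff_T_plus_f_eq:
  "coeff (T_plus t (f w)) j
    = a * coeff (f (t # w)) j - coeff (children_sum (t # w)) j - coeff (err t w) j"
  by (simp add: err_def)

context
  fixes w t
  assumes w: "w \<in> lists L" and t: "t \<in> L"
begin

lemma N_coeff_child_le:
  assumes "N (coeff (T_plus t (f w)) j) \<le> B" "N (coeff (children_sum (t # w)) j) \<le> B" "\<eta> \<le> B"
  shows "N a * N (coeff (f (t # w)) j) \<le> B"
  unfolding N_mult[symmetric] coeff_child_eq
  using assms N_coeff_err_le[OF w t] by (intro N_add_le) (auto intro: order_trans)

lemma N_coeff_child_less:
  assumes "N (coeff (T_plus t (f w)) j) < B" "N (coeff (children_sum (t # w)) j) < B" "\<eta> < B"
  shows "N a * N (coeff (f (t # w)) j) < B"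
  unfolding N_mult[symmetric] coeff_child_eq
  using assms N_coeff_err_le[OF w t] by (intro N_add_less) (auto intro: le_less_trans)

lemma gauss_T_plus_f_le:
  assumes "N a * gauss (f (t # w)) \<le> B" "gauss (children_sum (t # w)) \<le> B" "\<eta> \<le> B"
  shows "gauss (T_plus t (f w)) \<le> B"
proof -
  have "gauss (smult a (f (t # w)) - children_sum (t # w) - err t w) \<le> B"
    using assms gauss_err_le[OF w t] by (intro gauss_diff_le) (auto simp: gauss_smult)
  then show ?thesis by (simp add: err_def)
qed

lemma gauss_T_plus_f_less:
  assumes "N a * gauss (f (t # w)) < B" "gauss (children_sum (t # w)) < B" "\<eta> < B"
  shows "gauss (T_plus t (f w)) < B"
proof -
  define B' where "B' = max (max (N a * gauss (f (t # w))) (gauss (children_sum (t # w)))) \<eta>"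
  have "gauss (T_plus t (f w)) \<le> B'" unfolding B'_def by (intro gauss_T_plus_f_le) simp_all
  also have "B' < B" unfolding B'_def using assms by simp
  finally show ?thesis .
qed

end

lemma coeff_children_sum: "coeff (children_sum z) j
    = (\<Sum>s\<in>L. \<Sum>i\<le>k. coeff (U (f (s # z))) i * of_nat (i choose j) * s ^ (i - j))"
  unfolding children_sum_def coeff_sum coeff_T_minus ..

lemma N_children_term_le:
  assumes "s \<in> L"
  shows "N (x * of_nat n * s ^ m) \<le> N x * N (of_nat n)"
  unfolding N_mult using N_digit_power_le_one[OF assms, of m] by (intro mult_left_le) auto

lemma N_coeff_children_sum_le:
  assumes "\<And>s i. s \<in> L \<Longrightarrow> i \<le> k \<Longrightarrow> N (coeff (U (f (s # z))) i) * N (of_nat (i choose j)) \<le> B" "0 \<le> B"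
  shows "N (coeff (children_sum z) j) \<le> B"
  unfolding coeff_children_sum using assms
  by (intro N_sum_le order_trans[OF N_children_term_le]) auto

lemma N_coeff_children_sum_less:
  assumes "\<And>s i. s \<in> L \<Longrightarrow> i \<le> k \<Longrightarrow> N (coeff (U (f (s # z))) i) * N (of_nat (i choose j)) < B" "0 < B"
  shows "N (coeff (children_sum z) j) < B"
  unfolding coeff_children_sum using assms
  by (intro N_sum_less le_less_trans[OF N_children_term_le]) auto

lemma N_mult_binomial_le: "N x * N (of_nat n) \<le> N x"
  by (intro mult_left_le N_of_nat_le_one N_nonneg)

lemma gauss_children_sum_le:
  assumes "\<And>s. s \<in> L \<Longrightarrow> gauss (U (f (s # z))) \<le> B"
  shows "gauss (children_sum z) \<le> B"
  unfolding gauss_le_iff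
  using order_trans[OF N_mult_binomial_le order_trans[OF N_coeff_le_gauss assms]]
    order_trans[OF gauss_nonneg assms[OF zero_in_L]]
  by (blast intro: N_coeff_children_sum_le)

lemma gauss_children_sum_less:
  assumes "\<And>s. s \<in> L \<Longrightarrow> gauss (U (f (s # z))) < B"
  shows "gauss (children_sum z) < B"
  unfolding gauss_less_iff
  using le_less_trans[OF N_mult_binomial_le le_less_trans[OF N_coeff_le_gauss assms]]
    le_less_trans[OF gauss_nonneg assms[OF zero_in_L]]
  by (blast intro: N_coeff_children_sum_less)

lemma gauss_f_le_disc_norm: "N \<omega> ^ d * gauss (f w) \<le> disc_norm (f w)"
  using gauss_le_disc_norm[of "f w" d r] degree_f[of w] r_d_less_q k_eq by simp

lemma N_coeff_T_plus_f_less: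
  assumes "disc_norm (f w) \<le> B" "t \<in> L" "d < i" "0 < B"
  shows "N (coeff (T_plus t (f w)) i) < B"
proof (cases "f w = 0")
  case False
  then have "N \<omega> ^ i * gauss (f w) < N \<omega> ^ d * gauss (f w)"
    using omega_power_strict_mono[OF assms(3)] by simp
  then show ?thesis
    using N_coeff_T_plus_le[OF assms(2), of "f w" i] gauss_f_le_disc_norm[of w] assms(1) by linarith
qed (use assms in \<open>simp add: T_plus_def\<close>)

lemma N_coeff_T_plus_f_less_of_terms:
  assumes "t \<in> L" "0 < B" "\<And>i. i \<le> k \<Longrightarrow> N (coeff (f w) i * of_nat (i choose j)) < B"
  shows "N (coeff (T_plus t (f w)) j) < N \<omega> ^ j * B"
proof -
  have "N (coeff (f w) i * of_nat (i choose j) * (- t) ^ (i - j)) < B" if "i \<le> k" for i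
    using N_binomial_term_le[OF assms(1) order_refl, of "coeff (f w) i * of_nat (i choose j)" 1 "i - j"]
      assms(3)[OF that] by simp
  then have "N (\<Sum>i\<le>k. coeff (f w) i * of_nat (i choose j) * (- t) ^ (i - j)) < B"
    using assms(2) by (intro N_sum_less) auto
  then show ?thesis
    unfolding coeff_T_plus[OF degree_f] N_mult N_power using N_omega_pos by simp
qed

lemma finite_words: "finite {w \<in> lists L. length w \<le> n}"
  using finite_lists_length_le[OF finite_L, of n] by (simp add: lists_eq_set)

lemma longest_maximizer:
  fixes g :: "'c list \<Rightarrow> real"
  assumes long: "\<forall>w. M < length w \<longrightarrow> g w = 0" and nonneg: "\<And>w. 0 \<le> g w"
    and w0: "w0 \<in> lists L" "P w0"
  obtains z where "z \<in> lists L" "P z" "\<forall>w\<in>lists L. P w \<longrightarrow> g w \<le> g z"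
    "0 < g z \<longrightarrow> (\<forall>w\<in>lists L. P w \<longrightarrow> length z < length w \<longrightarrow> g w < g z)"
proof -
  define X where "X = {w \<in> lists L. length w \<le> max M (length w0) \<and> P w}"
  define Y where "Y = {w \<in> X. g w = Max (g ` X)}"
  have fin: "finite X" unfolding X_def by (rule finite_subset[OF _ finite_words]) auto
  have w0X: "w0 \<in> X" using w0 by (simp add: X_def)
  have "Max (g ` X) \<in> g ` X" using fin w0X by (intro Max_in) auto
  then have "Y \<noteq> {}" unfolding Y_def by auto
  then have "Max (length ` Y) \<in> length ` Y" using fin by (intro Max_in) (auto simp: Y_def)
  then obtain z where z: "z \<in> Y" "length z = Max (length ` Y)" by auto
  have max: "g w \<le> g z" if w: "w \<in> lists L" "P w" for w
  proof (cases "w \<in> X")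
    case True
    then show ?thesis using z(1) fin by (simp add: Y_def)
  next
    case False
    then show ?thesis
      using w long nonneg[of z] by (cases "length w \<le> M") (auto simp: X_def)
  qed
  have longer: "g w < g z" if w: "w \<in> lists L" "P w" "length z < length w" "0 < g z" for w
  proof -
    have "length w \<le> length z" if "w \<in> Y" using that fin z(2) by (auto simp: Y_def)
    moreover have "w \<in> X \<or> g w = 0"
      using w(1,2) long by (cases "length w \<le> M") (auto simp: X_def)
    ultimately show ?thesis using w max[of w] z(1) by (fastforce simp: Y_def)
  qed
  have "z \<in> lists L" "P z" using z(1) by (auto simp: Y_def X_def)
  then show thesis using max longer that by blast
qed

lemma gauss_root_le:
  assumes "\<And>w. w \<in> lists L \<Longrightarrow> w \<noteq> [] \<Longrightarrow> gauss (f w) \<le> B" "\<eta> \<le> B"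
  shows "gauss (f []) \<le> B / N \<omega> ^ d"
proof -
  have "gauss (T_plus t (f [])) \<le> B" if t: "t \<in> L" for t
  proof (rule gauss_T_plus_f_le[OF lists.Nil t])
    have "N a * gauss (f [t]) \<le> 1 * B" using assms(1)[of "[t]"] t N_a_less_one by (intro mult_mono) auto
    then show "N a * gauss (f [t]) \<le> B" by simp
    show "gauss (children_sum [t]) \<le> B"
      using t by (intro gauss_children_sum_le order_trans[OF gauss_U_le] assms(1)) simp_all
  qed (rule assms(2))
  then have "N \<omega> ^ d * gauss (f []) \<le> B"
    using gauss_f_le_disc_norm[of "[]"] order_trans disc_norm_le_iff by blast
  then show ?thesis using N_omega_pos by (simp add: pos_le_divide_eq mult.commute)
qed

end

locale large_solution = hecke_solution N \<omega> L q a p d r k f M \<eta>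
  for N :: "'c::field \<Rightarrow> real" and \<omega> :: 'c and L :: "'c set" and q :: nat and a :: 'c
    and p d r k :: nat and f :: "'c list \<Rightarrow> 'c poly" and M :: nat and \<eta> :: real +
  fixes A :: real
  assumes A_pos: "0 < A" and gauss_f_le_A: "\<And>w. w \<in> lists L \<Longrightarrow> w \<noteq> [] \<Longrightarrow> gauss (f w) \<le> A"
    and eta_less: "\<eta> < N a * (N a * A)" and omega_power_q_less_a: "N \<omega> ^ q < N a"
begin

lemma N_a_A_pos: "0 < N a * A"
  and N_a_A_less: "N a * A < A"
  and eta_less_N_a_A: "\<eta> < N a * A"
  and eta_less_A: "\<eta> < A"
proof -
  show "0 < N a * A" "N a * A < A" using N_a_pos N_a_mult_less[OF A_pos] A_pos by simp_all
  moreover from this(1) have "N a * (N a * A) < N a * A" by (rule N_a_mult_less)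
  ultimately show "\<eta> < N a * A" "\<eta> < A" using eta_less by linarith+
qed

lemma omega_power_A_less: "q \<le> j \<Longrightarrow> N \<omega> ^ j * A < N a * A"
  using omega_power_mono[of q j] omega_power_q_less_a A_pos by simp

lemma gauss_f_less_of_gauss_U_less:
  assumes U_less: "\<And>w. w \<in> lists L \<Longrightarrow> 2 \<le> length w \<Longrightarrow> gauss (U (f w)) < N a * A"
    and z: "z \<in> lists L" "z \<noteq> []"
  shows "gauss (f z) < A"
proof -
  have children: "gauss (children_sum y) < N a * A" if "y \<in> lists L" "y \<noteq> []" for y
    using that by (intro gauss_children_sum_less U_less) (auto simp: Suc_le_eq)
  have disc: "disc_norm (f y) \<le> N a * A" if y: "y \<in> lists L" for y
    unfolding disc_norm_le_iff
  proof
    fix t assume t: "t \<in> L"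
    then have ty: "t # y \<in> lists L" using y by simp
    show "gauss (T_plus t (f y)) \<le> N a * A"
      using gauss_f_le_A[OF ty] children[OF ty] eta_less_N_a_A N_a_pos
      by (intro gauss_T_plus_f_le[OF y t]) simp_all
  qed
  obtain t w where tw: "z = t # w" "t \<in> L" "w \<in> lists L" using z by (cases z) auto
  show ?thesis
  proof (rule gauss_less_of_digit_values_high_coeffs)
    show "N (poly (f z) (- s)) < A" if "s \<in> L" for s
      using N_poly_le_disc_norm[OF that, of "f z"] disc[OF z(1)] N_a_A_less by linarith
    fix j assume "q \<le> j"
    then have "N (coeff (T_plus t (f w)) j) < N a * A"
      using N_coeff_T_plus_f_less[OF disc] tw(2,3) r_d_less_q N_a_A_pos by simp
    moreover have "N (coeff (children_sum z) j) < N a * A"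
      using children[OF z] by (simp add: gauss_less_iff)
    ultimately have "N a * N (coeff (f z) j) < N a * A"
      using tw eta_less_N_a_A unfolding tw(1) by (intro N_coeff_child_less)
    then show "N (coeff (f z) j) < A" using N_a_pos by simp
  qed
qed

end

locale critical_word = large_solution N \<omega> L q a p d r k f M \<eta> A
  for N :: "'c::field \<Rightarrow> real" and \<omega> :: 'c and L :: "'c set" and q :: nat and a :: 'c
    and p d r k :: nat and f :: "'c list \<Rightarrow> 'c poly" and M :: nat and \<eta> A :: real +
  fixes t0 :: 'c and w0 :: "'c list" and m :: real
  assumes t0: "t0 \<in> L" and w0: "w0 \<in> lists L" "w0 \<noteq> []" and m_ge: "N a * A \<le> m"
    and gauss_U_f_le: "\<And>w. w \<in> lists L \<Longrightarrow> 2 \<le> length w \<Longrightarrow> gauss (U (f w)) \<le> m"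
    and gauss_U_f_less:
      "\<And>w. w \<in> lists L \<Longrightarrow> Suc (length w0) < length w \<Longrightarrow> gauss (U (f w)) < m"
begin

lemma m_pos: "0 < m" and N_a_m_pos: "0 < N a * m"
  and N_a_N_a_A_le: "N a * (N a * A) \<le> N a * m" and eta_less_N_a_m: "\<eta> < N a * m"
  and eta_less_m: "\<eta> < m"
proof -
  show m: "0 < m" "0 < N a * m" "N a * (N a * A) \<le> N a * m"
    using m_ge N_a_A_pos N_a_pos by auto
  show "\<eta> < N a * m" "\<eta> < m" using m(3) eta_less m_ge eta_less_N_a_A by linarith+
qed

lemma gauss_f_w0_le: "gauss (f w0) \<le> A"
  by (rule gauss_f_le_A[OF w0])

lemma gauss_children_sum_f_less:
  "y \<in> lists L \<Longrightarrow> length w0 < length y \<Longrightarrow> gauss (children_sum y) < m"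
  by (intro gauss_children_sum_less gauss_U_f_less) simp_all

lemma gauss_f_less_A:
  assumes m: "m = N a * A" and y: "y \<in> lists L" "length w0 < length y"
  shows "gauss (f y) < A"
proof -
  obtain t w where tw: "y = t # w" "t \<in> L" "w \<in> lists L" using y by (cases y) auto
  then have "w \<noteq> []" using y(2) w0(2) by auto
  show ?thesis
  proof (rule gauss_less_of_digit_values_high_coeffs)
    fix s assume s: "s \<in> L"
    have "N a * gauss (f (s # y)) \<le> N a * A" using gauss_f_le_A[of "s # y"] s y N_a_pos by simp
    then have "gauss (T_plus s (f y)) < A"
      using gauss_children_sum_f_less[of "s # y"] s y N_a_A_less eta_less_A
      by (intro gauss_T_plus_f_less) (simp_all add: m)
    then show "N (poly (f y) (- s)) < A"
      using N_coeff_le_gauss[of "T_plus s (f y)" 0] by (simp add: coeff_T_plus_0)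
  next
    fix j assume "q \<le> j"
    have "N (coeff (T_plus t (f w)) j) \<le> N \<omega> ^ j * gauss (f w)" by (rule N_coeff_T_plus_le[OF tw(2)])
    also have "\<dots> \<le> N \<omega> ^ j * A" using gauss_f_le_A[OF tw(3) \<open>w \<noteq> []\<close>] by (simp add: mult_left_mono)
    also have "\<dots> < N a * A" by (rule omega_power_A_less[OF \<open>q \<le> j\<close>])
    finally have "N a * N (coeff (f y) j) < N a * A"
      using tw gauss_children_sum_f_less[OF y] eta_less_N_a_A unfolding tw(1)
      by (intro N_coeff_child_less) (simp_all add: m gauss_less_iff)
    then show "N (coeff (f y) j) < A" using N_a_pos by simp
  qed
qed

lemma N_a_gauss_f_less:
  assumes "w \<in> lists L" "length w0 < length w"
  shows "N a * gauss (f w) < m"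
proof (cases "m = N a * A")
  case True
  then show ?thesis using gauss_f_less_A[OF True assms] N_a_pos by simp
next
  case False
  have "gauss (f w) \<le> A" using assms by (intro gauss_f_le_A) auto
  then have "N a * gauss (f w) \<le> N a * A" using N_a_pos by simp
  then show ?thesis using False m_ge by linarith
qed

lemma disc_norm_f_le:
  assumes "y \<in> lists L" shows "disc_norm (f y) \<le> m"
  unfolding disc_norm_le_iff
proof
  fix t assume t: "t \<in> L"
  show "gauss (T_plus t (f y)) \<le> m"
  proof (rule gauss_T_plus_f_le[OF assms t])
    have "N a * gauss (f (t # y)) \<le> N a * A" using gauss_f_le_A[of "t # y"] assms t N_a_pos by simp
    then show "N a * gauss (f (t # y)) \<le> m" using m_ge by linarith
    show "gauss (children_sum (t # y)) \<le> m"
      using assms t by (intro gauss_children_sum_le gauss_U_f_le) simp_all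
  qed (use eta_less_m in simp)
qed

lemma disc_norm_f_less:
  assumes "y \<in> lists L" "length w0 < length y" shows "disc_norm (f y) < m"
  unfolding disc_norm_less_iff using assms eta_less_m
  by (auto intro!: gauss_T_plus_f_less N_a_gauss_f_less gauss_children_sum_f_less)

abbreviation z :: "'c list" where "z \<equiv> t0 # w0"

lemma z_word: "z \<in> lists L"
  using t0 w0 by simp

lemma N_coeff_U_z_less_low:
  assumes "d \<le> k - i" shows "N (coeff (U (f z)) i) < m"
proof -
  have "N (coeff (U (f z)) i) \<le> N \<omega> ^ d * N (coeff (f z) i)" by (rule N_coeff_U_le[OF assms])
  also have "\<dots> \<le> N \<omega> ^ d * gauss (f z)" by (simp add: N_coeff_le_gauss mult_left_mono)
  also have "\<dots> \<le> disc_norm (f z)" by (rule gauss_f_le_disc_norm)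
  also have "\<dots> < m" by (rule disc_norm_f_less[OF z_word]) simp
  finally show ?thesis .
qed

lemma N_coeff_U_z_less_top:
  assumes "l < d" "l \<le> r"
    and less: "\<And>t. l < t \<Longrightarrow> t \<le> d \<Longrightarrow> N \<omega> ^ l * N (coeff (f z) (theta_exponent d (r - l) t)) < m"
  shows "N (coeff (U (f z)) (k - l)) < m"
proof -
  define B where "B = Max ((\<lambda>t. N \<omega> ^ l * N (coeff (f z) (theta_exponent d (r - l) t))) ` {l<..d})"
  have "N \<omega> ^ l * N (coeff (f z) (theta_exponent d (r - l) 0)) \<le> max (disc_norm (f z)) B"
  proof (rule N_top_coeff_le[OF assms(1)])
    show "degree (f z) \<le> d * q + r" using degree_f k_eq by simp
    show "N \<omega> ^ l * N (coeff (f z) (theta_exponent d (r - l) t)) \<le> max (disc_norm (f z)) B"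
      if "l < t" "t \<le> d" for t unfolding B_def using that by (intro max.coboundedI2 Max_ge) auto
  qed (use r_d_less_q in auto)
  also have "B < m" unfolding B_def using assms(1) less by (subst Max_less_iff) auto
  then have "max (disc_norm (f z)) B < m" using disc_norm_f_less[OF z_word] by simp
  finally have "N \<omega> ^ l * N (coeff (f z) (theta_exponent d (r - l) 0)) < m" .
  moreover have "theta_exponent d (r - l) 0 = k - l" "k - (k - l) = l"
    using k_eq assms(2) by (simp_all add: theta_exponent_def)
  ultimately show ?thesis by (simp add: coeff_U N_mult N_power)
qed

end

lemma (in large_solution) critical_word_exists:
  assumes "w \<in> lists L" "2 \<le> length w" "N a * A \<le> gauss (U (f w))"
  obtains t0 w0 where
    "critical_word N \<omega> L q a p d r k f M \<eta> A t0 w0 (gauss (U (f (t0 # w0))))"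
proof -
  have vanish: "\<forall>v. M < length v \<longrightarrow> gauss (U (f v)) = 0" by (simp add: f_vanish)
  obtain z where z: "z \<in> lists L" "2 \<le> length z"
    and max: "\<forall>v\<in>lists L. 2 \<le> length v \<longrightarrow> gauss (U (f v)) \<le> gauss (U (f z))"
    and longer: "0 < gauss (U (f z)) \<longrightarrow>
      (\<forall>v\<in>lists L. 2 \<le> length v \<longrightarrow> length z < length v \<longrightarrow> gauss (U (f v)) < gauss (U (f z)))"
    by (rule longest_maximizer[of "\<lambda>w. gauss (U (f w))" w "\<lambda>w. 2 \<le> length w",
          OF vanish gauss_nonneg assms(1,2)]) (rule that)
  obtain t0 w0 where tw: "z = t0 # w0" "w0 \<noteq> []" using z(2) by (cases z) (auto simp: Suc_le_eq)
  have ge: "N a * A \<le> gauss (U (f z))" using max assms by fastforce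
  then have "0 < gauss (U (f z))" using N_a_A_pos by linarith
  then have "critical_word N \<omega> L q a p d r k f M \<eta> A t0 w0 (gauss (U (f (t0 # w0))))"
    using z max longer ge unfolding tw(1) by unfold_locales (use tw(2) in \<open>auto simp: tw(1)\<close>)
  then show thesis by (rule that)
qed

lemma (in hecke_solution) gauss_f_le_of_large_solution:
  assumes small: "\<And>A. large_solution N \<omega> L q a p d r k f M \<eta> A \<Longrightarrow>
      \<forall>w\<in>lists L. w \<noteq> [] \<longrightarrow> gauss (f w) < A"
    and omega_q: "N \<omega> ^ q < N a" and w: "w \<in> lists L" "w \<noteq> []"
  shows "gauss (f w) \<le> \<eta> / (N a * N a)"
proof -
  have vanish: "\<forall>v. M < length v \<longrightarrow> gauss (f v) = 0" by (simp add: f_vanish)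
  obtain z where z: "z \<in> lists L" "z \<noteq> []"
    and max: "\<forall>v\<in>lists L. v \<noteq> [] \<longrightarrow> gauss (f v) \<le> gauss (f z)"
    by (rule longest_maximizer[of "\<lambda>w. gauss (f w)" w "\<lambda>w. w \<noteq> []", OF vanish gauss_nonneg w])
      (rule that)
  have "gauss (f z) \<le> \<eta> / (N a * N a)"
  proof (rule ccontr)
    assume "\<not> ?thesis"
    then have less: "\<eta> < N a * (N a * gauss (f z))" using N_a_pos by (simp add: field_simps)
    then have "0 < gauss (f z)" using eta_nonneg by auto
    then have "large_solution N \<omega> L q a p d r k f M \<eta> (gauss (f z))"
      using max less omega_q by unfold_locales auto
    from small[OF this] z show False by blast
  qed
  then show ?thesis using max w by fastforce
qed

section \<open>Critical words when \<open>|\<omega>|\<^sup>r\<^sup>+\<^sup>1 \<le> |a|\<^sup>2\<close>\<close>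

locale critical_word_small_omega = critical_word +
  assumes omega_power_Suc_r_le: "N \<omega> ^ Suc r \<le> N a * N a" and r_pos: "d = 1 \<Longrightarrow> 1 \<le> r"
begin

lemma omega_power_le_a_square: "Suc r \<le> j \<Longrightarrow> 0 \<le> x \<Longrightarrow> N \<omega> ^ j * x \<le> N a * (N a * x)"
  using mult_right_mono[OF order_trans[OF omega_power_mono omega_power_Suc_r_le], of j x]
  by (simp add: mult.assoc)

lemma mod_less_of_gt_r:
  assumes "d * q \<le> i" "i \<le> k" "r < j mod q"
  shows "i mod q < j mod q"
proof -
  have "i - d * q < q" "i - d * q \<le> r" using assms k_eq r_d_less_q by auto
  then have "i mod q \<le> r" using assms(1) by (metis le_add_diff_inverse mod_less mod_mult_self3)
  then show ?thesis using assms(3) by simp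
qed

lemma N_coeff_children_sum_less_of_gt_r:
  assumes "\<And>s. s \<in> L \<Longrightarrow> N a * gauss (U (f (s # y))) < B"
    and "\<And>s. s \<in> L \<Longrightarrow> N a * (N a * gauss (f (s # y))) < B"
    and j: "r < j mod q"
  shows "N (coeff (children_sum y) j) < B"
proof (rule N_coeff_children_sum_less)
  show "0 < B" using assms(1)[OF zero_in_L] by (rule le_less_trans[rotated]) simp
  fix s i assume s: "s \<in> L" and i: "i \<le> k"
  let ?c = "coeff (U (f (s # y))) i"
  show "N ?c * N (of_nat (i choose j)) < B"
  proof (cases "d * q \<le> i")
    case True
    have "N ?c * N (of_nat (i choose j)) \<le> gauss (U (f (s # y))) * N a"
      using N_binomial_le_a[OF mod_less_of_gt_r[OF True i j]]
      by (intro mult_mono N_coeff_le_gauss) simp_all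
    then show ?thesis using assms(1)[OF s] by (simp add: mult.commute)
  next
    case False
    then have "N ?c \<le> N \<omega> ^ Suc r * N (coeff (f (s # y)) i)" using k_eq by (intro N_coeff_U_le) simp
    also have "\<dots> \<le> N \<omega> ^ Suc r * gauss (f (s # y))" by (simp add: N_coeff_le_gauss mult_left_mono)
    also have "\<dots> \<le> N a * (N a * gauss (f (s # y)))" by (rule omega_power_le_a_square) simp_all
    also have "\<dots> < B" by (rule assms(2)[OF s])
    finally show ?thesis using N_mult_binomial_le le_less_trans by blast
  qed
qed

lemma N_coeff_children_sum_z_less:
  "r < j mod q \<Longrightarrow> N (coeff (children_sum z) j) < N a * m"
  using t0 w0 N_a_pos
  by (intro N_coeff_children_sum_less_of_gt_r) (simp_all add: gauss_U_f_less N_a_gauss_f_less)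

lemma N_coeff_T_plus_w0_le: "t \<in> L \<Longrightarrow> N (coeff (T_plus t (f w0)) j) \<le> N \<omega> ^ j * A"
  by (rule order_trans[OF N_coeff_T_plus_le]) (simp_all add: mult_left_mono gauss_f_w0_le)

lemma N_coeff_z_less_of_T_plus:
  assumes "r < j mod q" "N (coeff (T_plus t0 (f w0)) j) < N a * m"
  shows "N (coeff (f z) j) < m"
proof -
  have "N a * N (coeff (f z) j) < N a * m"
    using assms N_coeff_children_sum_z_less eta_less_N_a_m
    by (intro N_coeff_child_less[OF w0(1) t0]) simp_all
  then show ?thesis using N_a_pos by simp
qed

lemma gt_r_of_mod: "r < j mod q \<Longrightarrow> Suc r \<le> j"
  using mod_less_eq_dividend[of j q] by linarith

lemma N_coeff_z_le:
  assumes j: "r < j mod q" shows "N (coeff (f z) j) \<le> m"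
proof -
  have "N (coeff (T_plus t0 (f w0)) j) \<le> N a * m"
    using N_coeff_T_plus_w0_le[OF t0, of j] omega_power_le_a_square[OF gt_r_of_mod[OF j], of A]
      A_pos N_a_N_a_A_le by linarith
  then have "N a * N (coeff (f z) j) \<le> N a * m"
    using N_coeff_children_sum_z_less[OF j] eta_less_N_a_m
    by (intro N_coeff_child_le[OF w0(1) t0]) simp_all
  then show ?thesis using N_a_pos by simp
qed

lemma N_coeff_z_less:
  assumes j: "r < j mod q" and "Suc r < j \<or> N a * A < m"
  shows "N (coeff (f z) j) < m"
proof (rule N_coeff_z_less_of_T_plus[OF j])
  show "N (coeff (T_plus t0 (f w0)) j) < N a * m"
  proof (cases "N a * A < m")
    case True
    then have "N a * (N a * A) < N a * m" using N_a_pos by simp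
    then show ?thesis
      using N_coeff_T_plus_w0_le[OF t0, of j] omega_power_le_a_square[OF gt_r_of_mod[OF j], of A]
        A_pos by linarith
  next
    case False
    then have "N \<omega> ^ j * A < N \<omega> ^ Suc r * A"
      using assms(2) by (intro mult_strict_right_mono omega_power_strict_mono A_pos) simp
    then show ?thesis
      using N_coeff_T_plus_w0_le[OF t0, of j] omega_power_le_a_square[of "Suc r" A]
        A_pos N_a_N_a_A_le by linarith
  qed
qed

lemma N_coeff_w0_less:
  assumes m: "m = N a * A" and d: "d = 1" and i: "Suc r \<le> i" "i < q"
  shows "N (coeff (f w0) i) < A"
proof -
  obtain t1 w1 where w: "w0 = t1 # w1" "t1 \<in> L" "w1 \<in> lists L" using w0 by (cases w0) auto
  have "N (coeff (T_plus t1 (f w1)) i) < N a * A"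
    using disc_norm_f_le[OF w(3)] w(2) d r_pos i N_a_A_pos
    by (intro N_coeff_T_plus_f_less) (simp_all add: m)
  moreover have "N (coeff (children_sum w0) i) < N a * A"
  proof (rule N_coeff_children_sum_less_of_gt_r)
    fix s assume s: "s \<in> L"
    then have sw: "s # w0 \<in> lists L" using w0(1) by simp
    have "gauss (U (f (s # w0))) \<le> N a * A"
      using gauss_U_f_le[OF sw] w0(2) by (simp add: m Suc_le_eq)
    then have "N a * gauss (U (f (s # w0))) \<le> N a * (N a * A)" using N_a_pos by simp
    also have "\<dots> < N a * A" by (rule N_a_mult_less[OF N_a_A_pos])
    finally show "N a * gauss (U (f (s # w0))) < N a * A" .
    have "N a * (N a * gauss (f (s # w0))) \<le> N a * (N a * A)"
      using gauss_f_le_A[OF sw] N_a_pos by simp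
    then show "N a * (N a * gauss (f (s # w0))) < N a * A"
      using N_a_mult_less[OF N_a_A_pos] by linarith
  qed (use i in simp)
  ultimately have "N a * N (coeff (f w0) i) < N a * A"
    unfolding w(1) using eta_less_N_a_A by (intro N_coeff_child_less[OF w(3,2)])
  then show ?thesis using N_a_pos by simp
qed

lemma N_coeff_z_Suc_r_less:
  assumes d: "d = 1" shows "N (coeff (f z) (Suc r)) < m"
proof (cases "N a * A < m")
  case True
  then show ?thesis using N_coeff_z_less[of "Suc r"] r_d_less_q d by simp
next
  case False
  then have m: "m = N a * A" using m_ge by simp
  have "N (coeff (T_plus t0 (f w0)) (Suc r)) < N \<omega> ^ Suc r * A"
  proof (rule N_coeff_T_plus_f_less_of_terms[OF t0 A_pos])
    fix i assume "i \<le> k"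
    consider "i < Suc r" | "Suc r \<le> i" "i < q" | "q \<le> i" by linarith
    then show "N (coeff (f w0) i * of_nat (i choose Suc r)) < A"
    proof cases
      case 2
      have "N (coeff (f w0) i * of_nat (i choose Suc r)) \<le> N (coeff (f w0) i)"
        unfolding N_mult by (rule N_mult_binomial_le)
      then show ?thesis using N_coeff_w0_less[OF m d 2] by linarith
    next
      case 3
      then have "N (of_nat (i choose Suc r)) \<le> N a"
        using d r_d_less_q \<open>i \<le> k\<close> by (intro N_binomial_le_a mod_less_of_gt_r) auto
      then have "N (coeff (f w0) i * of_nat (i choose Suc r)) \<le> A * N a"
        using order_trans[OF N_coeff_le_gauss gauss_f_w0_le] by (intro N_mult_le)
      then show ?thesis using N_a_A_less by (simp add: mult.commute)
    qed (use A_pos in \<open>simp add: binomial_eq_0\<close>)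
  qed
  also have "\<dots> \<le> N a * m" using omega_power_le_a_square[of "Suc r" A] A_pos by (simp add: m)
  finally show ?thesis using r_d_less_q d by (intro N_coeff_z_less_of_T_plus) simp_all
qed

lemma omega_power_N_coeff_z_less:
  assumes "l < t" "t \<le> d" "l \<le> r"
  shows "N \<omega> ^ l * N (coeff (f z) (theta_exponent d (r - l) t)) < m"
proof (cases "l = 0")
  case False
  have "theta_exponent d (r - l) t mod q = r - l + t"
    using assms r_d_less_q by (intro theta_exponent_mod) simp
  then have "N \<omega> ^ l * N (coeff (f z) (theta_exponent d (r - l) t)) \<le> N \<omega> ^ l * m"
    using assms by (simp add: N_coeff_z_le mult_left_mono)
  also have "\<dots> < m" using omega_power_strict_mono[of 0 l] False m_pos by simp
  finally show ?thesis .
next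
  case True
  have jmod: "r < theta_exponent d r t mod q"
    using assms True r_d_less_q by (subst theta_exponent_mod) auto
  have "Suc r < theta_exponent d r t" if "d \<noteq> 1"
  proof (cases "t = d")
    case False
    then have "1 * q \<le> (d - t) * q" using assms by (intro mult_right_mono) linarith+
    then show ?thesis unfolding theta_exponent_def using q_ge_2 assms True by linarith
  qed (use that assms True in \<open>simp add: theta_exponent_def\<close>)
  moreover have "theta_exponent d r t = Suc r" if "d = 1"
    using that assms True by (simp add: theta_exponent_def)
  ultimately show ?thesis
    using N_coeff_z_less[OF jmod] N_coeff_z_Suc_r_less True by (cases "d = 1") simp_all
qed

lemma gauss_U_z_less: "gauss (U (f z)) < m"
  unfolding gauss_less_iff
proof
  fix i
  consider "k < i" | "d \<le> k - i" | "i \<le> k" "r < k - i" | "i \<le> k" "k - i < d" "k - i \<le> r" by linarith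
  then show "N (coeff (U (f z)) i) < m"
  proof cases
    case 1
    then show ?thesis using m_pos by (simp add: coeff_U)
  next
    case 2
    then show ?thesis by (rule N_coeff_U_z_less_low)
  next
    case 3
    have "N (coeff (U (f z)) i) \<le> N \<omega> ^ Suc r * N (coeff (f z) i)" using 3 by (intro N_coeff_U_le) simp
    also have "\<dots> \<le> N \<omega> ^ Suc r * gauss (f z)" by (simp add: N_coeff_le_gauss mult_left_mono)
    also have "\<dots> \<le> N a * (N a * gauss (f z))" by (rule omega_power_le_a_square) simp_all
    also have "\<dots> < N a * m" using N_a_gauss_f_less[OF z_word] N_a_pos by simp
    finally show ?thesis using N_a_mult_less[OF m_pos] by linarith
  next
    case 4
    then have "i = k - (k - i)" by simp
    then show ?thesis
      using N_coeff_U_z_less_top[OF 4(2,3)] omega_power_N_coeff_z_less 4 by metis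
  qed
qed

end

section \<open>Critical words when \<open>r = 0\<close> and \<open>|\<omega>| \<le> |a|\<close>\<close>

lemma (in digit_system) coeff_mod_theta_2:
  assumes "degree v \<le> 2 * q" "2 < q"
  shows "coeff (v mod theta) 2 = coeff v 2 + sign_q * coeff v (q + 1) + coeff v (2 * q)"
proof -
  have "degree (v div theta) \<le> q" using degree_div_theta[of v 1 0] assms(1) by simp
  then have "coeff (v div theta) (2 * q - 1) = 0" using assms(2) by (intro coeff_eq_0) linarith
  then have "coeff v (2 * q) = coeff (v div theta) q"
    using coeff_mod_div_theta[of v "2 * q"] assms(2) by (simp add: coeff_mod_theta_eq_0)
  moreover have "coeff v (q + 1) = coeff (v div theta) 1 - sign_q * coeff (v div theta) q"
    using coeff_mod_div_theta[of v "q + 1"] by (simp add: coeff_mod_theta_eq_0)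
  moreover have "coeff v 2 = coeff (v mod theta) 2 - sign_q * coeff (v div theta) 1"
    using coeff_mod_div_theta[of v 2] assms(2) by simp
  moreover have "sign_q * (x - sign_q * y) = sign_q * x - y" for x y
    by (simp add: right_diff_distrib flip: mult.assoc)
  ultimately show ?thesis by simp
qed

locale critical_word_r_0 = critical_word +
  assumes r_0: "r = 0" and d_ge_2: "2 \<le> d" and omega_le_a: "N \<omega> \<le> N a"
begin

lemma q_gt_2: "2 < q"
  using d_ge_2 r_d_less_q by linarith

lemma k_eq_d_mult_q: "k = d * q"
  using k_eq r_0 by simp

lemma k_ge_6: "6 \<le> k"
  using mult_le_mono[OF d_ge_2, of 3 q] q_gt_2 k_eq_d_mult_q by simp

lemma omega_power_le_a_square:
  assumes "2 \<le> j" "0 \<le> x" shows "N \<omega> ^ j * x \<le> N a * (N a * x)"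
proof -
  have "N \<omega> ^ j \<le> N \<omega> ^ 2" by (rule omega_power_mono[OF assms(1)])
  also have "\<dots> \<le> N a * N a" unfolding power2_eq_square using omega_le_a by (intro mult_mono) auto
  finally have "N \<omega> ^ j \<le> N a * N a" .
  from mult_right_mono[OF this assms(2)] show ?thesis by (simp add: mult.assoc)
qed

lemma omega_power_A_less_of_ge_3:
  assumes "3 \<le> j" shows "N \<omega> ^ j * A < N a * m"
proof -
  have "N \<omega> ^ j * A < N \<omega> ^ 2 * A"
    using assms by (intro mult_strict_right_mono omega_power_strict_mono A_pos) simp
  also have "\<dots> \<le> N a * (N a * A)" using A_pos by (intro omega_power_le_a_square) simp_all
  also have "\<dots> \<le> N a * m" by (rule N_a_N_a_A_le)
  finally show ?thesis .
qed

lemma N_coeff_children_sum_less_of_mod_pos: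
  assumes U_less: "\<And>s. s \<in> L \<Longrightarrow> N a * gauss (U (f (s # y))) < B"
    and subtop_less: "\<And>s. s \<in> L \<Longrightarrow> N \<omega> * N (coeff (f (s # y)) (k - 1)) < B"
    and f_less: "\<And>s. s \<in> L \<Longrightarrow> N a * (N a * gauss (f (s # y))) < B"
    and j: "0 < j mod q"
  shows "N (coeff (children_sum y) j) < B"
proof (rule N_coeff_children_sum_less)
  show "0 < B" using U_less[OF zero_in_L] by (rule le_less_trans[rotated]) simp
  fix s i assume s: "s \<in> L" and "i \<le> k"
  let ?c = "coeff (U (f (s # y))) i"
  consider "i = k" | "i = k - 1" | "i \<le> k - 2" using \<open>i \<le> k\<close> by linarith
  then show "N ?c * N (of_nat (i choose j)) < B"
  proof cases
    case 1
    have "N (of_nat (i choose j)) \<le> N a" unfolding 1 using j k_eq_d_mult_q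
      by (intro N_binomial_le_a) simp
    then have "N ?c * N (of_nat (i choose j)) \<le> gauss (U (f (s # y))) * N a"
      by (intro mult_mono N_coeff_le_gauss) simp_all
    then show ?thesis using U_less[OF s] by (simp add: mult.commute)
  next
    case 2
    then have "N ?c \<le> N \<omega> ^ 1 * N (coeff (f (s # y)) i)" using k_ge_6 by (intro N_coeff_U_le) simp
    also have "\<dots> < B" using subtop_less[OF s] 2 by simp
    finally show ?thesis by (rule le_less_trans[OF N_mult_binomial_le])
  next
    case 3
    then have "N ?c \<le> N \<omega> ^ 2 * N (coeff (f (s # y)) i)" using k_ge_6 by (intro N_coeff_U_le) simp
    also have "\<dots> \<le> N \<omega> ^ 2 * gauss (f (s # y))" by (simp add: N_coeff_le_gauss mult_left_mono)
    also have "\<dots> \<le> N a * (N a * gauss (f (s # y)))" by (rule omega_power_le_a_square) simp_all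
    also have "\<dots> < B" by (rule f_less[OF s])
    finally show ?thesis by (rule le_less_trans[OF N_mult_binomial_le])
  qed
qed

lemma N_coeff_T_plus_le_omega_power_A:
  assumes "w \<in> lists L" "w \<noteq> []" "t \<in> L"
  shows "N (coeff (T_plus t (f w)) j) \<le> N \<omega> ^ j * A"
  by (rule order_trans[OF N_coeff_T_plus_le[OF assms(3)]])
    (simp add: mult_left_mono gauss_f_le_A[OF assms(1,2)])

lemma N_coeff_subtop_less:
  assumes "w \<in> lists L" "length z < length w"
  shows "N (coeff (f w) (k - 1)) < m"
  using assms
proof (induction "Suc M - length w" arbitrary: w rule: less_induct)
  case less
  show ?case
  proof (cases "M < length w")
    case True
    then show ?thesis using f_vanish m_pos by simp
  next
    case False
    obtain t y where w: "w = t # y" "t \<in> L" "y \<in> lists L" using less.prems by (cases w) auto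
    then have "y \<noteq> []" using less.prems(2) by auto
    have "k - 1 = (d - 1) * q + (q - 1)" using k_eq_d_mult_q d_ge_2 q_gt_2 by (cases d) simp_all
    then have "(k - 1) mod q = (q - 1) mod q" by (simp only: mod_mult_self3)
    have "N (coeff (children_sum w) (k - 1)) < N a * m"
    proof (rule N_coeff_children_sum_less_of_mod_pos)
      show "0 < (k - 1) mod q" using \<open>(k - 1) mod q = (q - 1) mod q\<close> q_gt_2 by simp
      fix s assume s: "s \<in> L"
      then have sw: "s # w \<in> lists L" "length z < length (s # w)" using less.prems by auto
      then have "N (coeff (f (s # w)) (k - 1)) < m" using False by (intro less.hyps) auto
      then have "N \<omega> * N (coeff (f (s # w)) (k - 1)) < N \<omega> * m" using N_omega_pos by simp
      also have "\<dots> \<le> N a * m" using omega_le_a m_pos by simp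
      finally show "N \<omega> * N (coeff (f (s # w)) (k - 1)) < N a * m" .
      show "N a * gauss (U (f (s # w))) < N a * m" "N a * (N a * gauss (f (s # w))) < N a * m"
        using sw N_a_pos by (simp_all add: gauss_U_f_less N_a_gauss_f_less)
    qed
    moreover have "N (coeff (T_plus t (f y)) (k - 1)) < N a * m"
      using N_coeff_T_plus_le_omega_power_A[OF w(3) \<open>y \<noteq> []\<close> w(2), of "k - 1"]
        omega_power_A_less_of_ge_3[of "k - 1"] k_ge_6 by linarith
    ultimately have "N a * N (coeff (f w) (k - 1)) < N a * m"
      unfolding w(1) using eta_less_N_a_m by (intro N_coeff_child_less[OF w(3,2)])
    then show ?thesis using N_a_pos by simp
  qed
qed

lemma N_coeff_children_sum_f_less:
  assumes y: "y \<in> lists L" "length w0 < length y" and j: "0 < j mod q"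
  shows "N (coeff (children_sum y) j) < N a * m"
proof (rule N_coeff_children_sum_less_of_mod_pos[OF _ _ _ j])
  fix s assume "s \<in> L"
  then have sy: "s # y \<in> lists L" "length z < length (s # y)" using y by auto
  have "N \<omega> * N (coeff (f (s # y)) (k - 1)) < N \<omega> * m"
    using N_coeff_subtop_less[OF sy] N_omega_pos by simp
  also have "\<dots> \<le> N a * m" using omega_le_a m_pos by simp
  finally show "N \<omega> * N (coeff (f (s # y)) (k - 1)) < N a * m" .
  show "N a * gauss (U (f (s # y))) < N a * m" "N a * (N a * gauss (f (s # y))) < N a * m"
    using sy N_a_pos by (simp_all add: gauss_U_f_less N_a_gauss_f_less)
qed

lemma N_coeff_child_w0_less:
  assumes t: "t \<in> L" and "0 < j mod q" "N (coeff (T_plus t (f w0)) j) < N a * m"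
  shows "N (coeff (f (t # w0)) j) < m"
proof -
  have "N a * N (coeff (f (t # w0)) j) < N a * m"
    using assms N_coeff_children_sum_f_less[of "t # w0"] w0(1) eta_less_N_a_m
    by (intro N_coeff_child_less[OF w0(1) t]) simp_all
  then show ?thesis using N_a_pos by simp
qed

lemma N_coeff_child_w0_less_of_ge_3:
  assumes "t \<in> L" "0 < j mod q" "3 \<le> j"
  shows "N (coeff (f (t # w0)) j) < m"
  using N_coeff_T_plus_le_omega_power_A[OF w0 assms(1), of j] omega_power_A_less_of_ge_3[OF assms(3)]
  by (intro N_coeff_child_w0_less assms) linarith

end

text \<open>Here all the estimates above are sharp, and the digit sum over the children of \<open>w0\<close> has to be
  used.\<close>

locale critical_word_sharp = critical_word_r_0 +
  assumes m_eq: "m = N a * A" and omega_eq: "N \<omega> = N a" and d_eq_2: "d = 2"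
begin

lemma k_eq_2_mult_q: "k = 2 * q"
  using k_eq_d_mult_q d_eq_2 by simp

lemma omega_square_A: "N \<omega> ^ 2 * A = N a * m"
  by (simp add: m_eq omega_eq power2_eq_square)

lemma Suc_q_mod_q_pos: "0 < (q + 1) mod q"
  unfolding mod_add_self1 using q_gt_2 by simp

lemma N_coeff_T_plus_parent_w0_less:
  assumes "w0 = t1 # w1" "3 \<le> j" shows "N (coeff (T_plus t1 (f w1)) j) < N a * A"
  using disc_norm_f_le[of w1] assms w0(1) d_eq_2 N_a_A_pos
  by (intro N_coeff_T_plus_f_less) (simp_all add: m_eq)

lemma N_coeff_w0_less_of_children_sum:
  assumes j: "3 \<le> j" and "N (coeff (children_sum w0) j) < N a * A"
  shows "N (coeff (f w0) j) < A"
proof -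
  obtain t1 w1 where w: "w0 = t1 # w1" "t1 \<in> L" "w1 \<in> lists L" using w0 by (cases w0) auto
  have "N a * N (coeff (f w0) j) < N a * A"
    unfolding w(1) using N_coeff_T_plus_parent_w0_less[OF w(1) j] assms(2)[unfolded w(1)] eta_less_N_a_A
    by (intro N_coeff_child_less[OF w(3,2)])
  then show ?thesis using N_a_pos by simp
qed

lemma N_coeff_w0_less:
  assumes j: "3 \<le> j" "0 < j mod q" shows "N (coeff (f w0) j) < A"
proof (rule N_coeff_w0_less_of_children_sum[OF j(1)],
    rule N_coeff_children_sum_less_of_mod_pos[OF _ _ _ j(2)])
  fix s assume "s \<in> L"
  then have sw: "s # w0 \<in> lists L" "2 \<le> length (s # w0)" "length w0 < length (s # w0)"
    using w0 by (auto simp: Suc_le_eq)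
  have "N a * gauss (U (f (s # w0))) \<le> N a * m" using gauss_U_f_le[OF sw(1,2)] N_a_pos by simp
  also have "\<dots> < N a * A" using N_a_mult_less[OF N_a_A_pos] by (simp add: m_eq)
  finally show "N a * gauss (U (f (s # w0))) < N a * A" .
  have "N (coeff (f (s # w0)) (k - 1)) < A"
    using gauss_f_less_A[OF m_eq sw(1,3)] by (simp add: gauss_less_iff)
  then show "N \<omega> * N (coeff (f (s # w0)) (k - 1)) < N a * A" using N_a_pos by (simp add: omega_eq)
  have "N a * gauss (f (s # w0)) < A"
    using N_a_gauss_f_less[OF sw(1,3)] N_a_A_less m_eq by linarith
  then show "N a * (N a * gauss (f (s # w0))) < N a * A" using N_a_pos by simp
qed

lemma N_coeff_w0_choose_2_less:
  assumes "j \<noteq> 2" shows "N (coeff (f w0) j * of_nat (j choose 2)) < A"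
proof -
  consider "j < 2" | "3 \<le> j" "0 < j mod q" | "j mod q = 0" "0 < j" using assms by linarith
  then show ?thesis
  proof cases
    case 2
    have "N (coeff (f w0) j * of_nat (j choose 2)) \<le> N (coeff (f w0) j)"
      unfolding N_mult by (rule N_mult_binomial_le)
    then show ?thesis using N_coeff_w0_less[OF 2] by linarith
  next
    case 3
    then have "N (of_nat (j choose 2)) \<le> N a" using q_gt_2 by (intro N_binomial_le_a) simp
    then have "N (coeff (f w0) j * of_nat (j choose 2)) \<le> A * N a"
      using order_trans[OF N_coeff_le_gauss gauss_f_w0_le] by (intro N_mult_le)
    then show ?thesis using N_a_A_less by (simp add: mult.commute)
  qed (use A_pos in \<open>simp add: binomial_eq_0\<close>)
qed

lemma N_sum_coeff_T_plus_2_less: "N (\<Sum>t\<in>L. coeff (T_plus t (f w0)) 2) < N a * m"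
proof -
  define S where "S j = (\<Sum>t\<in>L. (- t) ^ (j - 2))" for j
  have "(\<Sum>t\<in>L. coeff (T_plus t (f w0)) 2)
      = (\<Sum>t\<in>L. \<Sum>j\<le>k. \<omega> ^ 2 * (coeff (f w0) j * of_nat (j choose 2) * (- t) ^ (j - 2)))"
    unfolding coeff_T_plus[OF degree_f] by (simp add: sum_distrib_left)
  also have "\<dots> = \<omega> ^ 2 * (\<Sum>j\<le>k. coeff (f w0) j * of_nat (j choose 2) * S j)"
    unfolding S_def by (subst sum.swap) (simp add: sum_distrib_left)
  finally have eq: "(\<Sum>t\<in>L. coeff (T_plus t (f w0)) 2)
      = \<omega> ^ 2 * (\<Sum>j\<le>k. coeff (f w0) j * of_nat (j choose 2) * S j)" .
  have "N (coeff (f w0) j * of_nat (j choose 2) * S j) < A" for j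
  proof (cases "j = 2")
    case True
    have "N (S 2) \<le> N a" unfolding S_def using N_q_le_a card_L by simp
    then have "N (coeff (f w0) j * of_nat (j choose 2) * S j) \<le> A * 1 * N a"
      unfolding True using order_trans[OF N_coeff_le_gauss gauss_f_w0_le]
      by (intro N_mult_le N_of_nat_le_one)
    then show ?thesis using N_a_A_less by (simp add: mult.commute)
  next
    case False
    have "N (S j) \<le> 1"
      unfolding S_def by (intro N_sum_le N_power_le_one) (simp_all add: N_digit_le_one)
    then have "N (coeff (f w0) j * of_nat (j choose 2) * S j)
        \<le> N (coeff (f w0) j * of_nat (j choose 2)) * 1"
      by (intro N_mult_le order_refl)
    then show ?thesis using N_coeff_w0_choose_2_less[OF False] by simp
  qed
  then have "N (\<Sum>j\<le>k. coeff (f w0) j * of_nat (j choose 2) * S j) < A"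
    by (intro N_sum_less A_pos)
  then show ?thesis
    unfolding eq N_mult N_power omega_square_A[symmetric] using N_omega_pos by simp
qed

lemma N_sum_coeff_children_w0_2_less: "N (\<Sum>t\<in>L. coeff (f (t # w0)) 2) < m"
proof -
  have "a * (\<Sum>t\<in>L. coeff (f (t # w0)) 2) = (\<Sum>t\<in>L. coeff (T_plus t (f w0)) 2)
      + (\<Sum>t\<in>L. coeff (children_sum (t # w0)) 2) + (\<Sum>t\<in>L. coeff (err t w0) 2)"
    unfolding sum_distrib_left coeff_child_eq sum.distrib ..
  moreover have "N (\<Sum>t\<in>L. coeff (children_sum (t # w0)) 2) < N a * m"
    using w0(1) q_gt_2 N_a_m_pos by (intro N_sum_less N_coeff_children_sum_f_less) auto
  moreover have "N (\<Sum>t\<in>L. coeff (err t w0) 2) < N a * m"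
    using N_coeff_err_le[OF w0(1)] eta_less_N_a_m N_a_m_pos
    by (intro N_sum_less) (auto intro: le_less_trans)
  ultimately have "N (a * (\<Sum>t\<in>L. coeff (f (t # w0)) 2)) < N a * m"
    using N_sum_coeff_T_plus_2_less by (simp only: N_add_less)
  then show ?thesis using N_a_pos by (simp add: N_mult)
qed

lemma N_coeff_k_add_coeff_2_less:
  assumes t: "t \<in> L" shows "N (coeff (f (t # w0)) k + coeff (f (t # w0)) 2) < m"
proof -
  let ?v = "f (t # w0)"
  have "gauss (?v mod theta) < m"
    using gauss_mod_theta_le_disc_norm[of ?v] disc_norm_f_less[of "t # w0"] w0(1) t by simp
  then have "N (coeff (?v mod theta) 2) < m" by (simp add: gauss_less_iff)
  moreover have "N (sign_q * coeff ?v (q + 1)) < m"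
    using N_coeff_child_w0_less_of_ge_3[OF t Suc_q_mod_q_pos] q_gt_2 by (simp add: N_mult)
  moreover have "coeff ?v k + coeff ?v 2 = coeff (?v mod theta) 2 - sign_q * coeff ?v (q + 1)"
    using coeff_mod_theta_2[of ?v] degree_f[of "t # w0"] q_gt_2 by (simp add: k_eq_2_mult_q)
  ultimately show ?thesis by (simp add: N_diff_less)
qed

lemma N_coeff_w0_k_less: "N (coeff (f w0) k) < A"
proof (rule N_coeff_w0_less_of_children_sum)
  have "(\<Sum>t\<in>L. coeff (f (t # w0)) k)
      = (\<Sum>t\<in>L. coeff (f (t # w0)) k + coeff (f (t # w0)) 2) - (\<Sum>t\<in>L. coeff (f (t # w0)) 2)"
    by (simp add: sum.distrib)
  moreover have "N (\<Sum>t\<in>L. coeff (f (t # w0)) k + coeff (f (t # w0)) 2) < m"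
    by (intro N_sum_less N_coeff_k_add_coeff_2_less m_pos)
  ultimately have "N (\<Sum>t\<in>L. coeff (f (t # w0)) k) < m"
    using N_sum_coeff_children_w0_2_less by (simp only: N_diff_less)
  then show "N (coeff (children_sum w0) k) < N a * A"
    by (simp add: children_sum_def coeff_sum coeff_T_minus_top m_eq)
qed (use k_ge_6 in simp)

lemma N_coeff_w0_2_less: "N (coeff (f w0) 2) < A"
proof -
  have "gauss (f w0 mod theta) \<le> m"
    by (rule order_trans[OF gauss_mod_theta_le_disc_norm disc_norm_f_le[OF w0(1)]])
  then have "N (coeff (f w0 mod theta) 2) < A"
    using N_coeff_le_gauss[of "f w0 mod theta" 2] N_a_A_less m_eq by linarith
  moreover have "N (sign_q * coeff (f w0) (q + 1)) < A"
    using N_coeff_w0_less[OF _ Suc_q_mod_q_pos] q_gt_2 by (simp add: N_mult)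
  moreover have "coeff (f w0) 2
      = coeff (f w0 mod theta) 2 - sign_q * coeff (f w0) (q + 1) - coeff (f w0) k"
    using coeff_mod_theta_2[of "f w0"] degree_f[of w0] q_gt_2 by (simp add: k_eq_2_mult_q)
  ultimately show ?thesis using N_coeff_w0_k_less by (simp add: N_diff_less)
qed

lemma N_coeff_z_2_less: "N (coeff (f z) 2) < m"
proof (rule N_coeff_child_w0_less[OF t0])
  have "N (coeff (f w0) j * of_nat (j choose 2)) < A" for j
    using N_coeff_w0_choose_2_less N_coeff_w0_2_less by (cases "j = 2") simp_all
  then have "N (coeff (T_plus t0 (f w0)) 2) < N \<omega> ^ 2 * A"
    by (intro N_coeff_T_plus_f_less_of_terms t0 A_pos)
  then show "N (coeff (T_plus t0 (f w0)) 2) < N a * m" unfolding omega_square_A .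
qed (use q_gt_2 in simp)

end

context critical_word_r_0
begin

lemma N_coeff_z_2_less:
  assumes d: "d = 2" shows "N (coeff (f z) 2) < m"
proof (cases "N a * A < m \<or> N \<omega> < N a")
  case True
  then have "N \<omega> ^ 2 * A < N a * m"
  proof
    assume "N a * A < m"
    then have "N a * (N a * A) < N a * m" using N_a_pos by simp
    then show ?thesis
      using omega_power_le_a_square[OF order_refl less_imp_le[OF A_pos]] by linarith
  next
    assume "N \<omega> < N a"
    then have "N \<omega> ^ 2 < N a * N a"
      unfolding power2_eq_square by (metis mult_strict_mono N_a_pos N_nonneg)
    from mult_strict_right_mono[OF this A_pos] show ?thesis
      using N_a_N_a_A_le by (simp add: mult.assoc)
  qed
  then show ?thesis
    using N_coeff_T_plus_le_omega_power_A[OF w0 t0, of 2] q_gt_2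
    by (intro N_coeff_child_w0_less t0) simp_all
next
  case False
  then interpret critical_word_sharp N \<omega> L q a p d r k f M \<eta> A t0 w0 m
    using m_ge omega_le_a d by unfold_locales auto
  show ?thesis by (rule N_coeff_z_2_less)
qed

lemma N_coeff_z_theta_exponent_less:
  assumes t: "0 < t" "t \<le> d" shows "N (coeff (f z) (theta_exponent d 0 t)) < m"
proof (cases "3 \<le> theta_exponent d 0 t")
  case True
  have "theta_exponent d 0 t mod q = t" using theta_exponent_mod[of 0 t d] t r_d_less_q by simp
  then show ?thesis using N_coeff_child_w0_less_of_ge_3[OF t0 _ True] t by simp
next
  case False
  have "t = d"
  proof (rule ccontr)
    assume "t \<noteq> d"
    then have "1 * q \<le> (d - t) * q" using t by (intro mult_right_mono) linarith+
    then show False using False q_gt_2 t unfolding theta_exponent_def by linarith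
  qed
  then have "d = 2" "theta_exponent d 0 t = 2"
    using False d_ge_2 by (simp_all add: theta_exponent_def)
  then show ?thesis using N_coeff_z_2_less by simp
qed

lemma gauss_U_z_less: "gauss (U (f z)) < m"
  unfolding gauss_less_iff
proof
  fix i
  consider "k < i" | "i = k" | "i < k" by linarith
  then show "N (coeff (U (f z)) i) < m"
  proof cases
    case 1
    then show ?thesis using m_pos by (simp add: coeff_U)
  next
    case 2
    then show ?thesis
      using N_coeff_U_z_less_top[of 0] N_coeff_z_theta_exponent_less d_ge_2 r_0 by simp
  next
    case 3
    then have "N (coeff (U (f z)) i) \<le> N \<omega> ^ 1 * N (coeff (f z) i)" by (intro N_coeff_U_le) simp
    also have "\<dots> \<le> N a * gauss (f z)"
      using omega_le_a by (intro mult_mono N_coeff_le_gauss) simp_all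
    also have "\<dots> < m" by (rule N_a_gauss_f_less[OF z_word]) simp
    finally show ?thesis .
  qed
qed

end

section \<open>The weight \<open>k = q\<close>\<close>

lemma (in hecke_solution) N_coeff_children_sum_1_le:
  assumes "k = q" and child_le: "\<And>s. s \<in> L \<Longrightarrow> gauss (f (s # z)) \<le> B"
  shows "N (coeff (children_sum z) 1) \<le> N \<omega> * B"
proof (rule N_coeff_children_sum_le)
  have B: "0 \<le> B" using order_trans[OF gauss_nonneg child_le[OF zero_in_L]] .
  then show "0 \<le> N \<omega> * B" by simp
  fix s i assume s: "s \<in> L" and "i \<le> k"
  let ?c = "coeff (U (f (s # z))) i"
  show "N ?c * N (of_nat (i choose 1)) \<le> N \<omega> * B"
  proof (cases "i = k")
    case True
    have "gauss (U (f (s # z))) \<le> B" by (rule order_trans[OF gauss_U_le child_le[OF s]])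
    then have "N ?c * N (of_nat (i choose 1)) \<le> B * N \<omega>"
      using order_trans[OF N_coeff_le_gauss] N_q_le_omega True \<open>k = q\<close> B by (intro mult_mono) simp_all
    then show ?thesis by (simp add: mult.commute)
  next
    case False
    then have "N ?c \<le> N \<omega> ^ 1 * N (coeff (f (s # z)) i)"
      using \<open>i \<le> k\<close> by (intro N_coeff_U_le) simp
    also have "\<dots> \<le> N \<omega> * B"
      using order_trans[OF N_coeff_le_gauss child_le[OF s]] by (simp add: mult_left_mono)
    finally show ?thesis by (rule order_trans[OF N_mult_binomial_le])
  qed
qed

lemma (in hecke_solution) gauss_f_le_of_descendants_of_k_eq_q:
  assumes k: "d = 1" "r = 0" and w: "w \<in> lists L" and eta: "\<eta> \<le> N \<omega> * B"
    and child_le: "\<And>t. t \<in> L \<Longrightarrow> N a * gauss (f (t # w)) \<le> N \<omega> * B"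
    and grandchild_le: "\<And>s t. s \<in> L \<Longrightarrow> t \<in> L \<Longrightarrow> gauss (f (s # t # w)) \<le> B"
  shows "gauss (f w) \<le> B"
proof -
  have k_eq_q: "k = q" using k_eq k by simp
  have B: "0 \<le> B" using order_trans[OF gauss_nonneg grandchild_le[OF zero_in_L zero_in_L]] .
  then have omega_B_le: "N \<omega> * B \<le> B" using N_omega_less_one by (simp add: mult_left_le_one_le)
  have "gauss (T_plus t (f w)) \<le> B" if t: "t \<in> L" for t
    using child_le[OF t] order_trans[OF gauss_U_le grandchild_le[OF _ t]] omega_B_le eta
    by (intro gauss_T_plus_f_le[OF w t] gauss_children_sum_le) simp_all
  then have "disc_norm (f w) \<le> B" unfolding disc_norm_le_iff ..
  then have mod_le: "gauss (f w mod theta) \<le> B"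
    using gauss_mod_theta_le_disc_norm[of "f w"] by linarith
  have "N (a * coeff (f (0 # w)) 1) \<le> N \<omega> * B"
    unfolding N_mult
    by (rule order_trans[OF mult_left_mono[OF N_coeff_le_gauss N_nonneg] child_le[OF zero_in_L]])
  then have "N (coeff (T_plus 0 (f w)) 1) \<le> N \<omega> * B"
    unfolding coeff_T_plus_f_eq
    using N_coeff_children_sum_1_le[OF k_eq_q grandchild_le[OF _ zero_in_L]]
      order_trans[OF N_coeff_err_le[OF w zero_in_L] eta]
    by (intro N_diff_le) simp_all
  then have "N (coeff (f w) 1) \<le> B" using N_omega_pos by (simp add: coeff_T_plus_0_left N_mult)
  then have "N (coeff (f w div theta) 0) \<le> B"
    using q_ge_2 N_coeff_div_theta_le[OF mod_le, of 0] by simp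
  moreover have "degree (f w div theta) = 0"
    using degree_div_theta[of "f w" 0 0] degree_f[of w] k_eq_q by simp
  then have "N (coeff (f w div theta) i) \<le> B" if "i \<noteq> 0" for i
    using that B by (simp add: coeff_eq_0)
  ultimately have "gauss (f w div theta) \<le> B" unfolding gauss_le_iff by metis
  with mod_le show ?thesis by (rule gauss_le_of_mod_div_theta)
qed

lemma (in hecke_solution) gauss_f_le_of_k_eq_q:
  assumes "d = 1" "r = 0" "N a \<le> N \<omega>" "w \<in> lists L"
  shows "N \<omega> * gauss (f w) \<le> \<eta>"
  using assms(4)
proof (induction "Suc M - length w" arbitrary: w rule: less_induct)
  case less
  show ?case
  proof (cases "M < length w")
    case True
    then show ?thesis using f_vanish eta_nonneg by simp
  next
    case False
    define B where "B = \<eta> / N \<omega>"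
    have eta: "\<eta> = N \<omega> * B" using N_omega_pos by (simp add: B_def)
    have IH: "gauss (f y) \<le> B" if "y \<in> lists L" "length w < length y" for y
      using less.hyps[of y] that False N_omega_pos by (simp add: eta)
    have "gauss (f w) \<le> B"
    proof (rule gauss_f_le_of_descendants_of_k_eq_q[OF assms(1,2) less.prems])
      show "N a * gauss (f (t # w)) \<le> N \<omega> * B" if "t \<in> L" for t
        using IH[of "t # w"] that less.prems assms(3) by (intro mult_mono) simp_all
      show "gauss (f (s # t # w)) \<le> B" if "s \<in> L" "t \<in> L" for s t
        using that less.prems by (intro IH) simp_all
    qed (simp add: eta)
    then show ?thesis using N_omega_pos by (simp add: eta)
  qed
qed

lemma (in nonarch) quadratic_fixed_point_step:
  assumes Q: "N Q \<le> N \<omega>" and b: "N \<omega> < N b" and x: "N x = N \<omega> / N b"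
  defines "y \<equiv> (\<omega> + Q * x\<^sup>2) / b"
  shows "N y = N \<omega> / N b"
    and "N (b * y - \<omega> - Q * y\<^sup>2) \<le> N (b * x - \<omega> - Q * x\<^sup>2) * (N \<omega> / N b)"
proof -
  have "0 < N b" using b N_nonneg[of \<omega>] by linarith
  then have b_nz: "b \<noteq> 0" and N_x: "N x < 1" using b by (auto simp: x)
  show N_y: "N y = N \<omega> / N b"
  proof (cases "\<omega> = 0")
    case False
    have "N (Q * x\<^sup>2) \<le> N \<omega> * (N x)\<^sup>2" using Q by (simp add: N_mult N_power mult_right_mono)
    also have "\<dots> < N \<omega>" using False N_x by (simp add: power_less_one_iff)
    finally show ?thesis by (simp add: y_def N_divide N_add_eq_left)
  qed (use Q in \<open>simp add: y_def\<close>)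
  have "x - y = (b * x - \<omega> - Q * x\<^sup>2) / b" using b_nz by (simp add: y_def field_simps)
  then have "b * y - \<omega> - Q * y\<^sup>2 = Q * ((b * x - \<omega> - Q * x\<^sup>2) / b) * (x + y)"
    using b_nz by (simp add: y_def field_simps power2_eq_square)
  also have "N \<dots> \<le> N \<omega> * (N (b * x - \<omega> - Q * x\<^sup>2) / N b) * 1"
    using Q N_x x N_y by (intro N_mult_le N_add_le) (simp_all add: N_divide)
  finally show "N (b * y - \<omega> - Q * y\<^sup>2) \<le> N (b * x - \<omega> - Q * x\<^sup>2) * (N \<omega> / N b)"
    by (simp add: mult.commute)
qed

lemma (in nonarch) approximate_root_quadratic:
  assumes Q: "N Q \<le> N \<omega>" and b: "N \<omega> < N b" and "0 < \<epsilon>"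
  shows "\<exists>x. N x = N \<omega> / N b \<and> N (b * x - \<omega> - Q * x\<^sup>2) \<le> N \<omega> * \<epsilon>"
proof -
  define \<rho> where "\<rho> = N \<omega> / N b"
  have "0 < N b" using b N_nonneg[of \<omega>] by linarith
  then have rho: "0 \<le> \<rho>" "\<rho> < 1" using b by (simp_all add: \<rho>_def)
  have "\<exists>x. N x = \<rho> \<and> N (b * x - \<omega> - Q * x\<^sup>2) \<le> N \<omega> * \<rho> ^ n" for n
  proof (induction n)
    case 0
    have "N (\<omega> / b) = \<rho>" by (simp add: N_divide \<rho>_def)
    moreover have "b * (\<omega> / b) - \<omega> - Q * (\<omega> / b)\<^sup>2 = - (Q * (\<omega> / b)\<^sup>2)" using \<open>0 < N b\<close> by simp
    moreover have "N (Q * (\<omega> / b)\<^sup>2) \<le> N \<omega> * 1"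
      using Q rho calculation(1) by (intro N_mult_le) (simp_all add: N_power power_le_one)
    ultimately show ?case by (intro exI[of _ "\<omega> / b"]) simp
  next
    case (Suc n)
    then obtain x where x: "N x = \<rho>" "N (b * x - \<omega> - Q * x\<^sup>2) \<le> N \<omega> * \<rho> ^ n" by blast
    then have "N (b * x - \<omega> - Q * x\<^sup>2) * \<rho> \<le> N \<omega> * \<rho> ^ Suc n"
      using mult_right_mono[OF x(2) rho(1)] by (simp add: mult_ac)
    then show ?case
      using quadratic_fixed_point_step[OF Q b x(1)[unfolded \<rho>_def]] order_trans
      unfolding \<rho>_def by blast
  qed
  moreover obtain n where "\<rho> ^ n < \<epsilon>" using real_arch_pow_inv[OF \<open>0 < \<epsilon>\<close> rho(2)] by blast
  then have "N \<omega> * \<rho> ^ n \<le> N \<omega> * \<epsilon>" by (intro mult_left_mono) simp_all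
  ultimately show ?thesis unfolding \<rho>_def[symmetric] by (meson order_trans)
qed

text \<open>Every \<open>f w\<close> is split as \<open>v w + \<gamma> w \<tau>\<close>, where \<open>\<tau>\<close> differs from \<open>\<theta>\<close> by a constant. This constant
  and the approximate root \<open>\<xi>\<close> of a quadratic polynomial are chosen such that the equations for \<open>v\<close>
  and for \<open>\<delta> w = \<gamma> w - \<xi> \<gamma> (tl w)\<close> lose their main terms.\<close>

locale weight_q = large_solution +
  assumes d_eq_1: "d = 1" and r_eq_0: "r = 0" and omega_less_a: "N \<omega> < N a"
begin

lemma k_eq_q: "k = q"
  using k_eq d_eq_1 r_eq_0 by simp

definition Q :: 'a where "Q = sign_q * of_nat q"

definition a' :: 'a where "a' = a * (1 + Q - \<omega> ^ (q - 1))"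

definition \<xi> :: 'a where
  "\<xi> = (SOME x. N x = N \<omega> / N a' \<and> N (a' * x - \<omega> - Q * x\<^sup>2) \<le> N \<omega> * N \<omega>)"

definition \<kappa> :: 'a where "\<kappa> = 1 - sign_q * \<omega> ^ (q - 1)"

definition \<zeta> :: 'a where
  "\<zeta> = \<kappa> * \<xi>\<^sup>2 * (\<Sum>s\<in>L. s) / (1 - a * \<xi> + \<omega> ^ q * of_nat q * \<xi>\<^sup>2)"

definition \<tau> :: "'a poly" where "\<tau> = theta - [:\<zeta>:]"

definition \<gamma> :: "'a list \<Rightarrow> 'a" where "\<gamma> w = coeff (f w) q"

definition \<delta> :: "'a list \<Rightarrow> 'a" where "\<delta> w = \<gamma> w - \<xi> * \<gamma> (tl w)"

definition v :: "'a list \<Rightarrow> 'a poly" where "v w = f w - smult (\<gamma> w) \<tau>"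

lemma N_omega_power_le: "0 < n \<Longrightarrow> N (\<omega> ^ n) \<le> N \<omega>"
  using omega_power_mono[of 1 n] by (simp add: N_power)

lemma N_omega_power_le_one: "N (\<omega> ^ n) \<le> 1"
  by (simp add: N_power omega_power_le_one)

lemma N_Q_le: "N Q \<le> N \<omega>"
  using N_q_le_omega by (simp add: Q_def N_mult)

lemma N_Q_minus_omega_power_le: "N (Q - \<omega> ^ (q - 1)) \<le> N \<omega>"
  using q_ge_2 by (intro N_diff_le N_Q_le N_omega_power_le) simp

lemma N_a'_eq: "N a' = N a"
proof -
  have "N (Q - \<omega> ^ (q - 1)) < N 1" using N_Q_minus_omega_power_le N_omega_less_one by simp
  from N_add_eq_left[OF this] show ?thesis unfolding a'_def N_mult by (simp add: add_diff_eq)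
qed

lemma N_xi: "N \<xi> = N \<omega> / N a"
  and N_xi_root: "N (a' * \<xi> - \<omega> - Q * \<xi>\<^sup>2) \<le> N \<omega> * N \<omega>"
  using someI_ex[OF approximate_root_quadratic[of Q \<omega> a' "N \<omega>"]] N_Q_le omega_less_a N_omega_pos
  by (simp_all add: \<xi>_def N_a'_eq)

lemma N_xi_less_one: "N \<xi> < 1"
  using omega_less_a N_a_pos by (simp add: N_xi)

lemma N_kappa_le_one: "N \<kappa> \<le> 1"
  unfolding \<kappa>_def using N_omega_power_le_one[of "q - 1"] by (intro N_diff_le) (simp_all add: N_mult)

lemma N_sum_digits_le_one: "N (\<Sum>s\<in>L. s) \<le> 1"
  by (intro N_sum_le N_digit_le_one) simp_all

lemma N_zeta_denominator: "N (1 - a * \<xi> + \<omega> ^ q * of_nat q * \<xi>\<^sup>2) = 1"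
proof -
  have "N (\<omega> ^ q * of_nat q * \<xi> * \<xi>) \<le> 1 * 1 * 1 * N \<xi>"
    using N_omega_power_le_one N_of_nat_le_one N_xi_less_one by (intro N_mult_le) simp_all
  moreover have "N (a * \<xi>) \<le> 1 * N \<xi>" using N_a_less_one by (intro N_mult_le) simp_all
  ultimately have "N (\<omega> ^ q * of_nat q * \<xi> * \<xi> - a * \<xi>) < N 1"
    using N_xi_less_one by (intro N_diff_less) simp_all
  from N_add_eq_left[OF this] show ?thesis by (simp add: power2_eq_square algebra_simps)
qed

lemma zeta_eq: "\<zeta> * (1 - a * \<xi> + \<omega> ^ q * of_nat q * \<xi>\<^sup>2) = \<kappa> * \<xi>\<^sup>2 * (\<Sum>s\<in>L. s)"
proof -
  have "1 - a * \<xi> + \<omega> ^ q * of_nat q * \<xi>\<^sup>2 \<noteq> 0" using N_zeta_denominator by auto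
  then show ?thesis by (simp add: \<zeta>_def)
qed

lemma N_zeta_le_one: "N \<zeta> \<le> 1"
proof -
  have "N \<zeta> = N (\<kappa> * \<xi> * \<xi> * (\<Sum>s\<in>L. s))"
    unfolding \<zeta>_def N_divide N_zeta_denominator by (simp add: power2_eq_square mult.assoc)
  also have "\<dots> \<le> 1 * 1 * 1 * 1"
    using N_xi_less_one by (intro N_mult_le N_kappa_le_one N_sum_digits_le_one) simp_all
  finally show ?thesis by simp
qed

lemma coeff_tau:
  "coeff \<tau> j = (if j = q then 1 else if j = 1 then - sign_q else if j = 0 then - \<zeta> else 0)"
  using q_ge_2 by (auto simp: \<tau>_def coeff_theta coeff_pCons split: nat.split)

lemma degree_tau: "degree \<tau> \<le> q"
  using q_ge_2 by (intro degree_le) (simp add: coeff_tau)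

lemma gauss_tau_le_one: "gauss \<tau> \<le> 1"
  using N_zeta_le_one by (simp add: gauss_le_iff coeff_tau)

lemma coeff_T_plus_tau:
  assumes "t \<in> L"
  shows "coeff (T_plus t \<tau>) 0 = - \<zeta>"
    and "coeff (T_plus t \<tau>) 1 = \<omega> * (of_nat q * (- t) ^ (q - 1) - sign_q)"
    and "coeff (T_plus t \<tau>) q = \<omega> ^ q"
proof -
  have "T_plus t [:\<zeta>:] = [:\<zeta>:]" by (simp add: T_plus_def)
  then show "coeff (T_plus t \<tau>) 0 = - \<zeta>"
    "coeff (T_plus t \<tau>) 1 = \<omega> * (of_nat q * (- t) ^ (q - 1) - sign_q)"
    using poly_theta[OF assms] coeff_T_plus_theta_1[of t]
    by (simp_all add: \<tau>_def T_plus_diff coeff_T_plus_0 coeff_pCons)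
  show "coeff (T_plus t \<tau>) q = \<omega> ^ q" using degree_tau by (simp add: coeff_T_plus_top coeff_tau)
qed

lemma coeff_T_minus_tau:
  assumes "s \<in> L"
  shows "coeff (T_minus s \<tau>) 0 = \<kappa> * s - \<omega> ^ q * \<zeta>"
    and "coeff (T_minus s \<tau>) 1 = of_nat q * s ^ (q - 1) - \<omega> ^ (q - 1) * sign_q"
    and "coeff (T_minus s \<tau>) q = 1"
proof -
  have U_tau: "coeff (U \<tau>) i = (if i = q then 1 else if i = 1 then - (\<omega> ^ (q - 1) * sign_q)
      else if i = 0 then - (\<omega> ^ q * \<zeta>) else 0)" for i
    unfolding coeff_U coeff_tau using q_ge_2 k_eq_q by simp
  have "{q, 1, 0} \<subseteq> {..k}" using k_eq_q q_ge_2 by simp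
  have "coeff (T_minus s \<tau>) j
      = (\<Sum>i\<in>{q, 1, 0}. coeff (U \<tau>) i * of_nat (i choose j) * s ^ (i - j))" for j
    unfolding coeff_T_minus using \<open>{q, 1, 0} \<subseteq> {..k}\<close>
    by (intro sum.mono_neutral_right) (auto simp: U_tau)
  then have coeffs: "coeff (T_minus s \<tau>) j = of_nat (q choose j) * s ^ (q - j)
      - \<omega> ^ (q - 1) * sign_q * of_nat (1 choose j) * s ^ (1 - j)
      - \<omega> ^ q * \<zeta> * of_nat (0 choose j) * s ^ (0 - j)" for j
    using q_ge_2 by (simp add: U_tau)
  show "coeff (T_minus s \<tau>) 0 = \<kappa> * s - \<omega> ^ q * \<zeta>"
    "coeff (T_minus s \<tau>) 1 = of_nat q * s ^ (q - 1) - \<omega> ^ (q - 1) * sign_q"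
    using coeffs[of 0] coeffs[of 1] q_ge_2 L_power_q[OF assms]
    by (simp_all add: \<kappa>_def algebra_simps)
  show "coeff (T_minus s \<tau>) q = 1"
    using coeff_T_minus_top[of s \<tau>] k_eq_q by (simp add: coeff_tau)
qed

lemma f_eq: "f w = v w + smult (\<gamma> w) \<tau>"
  by (simp add: v_def)

lemma degree_v: "degree (v w) < q"
proof -
  have "degree (v w) \<le> q"
    unfolding v_def using degree_f[of w] degree_tau k_eq_q
    by (intro degree_diff_le order_trans[OF degree_smult_le]) simp_all
  moreover have "coeff (v w) q = 0" by (simp add: v_def \<gamma>_def coeff_tau)
  ultimately show ?thesis using q_ge_2
    by (metis leading_coeff_0_iff degree_0 le_neq_implies_less not_numeral_le_zero)
qed

lemma gauss_U_v_le: "gauss (U (v w)) \<le> N \<omega> * gauss (v w)"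
  unfolding gauss_le_iff
proof
  fix i
  show "N (coeff (U (v w)) i) \<le> N \<omega> * gauss (v w)"
  proof (cases "i < q")
    case True
    then have "N (coeff (U (v w)) i) \<le> N \<omega> ^ 1 * N (coeff (v w) i)"
      using k_eq_q by (intro N_coeff_U_le) linarith
    also have "\<dots> \<le> N \<omega> * gauss (v w)" by (simp add: N_coeff_le_gauss mult_left_mono)
    finally show ?thesis .
  next
    case False
    then show ?thesis using degree_v[of w] by (simp add: coeff_U coeff_eq_0)
  qed
qed

lemma N_coeff_T_minus_v_le: "s \<in> L \<Longrightarrow> N (coeff (T_minus s (v w)) j) \<le> N \<omega> * gauss (v w)"
proof -
  assume "s \<in> L"
  then have "gauss (T_minus s (v w)) \<le> gauss (U (v w))"
    unfolding T_minus_def by (intro gauss_pcompose_le) (simp add: gauss_pCons N_digit_le_one)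
  then show ?thesis
    using N_coeff_le_gauss[of "T_minus s (v w)" j] gauss_U_v_le[of w] by linarith
qed

definition defect :: "'a \<Rightarrow> 'a list \<Rightarrow> 'a poly" where
  "defect t w = smult a (v (t # w)) - T_plus t (v w) - (\<Sum>s\<in>L. T_minus s (v (s # t # w))) - err t w"

lemma defect_eq:
  "defect t w = smult (\<gamma> w) (T_plus t \<tau>) + (\<Sum>s\<in>L. smult (\<gamma> (s # t # w)) (T_minus s \<tau>))
    - smult (a * \<gamma> (t # w)) \<tau>"
proof -
  have "T_plus t (f w) = T_plus t (v w) + smult (\<gamma> w) (T_plus t \<tau>)"
    by (subst f_eq) (simp only: T_plus_add T_plus_smult)
  moreover have "T_minus s (f y) = T_minus s (v y) + smult (\<gamma> y) (T_minus s \<tau>)" for s y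
    by (subst f_eq) (simp only: T_minus_add T_minus_smult)
  moreover have "smult a (f (t # w)) = smult a (v (t # w)) + smult (a * \<gamma> (t # w)) \<tau>"
    by (subst f_eq) (simp only: smult_add_right smult_smult)
  ultimately show ?thesis
    by (simp add: defect_def err_def children_sum_def sum.distrib)
qed

lemma gamma_child_eq:
  assumes t: "t \<in> L"
  shows "a * \<gamma> (t # w) = \<omega> ^ q * \<gamma> w + (\<Sum>s\<in>L. \<gamma> (s # t # w)) + coeff (err t w) q"
proof -
  have "coeff (T_plus t (v w)) q = 0" "coeff (T_minus s (v y)) q = 0" "coeff (v y) q = 0" for s y
    using degree_v[of w] degree_v[of y] coeff_T_plus_top[of "v w" q t] coeff_T_minus_top[of s "v y"] k_eq_q
    by (simp_all add: coeff_eq_0)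
  then have "coeff (defect t w) q = - coeff (err t w) q" by (simp add: defect_def coeff_sum)
  moreover have "coeff (defect t w) q = \<omega> ^ q * \<gamma> w + (\<Sum>s\<in>L. \<gamma> (s # t # w)) - a * \<gamma> (t # w)"
    unfolding defect_eq using t by (simp add: coeff_sum coeff_T_plus_tau coeff_T_minus_tau coeff_tau)
  ultimately show ?thesis by (simp add: algebra_simps)
qed

lemma digit_power_pred_q: "s \<in> L \<Longrightarrow> s ^ (q - 1) = (if s = 0 then 0 else 1)"
  using L_power_q[of s] power_minus_mult[of q s] q_ge_2 by (auto simp: power_0_left)

lemma coeff_defect_1:
  assumes t: "t \<in> L"
  shows "sign_q * coeff (defect t w) 1 = \<gamma> w * \<omega> * Q * (- t) ^ (q - 1) - \<omega> * \<gamma> w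
    + (Q - \<omega> ^ (q - 1)) * (\<Sum>s\<in>L. \<gamma> (s # t # w)) - Q * \<gamma> (0 # t # w) + a * \<gamma> (t # w)"
proof -
  define G where "G = (\<Sum>s\<in>L. \<gamma> (s # t # w))"
  have sign: "sign_q * (sign_q * x) = x" for x by (simp flip: mult.assoc)
  have "(\<Sum>s\<in>L. \<gamma> (s # t # w) * s ^ (q - 1))
      = (\<Sum>s\<in>L. \<gamma> (s # t # w) - (if s = 0 then \<gamma> (s # t # w) else 0))"
    using digit_power_pred_q by (intro sum.cong) auto
  also have "\<dots> = G - \<gamma> (0 # t # w)" using finite_L zero_in_L by (simp add: sum_subtractf G_def)
  finally have G1: "(\<Sum>s\<in>L. \<gamma> (s # t # w) * s ^ (q - 1)) = G - \<gamma> (0 # t # w)" .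
  have "(\<Sum>s\<in>L. \<gamma> (s # t # w) * coeff (T_minus s \<tau>) 1)
      = (\<Sum>s\<in>L. of_nat q * (\<gamma> (s # t # w) * s ^ (q - 1)) - \<omega> ^ (q - 1) * sign_q * \<gamma> (s # t # w))"
    by (intro sum.cong refl) (simp only: coeff_T_minus_tau(2), simp add: algebra_simps)
  also have "\<dots> = of_nat q * (G - \<gamma> (0 # t # w)) - \<omega> ^ (q - 1) * sign_q * G"
    by (simp only: sum_subtractf G1 G_def flip: sum_distrib_left)
  finally have coeff_1: "coeff (defect t w) 1 = \<gamma> w * (\<omega> * (of_nat q * (- t) ^ (q - 1) - sign_q))
      + (of_nat q * (G - \<gamma> (0 # t # w)) - \<omega> ^ (q - 1) * sign_q * G) + a * \<gamma> (t # w) * sign_q"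
    unfolding defect_eq coeff_diff coeff_add coeff_smult coeff_sum coeff_T_plus_tau(2)[OF t]
    using q_ge_2 by (simp only: coeff_tau) simp
  show ?thesis unfolding coeff_1 Q_def G_def[symmetric] by (simp add: algebra_simps sign)
qed

lemma N_coeff_defect_1_le:
  assumes w: "w \<in> lists L" and t: "t \<in> L"
    and v_child_le: "N a * gauss (v (t # w)) \<le> B" and v_le: "N \<omega> * gauss (v w) \<le> B"
    and v_grandchild_le: "\<And>s. s \<in> L \<Longrightarrow> N \<omega> * gauss (v (s # t # w)) \<le> B" and eta: "\<eta> \<le> B"
  shows "N (coeff (defect t w) 1) \<le> B"
proof -
  have "N (a * coeff (v (t # w)) 1) \<le> N a * gauss (v (t # w))"
    unfolding N_mult by (intro mult_left_mono N_coeff_le_gauss) simp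
  moreover have "N (coeff (T_plus t (v w)) 1) \<le> N \<omega> * gauss (v w)"
    using N_coeff_T_plus_le[OF t, of "v w" 1] by simp
  moreover have "N (\<Sum>s\<in>L. coeff (T_minus s (v (s # t # w))) 1) \<le> B"
    using order_trans[OF N_coeff_T_minus_v_le v_grandchild_le] order_trans[OF eta_nonneg eta]
    by (intro N_sum_le)
  moreover have "N (coeff (err t w) 1) \<le> B" by (rule order_trans[OF N_coeff_err_le[OF w t] eta])
  ultimately show ?thesis
    unfolding defect_def coeff_diff coeff_smult coeff_sum using v_child_le v_le
    by (intro N_diff_le) linarith+
qed

lemma N_gamma_equation_le:
  assumes w: "w \<in> lists L" and t: "t \<in> L"
    and gamma_le: "N \<omega> * N \<omega> * N (\<gamma> w) \<le> B" and v_child_le: "N a * gauss (v (t # w)) \<le> B"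
    and v_le: "N \<omega> * gauss (v w) \<le> B"
    and v_grandchild_le: "\<And>s. s \<in> L \<Longrightarrow> N \<omega> * gauss (v (s # t # w)) \<le> B" and eta: "\<eta> \<le> B"
  shows "N (a' * \<gamma> (t # w) - \<omega> * \<gamma> w - Q * \<gamma> (0 # t # w)) \<le> B"
proof -
  define R where "R = \<omega> ^ q * \<gamma> w + coeff (err t w) q"
  have err: "N (coeff (err t w) j) \<le> B" for j by (rule order_trans[OF N_coeff_err_le[OF w t] eta])
  have sum_eq: "(\<Sum>s\<in>L. \<gamma> (s # t # w)) = a * \<gamma> (t # w) - R"
    using gamma_child_eq[OF t, of w] by (simp add: R_def)
  have "a' * \<gamma> (t # w) - \<omega> * \<gamma> w - Q * \<gamma> (0 # t # w) = sign_q * coeff (defect t w) 1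
      - \<gamma> w * \<omega> * Q * (- t) ^ (q - 1) + (Q - \<omega> ^ (q - 1)) * R"
    unfolding coeff_defect_1[OF t] sum_eq by (simp add: a'_def algebra_simps)
  moreover have "N (sign_q * coeff (defect t w) 1) \<le> B"
    using N_coeff_defect_1_le[OF w t v_child_le v_le v_grandchild_le eta] by (simp add: N_mult)
  moreover have "N (\<gamma> w * \<omega> * Q * (- t) ^ (q - 1)) \<le> B"
  proof -
    have "N (\<gamma> w * \<omega> * Q * (- t) ^ (q - 1)) \<le> N (\<gamma> w) * N \<omega> * N \<omega> * 1"
      by (intro N_mult_le N_Q_le N_power_le_one) (simp_all add: N_digit_le_one[OF t])
    then show ?thesis using gamma_le by (simp add: mult_ac)
  qed
  moreover have "N ((Q - \<omega> ^ (q - 1)) * R) \<le> B"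
  proof -
    have "N (\<omega> * (\<omega> ^ q * \<gamma> w)) \<le> N \<omega> * (N \<omega> * N (\<gamma> w))"
      using q_ge_2 by (intro N_mult_le N_omega_power_le order_refl) simp
    moreover have "N (\<omega> * coeff (err t w) q) \<le> 1 * B"
      using N_omega_less_one err by (intro N_mult_le) simp_all
    ultimately have "N (\<omega> * R) \<le> B"
      unfolding R_def distrib_left using gamma_le by (intro N_add_le) (simp_all add: mult_ac)
    then show ?thesis
      using mult_right_mono[OF N_Q_minus_omega_power_le, of "N R"] by (simp add: N_mult)
  qed
  ultimately show ?thesis by (simp add: N_add_le N_diff_le)
qed

lemma poly_v_eq:
  assumes t: "t \<in> L"
  shows "poly (v w) (- t) = a * coeff (v (t # w)) 0
    - (\<Sum>s\<in>L. coeff (T_minus s (v (s # t # w))) 0) - coeff (err t w) 0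
    - (\<Sum>s\<in>L. (\<kappa> * s - \<omega> ^ q * \<zeta>) * \<delta> (s # t # w))
    - (a * \<zeta> + \<kappa> * \<xi> * (\<Sum>s\<in>L. s) - \<omega> ^ q * \<zeta> * of_nat q * \<xi>) * \<delta> (t # w)"
proof -
  define z where "z = t # w"
  define K where "K = a * \<zeta> + \<kappa> * \<xi> * (\<Sum>s\<in>L. s) - \<omega> ^ q * \<zeta> * of_nat q * \<xi>"
  define S where "S = (\<Sum>s\<in>L. (\<kappa> * s - \<omega> ^ q * \<zeta>) * \<delta> (s # z))"
  have "\<zeta> = K * \<xi>" using zeta_eq by (simp add: K_def algebra_simps power2_eq_square)
  then have K_gamma: "K * \<gamma> z = K * \<delta> z + \<zeta> * \<gamma> w" by (simp add: \<delta>_def z_def algebra_simps)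
  have "(\<Sum>s\<in>L. \<gamma> (s # z) * (\<kappa> * s - \<omega> ^ q * \<zeta>))
      = (\<Sum>s\<in>L. (\<kappa> * s - \<omega> ^ q * \<zeta>) * \<delta> (s # z) + (\<kappa> * \<xi> * \<gamma> z * s - \<omega> ^ q * \<zeta> * \<xi> * \<gamma> z))"
    by (intro sum.cong) (simp_all add: \<delta>_def algebra_simps)
  also have "\<dots> = S + (\<kappa> * \<xi> * \<gamma> z * (\<Sum>s\<in>L. s) - of_nat q * (\<omega> ^ q * \<zeta> * \<xi> * \<gamma> z))"
    unfolding S_def sum.distrib sum_subtractf by (simp add: card_L flip: sum_distrib_left)
  also have "\<dots> = S + K * \<gamma> z - a * \<zeta> * \<gamma> z" by (simp add: K_def algebra_simps)
  finally have sum_eq: "(\<Sum>s\<in>L. \<gamma> (s # z) * (\<kappa> * s - \<omega> ^ q * \<zeta>)) = S + K * \<gamma> z - a * \<zeta> * \<gamma> z" .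
  have "coeff (defect t w) 0 = a * coeff (v z) 0 - poly (v w) (- t)
      - (\<Sum>s\<in>L. coeff (T_minus s (v (s # z))) 0) - coeff (err t w) 0"
    by (simp add: defect_def coeff_sum coeff_T_plus_0 z_def)
  moreover have "coeff (defect t w) 0
      = - \<zeta> * \<gamma> w + (\<Sum>s\<in>L. \<gamma> (s # z) * (\<kappa> * s - \<omega> ^ q * \<zeta>)) + a * \<zeta> * \<gamma> z"
    unfolding defect_eq using t q_ge_2
    by (simp add: coeff_sum coeff_T_plus_tau(1) coeff_T_minus_tau(1) coeff_tau z_def cong: sum.cong)
  ultimately show ?thesis
    unfolding sum_eq K_gamma z_def[symmetric] S_def[symmetric] K_def[symmetric]
    by (simp add: algebra_simps)
qed

lemma N_poly_v_le:
  assumes w: "w \<in> lists L" and t: "t \<in> L"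
    and v_child_le: "gauss (v (t # w)) \<le> B" and delta_child_le: "N (\<delta> (t # w)) \<le> B"
    and v_grandchild_le: "\<And>s. s \<in> L \<Longrightarrow> gauss (v (s # t # w)) \<le> B"
    and delta_grandchild_le: "\<And>s. s \<in> L \<Longrightarrow> N (\<delta> (s # t # w)) \<le> B"
    and eta: "\<eta> \<le> B"
  shows "N (poly (v w) (- t)) \<le> B"
proof -
  have B: "0 \<le> B" by (rule order_trans[OF eta_nonneg eta])
  have "N (a * coeff (v (t # w)) 0) \<le> B"
    using N_a_less_one order_trans[OF N_coeff_le_gauss v_child_le] by (intro N_mult_le_right) simp_all
  moreover have "N (coeff (T_minus s (v (s # t # w))) 0) \<le> B" if s: "s \<in> L" for s
  proof -
    have "N \<omega> * gauss (v (s # t # w)) \<le> 1 * B"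
      using N_omega_less_one v_grandchild_le[OF s] by (intro mult_mono) simp_all
    then show ?thesis using N_coeff_T_minus_v_le[OF s, of "s # t # w" 0] by simp
  qed
  then have "N (\<Sum>s\<in>L. coeff (T_minus s (v (s # t # w))) 0) \<le> B" using B by (intro N_sum_le)
  moreover have "N (coeff (err t w) 0) \<le> B" by (rule order_trans[OF N_coeff_err_le[OF w t] eta])
  moreover have "N (\<Sum>s\<in>L. (\<kappa> * s - \<omega> ^ q * \<zeta>) * \<delta> (s # t # w)) \<le> B"
  proof (rule N_sum_le[OF N_mult_le_right B])
    fix s assume s: "s \<in> L"
    have "N (\<kappa> * s) \<le> 1 * 1" "N (\<omega> ^ q * \<zeta>) \<le> 1 * 1"
      by (intro N_mult_le N_kappa_le_one N_digit_le_one s N_omega_power_le_one N_zeta_le_one)+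
    then show "N (\<kappa> * s - \<omega> ^ q * \<zeta>) \<le> 1" by (simp add: N_diff_le)
  qed (rule delta_grandchild_le)
  moreover have "N ((a * \<zeta> + \<kappa> * \<xi> * (\<Sum>s\<in>L. s) - \<omega> ^ q * \<zeta> * of_nat q * \<xi>) * \<delta> (t # w)) \<le> B"
  proof (rule N_mult_le_right[OF _ delta_child_le])
    have "N (a * \<zeta>) \<le> 1 * 1" "N (\<kappa> * \<xi> * (\<Sum>s\<in>L. s)) \<le> 1 * 1 * 1"
      "N (\<omega> ^ q * \<zeta> * of_nat q * \<xi>) \<le> 1 * 1 * 1 * 1"
      using N_a_less_one N_xi_less_one
      by (intro N_mult_le N_kappa_le_one N_sum_digits_le_one N_omega_power_le_one N_zeta_le_one
          N_of_nat_le_one; simp)+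
    then show "N (a * \<zeta> + \<kappa> * \<xi> * (\<Sum>s\<in>L. s) - \<omega> ^ q * \<zeta> * of_nat q * \<xi>) \<le> 1"
      by (simp add: N_add_le N_diff_le)
  qed
  ultimately show ?thesis unfolding poly_v_eq[OF t] by (intro N_diff_le)
qed

lemma gauss_v_le:
  assumes eta: "\<eta> \<le> B" and delta_le: "\<And>z. z \<in> lists L \<Longrightarrow> n < length z \<Longrightarrow> N (\<delta> z) \<le> B"
    and w: "w \<in> lists L" "n \<le> length w"
  shows "gauss (v w) \<le> B"
  using w
proof (induction "Suc M - length w" arbitrary: w rule: less_induct)
  case less
  show ?case
  proof (cases "M < length w")
    case True
    then show ?thesis using order_trans[OF eta_nonneg eta] by (simp add: v_def \<gamma>_def f_vanish)
  next
    case False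
    have "N (poly (v w) (- t)) \<le> B" if t: "t \<in> L" for t
    proof (rule N_poly_v_le[OF less.prems(1) t])
      show "N (\<delta> (t # w)) \<le> B" using t less.prems by (intro delta_le) auto
      show "gauss (v (t # w)) \<le> B" using t less.prems False by (intro less.hyps) auto
      fix s assume "s \<in> L"
      then show "N (\<delta> (s # t # w)) \<le> B" using t less.prems by (intro delta_le) auto
      show "gauss (v (s # t # w)) \<le> B" using \<open>s \<in> L\<close> t less.prems False by (intro less.hyps) auto
    qed (rule eta)
    then show ?thesis by (rule gauss_le_of_digit_values[OF degree_v])
  qed
qed

lemma N_delta_step:
  assumes w: "w \<in> lists L" and t: "t \<in> L"
    and delta_le: "N \<omega> * N (\<delta> (0 # t # w)) \<le> B"
    and gamma_le: "N \<omega> * N \<omega> * N (\<gamma> w) \<le> B" and v_child_le: "N a * gauss (v (t # w)) \<le> B"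
    and v_le: "N \<omega> * gauss (v w) \<le> B"
    and v_grandchild_le: "\<And>s. s \<in> L \<Longrightarrow> N \<omega> * gauss (v (s # t # w)) \<le> B" and eta: "\<eta> \<le> B"
  shows "N a * N (\<delta> (t # w)) \<le> B"
proof -
  have "(a' - Q * \<xi>) * \<delta> (t # w) = (a' * \<gamma> (t # w) - \<omega> * \<gamma> w - Q * \<gamma> (0 # t # w))
      + Q * \<delta> (0 # t # w) - (a' * \<xi> - \<omega> - Q * \<xi>\<^sup>2) * \<gamma> w"
    by (simp add: \<delta>_def algebra_simps power2_eq_square)
  moreover have "N (Q * \<delta> (0 # t # w)) \<le> B"
    using mult_right_mono[OF N_Q_le, of "N (\<delta> (0 # t # w))"] delta_le by (simp add: N_mult)
  moreover have "N ((a' * \<xi> - \<omega> - Q * \<xi>\<^sup>2) * \<gamma> w) \<le> B"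
    using mult_right_mono[OF N_xi_root, of "N (\<gamma> w)"] gamma_le by (simp add: N_mult)
  moreover note N_gamma_equation_le[OF w t gamma_le v_child_le v_le v_grandchild_le eta]
  ultimately have "N ((a' - Q * \<xi>) * \<delta> (t # w)) \<le> B" by (simp add: N_add_le N_diff_le)
  moreover have "N (Q * \<xi>) \<le> N \<omega> * 1" using N_Q_le N_xi_less_one by (intro N_mult_le) auto
  then have "N (- (Q * \<xi>)) < N a'" using omega_less_a N_a'_eq by simp
  then have "N (a' - Q * \<xi>) = N a" using N_add_eq_left N_a'_eq by (metis diff_conv_add_uminus)
  ultimately show ?thesis by (simp add: N_mult)
qed

definition R :: real where "R = max (N \<omega> * N \<omega> * A / N a) (\<eta> / N a)"

lemma R_nonneg: "0 \<le> R"
  and eta_le_N_a_R: "\<eta> \<le> N a * R"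
  and omega_square_A_le: "N \<omega> * N \<omega> * A \<le> N a * R"
  and eta_le_R: "\<eta> \<le> R"
  and R_less_N_a_A: "R < N a * A"
  and R_less_A: "R < A"
proof -
  show nonneg: "0 \<le> R" unfolding R_def using eta_nonneg by (simp add: le_max_iff_disj)
  have "\<eta> / N a \<le> R" "N \<omega> * N \<omega> * A / N a \<le> R" by (simp_all add: R_def)
  then show le: "\<eta> \<le> N a * R" "N \<omega> * N \<omega> * A \<le> N a * R"
    using N_a_pos by (simp_all add: pos_divide_le_eq mult.commute)
  have "N a * R \<le> R" using nonneg N_a_less_one by (simp add: mult_left_le_one_le)
  then show "\<eta> \<le> R" using le by linarith
  have "N \<omega> * N \<omega> < N a * N a" using omega_less_a N_a_pos by (intro mult_strict_mono) simp_all
  from mult_strict_right_mono[OF this A_pos] have "N \<omega> * N \<omega> * A < N a * (N a * A)"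
    by (simp add: mult.assoc)
  then show "R < N a * A" unfolding R_def using eta_less N_a_pos
    by (simp add: pos_divide_less_eq mult.commute)
  then show "R < A" using N_a_A_less by linarith
qed

lemma N_gamma_le: "w \<in> lists L \<Longrightarrow> w \<noteq> [] \<Longrightarrow> N (\<gamma> w) \<le> A"
  unfolding \<gamma>_def by (rule order_trans[OF N_coeff_le_gauss gauss_f_le_A])

lemma N_delta_le_of_maximal:
  assumes t: "t \<in> L" and w: "w \<in> lists L" "w \<noteq> []"
    and deeper: "\<And>y. y \<in> lists L \<Longrightarrow> Suc (length w) < length y \<Longrightarrow> N (\<delta> y) \<le> R"
    and maximal: "\<And>y. y \<in> lists L \<Longrightarrow> length y = Suc (length w) \<Longrightarrow> N (\<delta> y) \<le> N (\<delta> (t # w))"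
  shows "N (\<delta> (t # w)) \<le> R"
proof (rule ccontr)
  assume "\<not> ?thesis"
  then have R_less: "R < N (\<delta> (t # w))" by simp
  have v_le_R: "gauss (v y) \<le> R" if "y \<in> lists L" "Suc (length w) \<le> length y" for y
    by (rule gauss_v_le[OF eta_le_R deeper that])
  have "N (\<delta> y) \<le> N (\<delta> (t # w))" if "y \<in> lists L" "length w < length y" for y
    using maximal[of y] deeper[of y] that R_less by (cases "length y = Suc (length w)") auto
  then have v_w_le: "gauss (v w) \<le> N (\<delta> (t # w))"
    using eta_le_R R_less w(1) by (intro gauss_v_le[of _ "length w"]) auto
  define B where "B = max (N a * R) (N \<omega> * N (\<delta> (t # w)))"
  have omega_le_B: "N \<omega> * x \<le> B" if "0 \<le> x" "x \<le> R" for x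
  proof -
    have "N \<omega> * x \<le> N a * R" using that omega_less_a by (intro mult_mono) simp_all
    then show ?thesis by (simp add: B_def)
  qed
  have "N a * N (\<delta> (t # w)) \<le> B"
  proof (rule N_delta_step[OF w(1) t])
    show "N \<omega> * N (\<delta> (0 # t # w)) \<le> B"
      using t w(1) zero_in_L by (intro omega_le_B deeper) simp_all
    have "N \<omega> * N \<omega> * N (\<gamma> w) \<le> N \<omega> * N \<omega> * A"
      using N_gamma_le[OF w] by (intro mult_left_mono) simp_all
    then show "N \<omega> * N \<omega> * N (\<gamma> w) \<le> B" using omega_square_A_le by (simp add: B_def)
    show "N a * gauss (v (t # w)) \<le> B"
      using v_le_R[of "t # w"] t w(1) N_a_pos by (simp add: B_def le_max_iff_disj)
    show "N \<omega> * gauss (v w) \<le> B" using v_w_le by (simp add: B_def le_max_iff_disj mult_left_mono)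
    show "N \<omega> * gauss (v (s # t # w)) \<le> B" if "s \<in> L" for s
      using that t w(1) by (intro omega_le_B v_le_R) simp_all
    show "\<eta> \<le> B" using eta_le_N_a_R by (simp add: B_def)
  qed
  moreover have "0 < N (\<delta> (t # w))" using R_less R_nonneg by linarith
  from mult_strict_right_mono[OF omega_less_a this] have "B < N a * N (\<delta> (t # w))"
    using R_less N_a_pos by (simp add: B_def)
  ultimately show False by simp
qed

lemma N_delta_le:
  assumes "z \<in> lists L" "2 \<le> length z" shows "N (\<delta> z) \<le> R"
  using assms
proof (induction "M + 2 - length z" arbitrary: z rule: less_induct)
  case less
  show ?case
  proof (cases "M + 1 < length z")
    case True
    then show ?thesis using R_nonneg by (simp add: \<delta>_def \<gamma>_def f_vanish)
  next
    case False
    define X where "X = {y \<in> lists L. length y = length z}"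
    have fin: "finite X" unfolding X_def by (rule finite_subset[OF _ finite_words[of "length z"]]) auto
    have zX: "z \<in> X" using less.prems by (simp add: X_def)
    obtain y where y: "y \<in> X" "Max ((\<lambda>x. N (\<delta> x)) ` X) = N (\<delta> y)"
      using obtains_MAX[OF fin] zX by blast
    have max: "N (\<delta> x) \<le> N (\<delta> y)" if "x \<in> X" for x
      unfolding y(2)[symmetric] using that fin by simp
    obtain t w where w: "y = t # w" "t \<in> L" "w \<in> lists L" "length z = Suc (length w)"
      using y(1) less.prems(2) by (cases y) (auto simp: X_def)
    have "N (\<delta> (t # w)) \<le> R"
    proof (rule N_delta_le_of_maximal[OF w(2,3)])
      show "w \<noteq> []" using w(4) less.prems(2) by auto
      show "N (\<delta> x) \<le> R" if "x \<in> lists L" "Suc (length w) < length x" for x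
        using that w(4) less.prems(2) False by (intro less.hyps) auto
      show "N (\<delta> x) \<le> N (\<delta> (t # w))" if "x \<in> lists L" "length x = Suc (length w)" for x
        using max[of x] that w(1,4) by (simp add: X_def)
    qed
    then show ?thesis using max[OF zX] w(1) by simp
  qed
qed

lemma gauss_v_le_R: "w \<in> lists L \<Longrightarrow> w \<noteq> [] \<Longrightarrow> gauss (v w) \<le> R"
  by (rule gauss_v_le[of _ 1]) (simp_all add: eta_le_R N_delta_le Suc_le_eq)

lemma gauss_v_root_le: "gauss (v []) \<le> max A (N \<xi> * N (\<gamma> []))"
proof (rule gauss_v_le[of _ 0])
  show "\<eta> \<le> max A (N \<xi> * N (\<gamma> []))" using eta_less_A by simp
  fix z assume z: "z \<in> lists L" "0 < length z"
  show "N (\<delta> z) \<le> max A (N \<xi> * N (\<gamma> []))"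
  proof (cases "length z = 1")
    case True
    then obtain t where t: "z = [t]" by (auto simp: length_Suc_conv)
    then show ?thesis unfolding \<delta>_def using N_gamma_le[of "[t]"] z(1)
      by (intro N_diff_le) (auto simp: N_mult le_max_iff_disj)
  next
    case False
    then have "N (\<delta> z) \<le> R" using z by (intro N_delta_le[OF z(1)]) linarith
    then show ?thesis using R_less_A by simp
  qed
qed simp_all

lemma N_gamma_root_equation_le:
  "N (a' * \<gamma> [0] - \<omega> * \<gamma> [] - Q * \<gamma> [0, 0])
    \<le> max (N a * A) (max (N \<omega> * max A (N \<xi> * N (\<gamma> []))) (N \<omega> * (N \<omega> * N (\<gamma> []))))" (is "_ \<le> ?B")
proof (rule N_gamma_equation_le[OF lists.Nil zero_in_L])
  have v_le: "x * gauss (v w) \<le> N a * A" if "w \<in> lists L" "w \<noteq> []" "x \<le> N a" "0 \<le> x" for x w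
    using mult_mono[OF that(3) order_trans[OF gauss_v_le_R[OF that(1,2)] less_imp_le[OF R_less_A]]]
    by simp
  show "N \<omega> * N \<omega> * N (\<gamma> []) \<le> ?B" by (simp add: mult.assoc le_max_iff_disj)
  show "N a * gauss (v [0]) \<le> ?B" using v_le[of "[0]" "N a"] zero_in_L by (simp add: le_max_iff_disj)
  show "N \<omega> * gauss (v []) \<le> ?B"
    using mult_left_mono[OF gauss_v_root_le, of "N \<omega>"] by (simp add: le_max_iff_disj)
  show "N \<omega> * gauss (v [s, 0]) \<le> ?B" if "s \<in> L" for s
    using v_le[of "[s, 0]" "N \<omega>"] that zero_in_L omega_less_a by (simp add: le_max_iff_disj)
  show "\<eta> \<le> ?B" using eta_less_N_a_A by (simp add: le_max_iff_disj)
qed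

lemma N_omega_gamma_root_le: "N \<omega> * N (\<gamma> []) \<le> N a * A"
proof (rule ccontr)
  define c where "c = N (\<gamma> [])"
  assume "\<not> ?thesis"
  then have big: "N a * A < N \<omega> * c" by (simp add: c_def)
  then have "0 < N \<omega> * c" using N_a_A_pos by linarith
  then have c: "0 < c" using N_omega_pos by (simp add: zero_less_mult_iff)
  have eq_less: "N (a' * \<gamma> [0] - \<omega> * \<gamma> [] - Q * \<gamma> [0, 0]) < N \<omega> * c"
  proof (rule le_less_trans[OF N_gamma_root_equation_le[folded c_def]])
    have "N \<omega> * A \<le> N a * A" using omega_less_a A_pos by simp
    then have "N \<omega> * A < N \<omega> * c" using big by linarith
    then have "A < c" using N_omega_pos by simp
    moreover have "N \<xi> * c < c" "N \<omega> * c < c" using N_xi_less_one N_omega_less_one c by simp_all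
    ultimately show "max (N a * A) (max (N \<omega> * max A (N \<xi> * c)) (N \<omega> * (N \<omega> * c))) < N \<omega> * c"
      using big N_omega_pos by simp
  qed
  have "N (a' * \<gamma> [0]) \<le> N a * A"
    using N_gamma_le[of "[0]"] zero_in_L by (intro N_mult_le) (simp_all add: N_a'_eq)
  then have child_less: "N (a' * \<gamma> [0]) < N \<omega> * c" using big by linarith
  have "N (Q * \<gamma> [0, 0]) \<le> N a * A"
    using N_gamma_le[of "[0, 0]"] zero_in_L N_Q_le omega_less_a by (intro N_mult_le) simp_all
  then have grandchild_less: "N (Q * \<gamma> [0, 0]) < N \<omega> * c" using big by linarith
  from N_diff_less[OF N_diff_less[OF child_less eq_less] grandchild_less]
  have "N (\<omega> * \<gamma> []) < N \<omega> * c" by simp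
  then show False by (simp add: N_mult c_def)
qed

lemma N_omega_power_q_gamma_less:
  assumes "y \<in> lists L" shows "N (\<omega> ^ q * \<gamma> y) < N a * A"
proof (cases "y = []")
  case True
  have "N (\<omega> ^ q * \<gamma> y) = N \<omega> ^ (q - 1) * (N \<omega> * N (\<gamma> []))"
    using power_minus_mult[of q "N \<omega>"] q_ge_2
    by (simp add: True N_mult N_power mult.assoc[symmetric])
  also have "\<dots> \<le> N \<omega> ^ (q - 1) * (N a * A)"
    using N_omega_gamma_root_le by (intro mult_left_mono) simp_all
  also have "\<dots> < N \<omega> ^ 0 * (N a * A)"
    using q_ge_2 N_a_A_pos by (intro mult_strict_right_mono omega_power_strict_mono) simp_all
  finally show ?thesis by simp
next
  case False
  have "N (\<omega> ^ q * \<gamma> y) \<le> N \<omega> ^ q * A"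
    using N_gamma_le[OF assms False] by (intro N_mult_le) (simp_all add: N_power)
  also have "\<dots> < N a * A" by (rule omega_power_A_less[OF order_refl])
  finally show ?thesis .
qed

lemma N_gamma_less:
  assumes "w \<in> lists L" "w \<noteq> []" shows "N (\<gamma> w) < A"
proof -
  obtain t y where w: "w = t # y" "t \<in> L" "y \<in> lists L" using assms by (cases w) auto
  have "(\<Sum>s\<in>L. \<gamma> (s # w)) = (\<Sum>s\<in>L. \<delta> (s # w)) + of_nat q * \<xi> * \<gamma> w"
    by (simp add: \<delta>_def sum_subtractf card_L)
  then have "(a - of_nat q * \<xi>) * \<gamma> w
      = \<omega> ^ q * \<gamma> y + (\<Sum>s\<in>L. \<delta> (s # w)) + coeff (err t y) q"
    using gamma_child_eq[OF w(2), of y] w(1) by (simp add: algebra_simps)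
  moreover have "N (\<Sum>s\<in>L. \<delta> (s # w)) < N a * A"
  proof (rule N_sum_less[OF _ N_a_A_pos])
    fix s assume "s \<in> L"
    then have "N (\<delta> (s # w)) \<le> R" using assms w by (intro N_delta_le) (auto simp: Suc_le_eq)
    then show "N (\<delta> (s # w)) < N a * A" using R_less_N_a_A by linarith
  qed
  moreover have "N (coeff (err t y) q) < N a * A"
    using N_coeff_err_le[OF w(3,2), of q] eta_less_N_a_A by linarith
  ultimately have "N ((a - of_nat q * \<xi>) * \<gamma> w) < N a * A"
    using N_omega_power_q_gamma_less[OF w(3)] by (simp add: N_add_less)
  moreover have "N (of_nat q * \<xi>) \<le> N \<omega> * 1"
    using N_q_le_omega N_xi_less_one by (intro N_mult_le) simp_all
  then have "N (- (of_nat q * \<xi>)) < N a" using omega_less_a by simp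
  then have "N (a - of_nat q * \<xi>) = N a" using N_add_eq_left by (metis diff_conv_add_uminus)
  ultimately show ?thesis using N_a_pos by (simp add: N_mult)
qed

lemma gauss_f_less:
  assumes "w \<in> lists L" "w \<noteq> []" shows "gauss (f w) < A"
proof -
  have "gauss (v w) < A" using gauss_v_le_R[OF assms] R_less_A by linarith
  moreover have "gauss (smult (\<gamma> w) \<tau>) \<le> N (\<gamma> w) * 1"
    unfolding gauss_smult by (intro mult_left_mono gauss_tau_le_one) simp
  then have "gauss (smult (\<gamma> w) \<tau>) < A" using N_gamma_less[OF assms] by linarith
  ultimately show ?thesis by (subst f_eq) (rule gauss_add_less)
qed

end

section \<open>The uniform bound on the tree\<close>

lemma (in critical_word) gauss_U_critical_less:
  assumes cond: "N \<omega> \<le> N a \<or> N \<omega> ^ Suc r \<le> N a * N a" and k: "d = 1 \<Longrightarrow> r \<noteq> 0"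
  shows "gauss (U (f z)) < m"
proof (cases "N \<omega> ^ Suc r \<le> N a * N a")
  case True
  then interpret critical_word_small_omega N \<omega> L q a p d r k f M \<eta> A t0 w0 m
    using k by unfold_locales auto
  show ?thesis by (rule gauss_U_z_less)
next
  case False
  then have om_a: "N \<omega> \<le> N a" using cond by simp
  have r: "r = 0"
  proof (rule ccontr)
    assume "r \<noteq> 0"
    then have "N \<omega> ^ Suc r \<le> N \<omega> ^ 2" by (intro omega_power_mono) simp
    also have "\<dots> \<le> N a * N a" unfolding power2_eq_square using om_a by (intro mult_mono) auto
    finally show False using False by simp
  qed
  show ?thesis
  proof (cases "d = 0")
    case True
    then show ?thesis using N_coeff_U_z_less_low by (simp add: gauss_less_iff)
  next
    case False
    moreover have "d \<noteq> 1" using k r by blast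
    ultimately interpret critical_word_r_0 N \<omega> L q a p d r k f M \<eta> A t0 w0 m
      using om_a r by unfold_locales linarith+
    show ?thesis by (rule gauss_U_z_less)
  qed
qed

lemma (in large_solution) gauss_f_below_root_less:
  assumes cond: "N \<omega> \<le> N a \<or> N \<omega> ^ Suc r \<le> N a * N a" and "d = 1 \<Longrightarrow> r = 0 \<Longrightarrow> N \<omega> < N a"
    and w: "w \<in> lists L" "w \<noteq> []"
  shows "gauss (f w) < A"
proof (cases "d = 1 \<and> r = 0")
  case True
  then interpret weight_q N \<omega> L q a p d r k f M \<eta> A using assms(2) by unfold_locales auto
  show ?thesis by (rule gauss_f_less[OF w])
next
  case False
  have "gauss (U (f y)) < N a * A" if y: "y \<in> lists L" "2 \<le> length y" for y
  proof (rule ccontr)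
    assume "\<not> ?thesis"
    then have "N a * A \<le> gauss (U (f y))" by simp
    then obtain t0 w0 where "critical_word N \<omega> L q a p d r k f M \<eta> A t0 w0 (gauss (U (f (t0 # w0))))"
      by (rule critical_word_exists[OF y])
    then interpret critical_word N \<omega> L q a p d r k f M \<eta> A t0 w0 "gauss (U (f (t0 # w0)))" .
    show False using gauss_U_critical_less[OF cond] False by auto
  qed
  then show ?thesis by (rule gauss_f_less_of_gauss_U_less[OF _ w])
qed

lemma (in hecke_tree) omega_power_q_less_N_a:
  assumes "N \<omega> \<le> N a \<or> N \<omega> ^ Suc r \<le> N a * N a" shows "N \<omega> ^ q < N a"
  using assms
proof
  assume "N \<omega> \<le> N a"
  moreover have "N \<omega> ^ q < N \<omega> ^ 1" using q_ge_2 by (intro omega_power_strict_mono) simp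
  ultimately show ?thesis by simp
next
  assume "N \<omega> ^ Suc r \<le> N a * N a"
  moreover have "N \<omega> ^ q \<le> N \<omega> ^ Suc r" using r_d_less_q by (intro omega_power_mono) simp
  ultimately show ?thesis using N_a_mult_less[OF N_a_pos] by linarith
qed

lemma (in hecke_solution) gauss_f_le_uniform:
  assumes cond: "N \<omega> \<le> N a \<or> N \<omega> ^ Suc r \<le> N a * N a" and w: "w \<in> lists L"
  shows "gauss (f w) \<le> \<eta> / (N \<omega> * (N a * N a) * N \<omega> ^ d)"
proof -
  define B where "B = \<eta> / (N \<omega> * (N a * N a))"
  have le_divide: "x \<le> x / y" if "0 \<le> x" "0 < y" "y \<le> 1" for x y :: real
    using that by (simp add: le_divide_eq mult_left_le)
  have a2: "0 < N a * N a" "N a * N a \<le> 1"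
    using N_a_pos N_a_less_one by (simp_all add: mult_le_one)
  have nonempty: "gauss (f y) \<le> B" if y: "y \<in> lists L" "y \<noteq> []" for y
  proof (cases "d = 1 \<and> r = 0 \<and> N a \<le> N \<omega>")
    case True
    then have "gauss (f y) \<le> \<eta> / N \<omega>"
      using gauss_f_le_of_k_eq_q y(1) N_omega_pos by (simp add: pos_le_divide_eq mult.commute)
    also have "\<dots> \<le> B"
      using le_divide[OF _ a2, of "\<eta> / N \<omega>"] eta_nonneg N_omega_pos by (simp add: B_def)
    finally show ?thesis .
  next
    case False
    have "gauss (f y) \<le> \<eta> / (N a * N a)"
    proof (rule gauss_f_le_of_large_solution[OF _ omega_power_q_less_N_a[OF cond] y])
      fix A assume "large_solution N \<omega> L q a p d r k f M \<eta> A"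
      then interpret large_solution N \<omega> L q a p d r k f M \<eta> A .
      show "\<forall>w\<in>lists L. w \<noteq> [] \<longrightarrow> gauss (f w) < A"
        using gauss_f_below_root_less[OF cond] False by fastforce
    qed
    also have "\<dots> \<le> B"
      using le_divide[of "\<eta> / (N a * N a)" "N \<omega>"] eta_nonneg N_omega_pos N_omega_less_one a2(1)
      by (simp add: B_def mult.commute)
    finally show ?thesis .
  qed
  have "N \<omega> * (N a * N a) \<le> 1" using N_omega_less_one a2 by (simp add: mult_le_one)
  then have "\<eta> \<le> B" unfolding B_def using eta_nonneg N_omega_pos a2 by (intro le_divide) simp_all
  then have root: "gauss (f []) \<le> B / N \<omega> ^ d" using nonempty by (intro gauss_root_le)
  have "B \<le> B / N \<omega> ^ d"
    using order_trans[OF eta_nonneg \<open>\<eta> \<le> B\<close>] N_omega_pos omega_power_le_one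
    by (intro le_divide) simp_all
  then have "gauss (f w) \<le> B / N \<omega> ^ d" using root nonempty[OF w] by (cases "w = []") auto
  then show ?thesis by (simp add: B_def)
qed

section \<open>Finite extensions of complete fields\<close>

context nonarch
begin

lemma metric_space: "Metric_space UNIV (\<lambda>x y. N (x - y))"
proof
  fix x y z
  show "N (x - y) = N (y - x)" by (rule N_minus_commute)
  have "N ((x - y) + (y - z)) \<le> max (N (x - y)) (N (y - z))" by (rule N_add_le_max)
  also have "\<dots> \<le> N (x - y) + N (y - z)" by simp
  finally show "N (x - z) \<le> N (x - y) + N (y - z)" by simp
qed simp_all

definition N_Cauchy :: "(nat \<Rightarrow> 'a) \<Rightarrow> bool" where
  "N_Cauchy X \<longleftrightarrow> (\<forall>e>0. \<exists>n0. \<forall>m\<ge>n0. \<forall>n\<ge>n0. N (X m - X n) < e)"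

definition complete_on :: "'a set \<Rightarrow> bool" where
  "complete_on V \<longleftrightarrow> Metric_space.mcomplete V (\<lambda>x y. N (x - y))"

lemma complete_on_iff:
  "complete_on V \<longleftrightarrow>
    (\<forall>X. (\<forall>n. X n \<in> V) \<longrightarrow> N_Cauchy X \<longrightarrow> (\<exists>l\<in>V. (\<lambda>n. N (X n - l)) \<longlonglongrightarrow> 0))"
proof -
  interpret Metric_space V "\<lambda>x y. N (x - y)" using metric_space by (rule Metric_space.subspace) simp
  show ?thesis
    unfolding complete_on_def mcomplete_def MCauchy_def limitin_metric_dist_null N_Cauchy_def
    by (auto simp: image_subset_iff) (metis eventually_sequentially)+
qed

lemma N_CauchyI_vanishing:
  assumes "\<And>n m. N (X (n + m) - X n) \<le> b n" "b \<longlonglongrightarrow> (0::real)"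
  shows "N_Cauchy X"
  unfolding N_Cauchy_def
proof (intro allI impI)
  fix e :: real assume "0 < e"
  then obtain n0 where n0: "b n0 < e"
    using order_tendstoD(2)[OF assms(2)] by (auto simp: eventually_sequentially)
  have "N (X n - X n0) < e" if "n \<ge> n0" for n using assms(1)[of n0 "n - n0"] that n0 by simp
  then have "N (X m - X n) < e" if "m \<ge> n0" "n \<ge> n0" for m n
    using N_diff_less[of "X m - X n0" e "X n - X n0"] that by simp
  then show "\<exists>n0. \<forall>m\<ge>n0. \<forall>n\<ge>n0. N (X m - X n) < e" by blast
qed

lemma N_Cauchy_of_le:
  assumes "N_Cauchy X" "0 < K" "\<And>m n. M (Y m - Y n :: 'b::minus) \<le> K * N (X m - X n)"
  shows "\<forall>e>0. \<exists>n0. \<forall>m\<ge>n0. \<forall>n\<ge>n0. M (Y m - Y n) < e"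
proof (intro allI impI)
  fix e :: real assume "0 < e"
  then have "0 < e / K" using assms(2) by simp
  then obtain n0 where "\<forall>m\<ge>n0. \<forall>n\<ge>n0. N (X m - X n) < e / K"
    using assms(1) unfolding N_Cauchy_def by blast
  then have "\<forall>m\<ge>n0. \<forall>n\<ge>n0. K * N (X m - X n) < e" using assms(2) by (simp add: field_simps)
  then show "\<exists>n0. \<forall>m\<ge>n0. \<forall>n\<ge>n0. M (Y m - Y n) < e" using assms(3) le_less_trans by blast
qed

lemma complete_on_dist_pos:
  assumes "complete_on V" "b \<notin> V"
  obtains d where "0 < d" "\<And>s. s \<in> V \<Longrightarrow> d \<le> N (b - s)"
proof -
  interpret metric: Metric_space UNIV "\<lambda>x y. N (x - y)" by (rule metric_space)
  interpret V: Submetric UNIV "\<lambda>x y. N (x - y)" V by unfold_locales simp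
  have "closedin metric.mtopology V"
    using V.mcomplete_imp_closedin assms(1) unfolding complete_on_def .
  then obtain d where "0 < d" "disjnt V (metric.mball b d)"
    using assms(2) unfolding metric.closedin_metric by blast
  then show thesis by (intro that[of d]) (fastforce simp: disjnt_iff not_less)+
qed

end

locale field_hom =
  fixes \<phi> :: "'a::field \<Rightarrow> 'b::field"
  assumes is_ring_hom: "is_ring_hom \<phi>"
begin

lemma mult: "\<phi> (x * y) = \<phi> x * \<phi> y" and one: "\<phi> 1 = 1"
  using is_ring_hom unfolding is_ring_hom_def by auto

sublocale additive \<phi>
  using is_ring_hom unfolding is_ring_hom_def by unfold_locales auto

lemma power: "\<phi> (x ^ n) = \<phi> x ^ n"
  by (induction n) (simp_all add: one mult)

lemma of_nat: "\<phi> (of_nat n) = of_nat n"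
  by (induction n) (simp_all add: zero one add)

lemma nonzero: "x \<noteq> 0 \<Longrightarrow> \<phi> x \<noteq> 0"
  using mult[of x "inverse x"] one by auto

lemma inverse: "\<phi> (inverse x) = inverse (\<phi> x)"
proof (cases "x = 0")
  case False
  then have "\<phi> x * \<phi> (inverse x) = 1" by (simp add: one flip: mult)
  then show ?thesis by (metis inverse_unique)
qed (simp add: zero)

lemma inj: "inj \<phi>"
  by (rule injI) (use nonzero diff in \<open>metis eq_iff_diff_eq_0\<close>)

end

locale complete_base_ext = base: nonarch N0 + nonarch N + hom: field_hom \<iota>
  for N0 :: "'k::field \<Rightarrow> real" and N :: "'l::field \<Rightarrow> real" and \<iota> :: "'k \<Rightarrow> 'l" +
  assumes N_hom: "\<And>x. N (\<iota> x) = N0 x" and complete_base: "base.complete_on UNIV"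
begin

sublocale vs: vector_space "\<lambda>c x. \<iota> c * x"
  by unfold_locales (simp_all add: hom.add hom.mult hom.one algebra_simps)

lemma span_coordinates_bounded:
  assumes complete: "complete_on (vs.span B)" and b: "b \<notin> vs.span B"
  obtains K where "1 \<le> K"
    "\<And>c s. s \<in> vs.span B \<Longrightarrow> N0 c \<le> K * N (\<iota> c * b + s)"
    "\<And>c s. s \<in> vs.span B \<Longrightarrow> N s \<le> K * N (\<iota> c * b + s)"
proof -
  obtain d where d: "0 < d" "\<And>s. s \<in> vs.span B \<Longrightarrow> d \<le> N (b - s)"
    using complete_on_dist_pos[OF complete b] by blast
  have coeff_le: "d * N0 c \<le> N (\<iota> c * b + s)" if s: "s \<in> vs.span B" for c s
  proof (cases "c = 0")
    case False
    have "- (\<iota> (inverse c) * s) \<in> vs.span B" using s by (intro vs.span_neg vs.span_scale)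
    from d(2)[OF this] have "d \<le> N (b + \<iota> (inverse c) * s)" by simp
    then have "N0 c * d \<le> N0 c * N (b + \<iota> (inverse c) * s)" by (intro mult_left_mono) simp_all
    also have "\<dots> = N (\<iota> c * (b + \<iota> (inverse c) * s))" by (simp add: N_mult N_hom)
    also have "\<iota> c * (b + \<iota> (inverse c) * s) = \<iota> c * b + s"
      using False hom.mult[of c "inverse c"] by (simp add: hom.one distrib_left flip: mult.assoc)
    finally show ?thesis by (simp add: mult.commute)
  qed simp
  define K where "K = max 1 (max (1 / d) (N b / d))"
  show thesis
  proof
    show "1 \<le> K" by (simp add: K_def)
    fix c s assume s: "s \<in> vs.span B"
    let ?x = "\<iota> c * b + s"
    have le: "y * N ?x \<le> K * N ?x" if "y \<le> K" for y using that by (intro mult_right_mono) simp_all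
    have "N0 c \<le> (1 / d) * N ?x" using coeff_le[OF s, of c] d(1) by (simp add: field_simps)
    also have "\<dots> \<le> K * N ?x" by (rule le) (simp add: K_def)
    finally show "N0 c \<le> K * N ?x" .
    have "N (\<iota> c * b) * d \<le> N ?x * N b"
      using mult_right_mono[OF coeff_le[OF s, of c], of "N b"] by (simp add: N_mult N_hom mult_ac)
    then have "N (\<iota> c * b) \<le> (N b / d) * N ?x" using d(1) by (simp add: field_simps)
    also have "\<dots> \<le> K * N ?x" by (rule le) (simp add: K_def)
    finally have "N (\<iota> c * b) \<le> K * N ?x" .
    moreover have "N ?x \<le> K * N ?x" using le[of 1] by (simp add: K_def)
    ultimately have "N (?x - \<iota> c * b) \<le> K * N ?x" by (intro N_diff_le)
    then show "N s \<le> K * N ?x" by simp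
  qed
qed

lemma span_insert_cases:
  assumes "x \<in> vs.span (insert b B)"
  obtains c s where "s \<in> vs.span B" "x = \<iota> c * b + s"
proof -
  obtain c where "x - \<iota> c * b \<in> vs.span B" using assms unfolding vs.span_insert by blast
  then show thesis by (intro that[of "x - \<iota> c * b" c]) simp_all
qed

lemma complete_on_span_insert:
  assumes complete: "complete_on (vs.span B)"
  shows "complete_on (vs.span (insert b B))"
proof (cases "b \<in> vs.span B")
  case True
  then show ?thesis using complete by (simp add: vs.span_redundant)
next
  case False
  obtain K where K: "1 \<le> K" "\<And>c s. s \<in> vs.span B \<Longrightarrow> N0 c \<le> K * N (\<iota> c * b + s)"
    "\<And>c s. s \<in> vs.span B \<Longrightarrow> N s \<le> K * N (\<iota> c * b + s)"
    using span_coordinates_bounded[OF complete False] by blast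
  show ?thesis unfolding complete_on_iff
  proof (intro allI impI)
    fix X assume "\<forall>n. X n \<in> vs.span (insert b B)" and cauchy: "N_Cauchy X"
    then have "\<forall>n. \<exists>c s. s \<in> vs.span B \<and> X n = \<iota> c * b + s" by (metis span_insert_cases)
    then obtain c s where s: "\<And>n. s n \<in> vs.span B" and X: "\<And>n. X n = \<iota> (c n) * b + s n" by metis
    have diff: "X m - X n = \<iota> (c m - c n) * b + (s m - s n)" for m n
      by (simp add: X hom.diff left_diff_distrib)
    have bounds: "N0 (c m - c n) \<le> K * N (X m - X n)" "N (s m - s n) \<le> K * N (X m - X n)" for m n
      unfolding diff by (intro K vs.span_diff s)+
    have "base.N_Cauchy c" "N_Cauchy s"
      unfolding base.N_Cauchy_def N_Cauchy_def
      using N_Cauchy_of_le[OF cauchy _ bounds(1)] N_Cauchy_of_le[OF cauchy _ bounds(2)] K(1) by auto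
    then obtain lc ls where lc: "(\<lambda>n. N0 (c n - lc)) \<longlonglongrightarrow> 0"
      and ls: "ls \<in> vs.span B" "(\<lambda>n. N (s n - ls)) \<longlonglongrightarrow> 0"
      using complete_base complete s unfolding base.complete_on_iff complete_on_iff by blast
    have lim: "(\<lambda>n. max (N0 (c n - lc) * N b) (N (s n - ls))) \<longlonglongrightarrow> 0"
      using tendsto_max[OF tendsto_mult_left_zero[OF lc, of "N b"] ls(2)] by simp
    have "N (X n - (\<iota> lc * b + ls)) \<le> max (N0 (c n - lc) * N b) (N (s n - ls))" for n
    proof -
      have "X n - (\<iota> lc * b + ls) = \<iota> (c n - lc) * b + (s n - ls)"
        by (simp add: X hom.diff left_diff_distrib)
      then show ?thesis using N_add_le_max[of "\<iota> (c n - lc) * b" "s n - ls"]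
        by (simp only: N_mult N_hom)
    qed
    then have "(\<lambda>n. N (X n - (\<iota> lc * b + ls))) \<longlonglongrightarrow> 0"
      by (intro Lim_null_comparison[OF always_eventually lim]) simp
    moreover have "\<iota> lc * b + ls \<in> vs.span (insert b B)"
      unfolding vs.span_insert using ls(1) by (intro CollectI exI[of _ lc]) simp
    ultimately show "\<exists>l\<in>vs.span (insert b B). (\<lambda>n. N (X n - l)) \<longlonglongrightarrow> 0" by blast
  qed
qed

theorem complete_on_span: "finite B \<Longrightarrow> complete_on (vs.span B)"
proof (induction B rule: finite_induct)
  case empty
  show ?case unfolding complete_on_iff by simp
qed (rule complete_on_span_insert)

theorem seminorm_bounded_on_span:
  assumes "finite B" and nonneg: "\<And>x. 0 \<le> \<nu> x" and add: "\<And>x y. \<nu> (x + y) \<le> max (\<nu> x) (\<nu> y)"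
    and scale: "\<And>c x. \<nu> (\<iota> c * x) = N0 c * \<nu> x"
  shows "\<exists>K::real. \<forall>x\<in>vs.span B. \<nu> x \<le> K * N x"
  using assms(1)
proof (induction B rule: finite_induct)
  case empty
  have "\<nu> 0 = 0" using scale[of 0 0] by (simp add: hom.zero)
  then show ?case by simp
next
  case (insert b B)
  then obtain K where K: "\<And>x. x \<in> vs.span B \<Longrightarrow> \<nu> x \<le> K * N x" by blast
  show ?case
  proof (cases "b \<in> vs.span B")
    case True
    then show ?thesis using K by (auto simp: vs.span_redundant)
  next
    case False
    obtain K' where K': "1 \<le> K'" "\<And>c s. s \<in> vs.span B \<Longrightarrow> N0 c \<le> K' * N (\<iota> c * b + s)"
      "\<And>c s. s \<in> vs.span B \<Longrightarrow> N s \<le> K' * N (\<iota> c * b + s)"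
      using span_coordinates_bounded[OF complete_on_span[OF insert.hyps(1)] False] by blast
    have "\<nu> x \<le> max (K' * \<nu> b) (\<bar>K\<bar> * K') * N x" if "x \<in> vs.span (insert b B)" for x
    proof -
      obtain c s where s: "s \<in> vs.span B" and x: "x = \<iota> c * b + s"
        by (rule span_insert_cases[OF \<open>x \<in> _\<close>])
      have "\<nu> (\<iota> c * b) \<le> (K' * N x) * \<nu> b"
        unfolding scale x by (intro mult_right_mono K'(2) s nonneg)
      moreover have "\<nu> s \<le> \<bar>K\<bar> * (K' * N x)"
      proof -
        have "\<nu> s \<le> \<bar>K\<bar> * N s" using K[OF s] by (rule order_trans) (intro mult_right_mono; simp)
        also have "\<dots> \<le> \<bar>K\<bar> * (K' * N x)" unfolding x by (intro mult_left_mono K'(3) s) simp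
        finally show ?thesis .
      qed
      ultimately have "max (\<nu> (\<iota> c * b)) (\<nu> s) \<le> max ((K' * \<nu> b) * N x) ((\<bar>K\<bar> * K') * N x)"
        by (intro max.mono) (simp_all add: mult_ac)
      with add[of "\<iota> c * b" s]
      have "\<nu> x \<le> max ((K' * \<nu> b) * N x) ((\<bar>K\<bar> * K') * N x)" unfolding x by (rule order_trans)
      also have "\<dots> = max (K' * \<nu> b) (\<bar>K\<bar> * K') * N x" by (simp add: max_mult_distrib_right)
      finally show ?thesis .
    qed
    then show ?thesis by blast
  qed
qed

end

section \<open>Teichmueller representatives\<close>

context nonarch
begin

lemma N_prod_diff_less_one:
  assumes "finite S" "\<And>i. i \<in> S \<Longrightarrow> N (g i) \<le> 1" "\<And>i. i \<in> S \<Longrightarrow> N (h i) \<le> 1"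
    and "\<And>i. i \<in> S \<Longrightarrow> N (g i - h i) < 1"
  shows "N (prod g S - prod h S) < 1"
  using assms
proof (induction S rule: finite_induct)
  case (insert x F)
  have "N (g x * (prod g F - prod h F)) < 1"
    using insert N_mult_le[of "g x" 1 "prod g F - prod h F" "N (prod g F - prod h F)"] by simp
  moreover have "N ((g x - h x) * prod h F) < 1"
    using insert.prems(3)[of x] insert.prems(2)
      N_mult_le[of "g x - h x" "N (g x - h x)" "prod h F" 1] N_prod_le_one[of F h] by fastforce
  moreover have "prod g (insert x F) - prod h (insert x F)
      = g x * (prod g F - prod h F) + (g x - h x) * prod h F"
    using insert.hyps by (simp add: algebra_simps)
  ultimately show ?case using N_add_less by metis
qed simp

lemma N_power_diff_le:
  assumes "N u \<le> 1" "N v \<le> 1"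
  shows "N (u ^ n - v ^ n) \<le> N (u - v)"
proof -
  have "N (\<Sum>j<n. v ^ (n - Suc j) * u ^ j) \<le> 1"
    by (intro N_sum_le N_mult_le_right N_power_le_one assms) simp
  then show ?thesis unfolding power_diff_sumr2 N_mult by (simp add: mult_left_le)
qed

lemma N_power_diff_le_max:
  assumes "N u \<le> 1" "N v \<le> 1"
  shows "N (u ^ n - v ^ n) \<le> N (u - v) * max (N (of_nat n)) (N (u - v))"
proof -
  have "(\<Sum>i<n. v ^ (n - Suc i) * v ^ i) = (\<Sum>i<n. v ^ (n - 1))"
    by (intro sum.cong) (auto simp flip: power_add)
  then have "(\<Sum>i<n. v ^ (n - Suc i) * u ^ i)
      = (\<Sum>i<n. v ^ (n - Suc i) * (u ^ i - v ^ i)) + v ^ (n - 1) * of_nat n"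
    by (simp add: right_diff_distrib sum_subtractf mult.commute)
  moreover have "N (\<Sum>i<n. v ^ (n - Suc i) * (u ^ i - v ^ i)) \<le> max (N (of_nat n)) (N (u - v))"
    using order_trans[OF N_power_diff_le[OF assms] max.cobounded2]
    by (intro N_sum_le N_mult_le_right N_power_le_one assms) (simp_all add: le_max_iff_disj)
  moreover have "N (v ^ (n - 1) * of_nat n) \<le> max (N (of_nat n)) (N (u - v))"
    by (intro N_mult_le_right N_power_le_one assms) simp
  ultimately have "N (\<Sum>i<n. v ^ (n - Suc i) * u ^ i) \<le> max (N (of_nat n)) (N (u - v))"
    by (simp only: N_add_le)
  then show ?thesis unfolding power_diff_sumr2[of u n v] N_mult by (intro mult_left_mono) auto
qed

definition residue_rel :: "('a \<times> 'a) set" where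
  "residue_rel = {(x, y). x \<in> int_ring N \<and> y \<in> int_ring N \<and> N (x - y) < 1}"

lemma residue_field_eq: "residue_field N = int_ring N // residue_rel"
  by (simp add: residue_field_def residue_rel_def)

lemma equiv_residue_rel: "equiv (int_ring N) residue_rel"
proof (rule equivI)
  show "trans residue_rel"
  proof (rule transI)
    fix x y z assume "(x, y) \<in> residue_rel" "(y, z) \<in> residue_rel"
    then show "(x, z) \<in> residue_rel" using N_add_less[of "x - y" 1 "y - z"]
      by (simp add: residue_rel_def)
  qed
qed (auto simp: residue_rel_def refl_on_def sym_def N_minus_commute)

end

locale finite_residue_field = nonarch N for N :: "'a::field \<Rightarrow> real" +
  fixes q :: nat
  assumes card_residue_field: "card (residue_field N) = q" and q_pos: "0 < q"
    and complete: "complete_on UNIV"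
begin

definition rep :: "'a \<Rightarrow> 'a" where "rep x = (SOME y. y \<in> residue_rel `` {x})"

definition reps :: "'a set" where "reps = rep ` int_ring N"

lemma residue_rel_rep:
  assumes "N x \<le> 1" shows "(x, rep x) \<in> residue_rel"
proof -
  have "x \<in> residue_rel `` {x}" using assms by (simp add: residue_rel_def int_ring_def)
  then have "rep x \<in> residue_rel `` {x}" unfolding rep_def by (rule someI)
  then show ?thesis by simp
qed

lemma N_rep_le_one: "N x \<le> 1 \<Longrightarrow> N (rep x) \<le> 1"
  and N_rep_diff_less_one: "N x \<le> 1 \<Longrightarrow> N (rep x - x) < 1"
  using residue_rel_rep[of x] N_minus_commute[of x "rep x"] by (auto simp: residue_rel_def int_ring_def)

lemma rep_eq_iff:
  assumes "N x \<le> 1" "N y \<le> 1" shows "rep x = rep y \<longleftrightarrow> N (x - y) < 1"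
proof
  assume "rep x = rep y"
  then show "N (x - y) < 1"
    using N_diff_less[OF N_rep_diff_less_one[OF assms(2)] N_rep_diff_less_one[OF assms(1)]] by simp
next
  assume "N (x - y) < 1"
  then have "(x, y) \<in> residue_rel" using assms by (simp add: residue_rel_def int_ring_def)
  then show "rep x = rep y" using equiv_class_eq[OF equiv_residue_rel] by (simp add: rep_def)
qed

lemma N_le_one_of_reps: "s \<in> reps \<Longrightarrow> N s \<le> 1"
  using N_rep_le_one by (auto simp: reps_def int_ring_def)

lemma rep_in_reps: "N x \<le> 1 \<Longrightarrow> rep x \<in> reps"
  by (simp add: reps_def int_ring_def)

lemma rep_of_reps: "s \<in> reps \<Longrightarrow> rep s = s"
  using rep_eq_iff N_rep_le_one N_rep_diff_less_one by (fastforce simp: reps_def int_ring_def)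

lemma reps_eqI: "s \<in> reps \<Longrightarrow> t \<in> reps \<Longrightarrow> N (s - t) < 1 \<Longrightarrow> s = t"
  using rep_eq_iff[of s t] N_le_one_of_reps rep_of_reps by metis

lemma bij_betw_reps: "bij_betw (\<lambda>s. residue_rel `` {s}) reps (residue_field N)"
proof (rule bij_betw_imageI)
  show "inj_on (\<lambda>s. residue_rel `` {s}) reps"
  proof (rule inj_onI)
    fix s t assume st: "s \<in> reps" "t \<in> reps" "residue_rel `` {s} = residue_rel `` {t}"
    then have "rep s = rep t" by (simp add: rep_def)
    then show "s = t" using st rep_of_reps by simp
  qed
  have "residue_rel `` {rep x} = residue_rel `` {x}" if "N x \<le> 1" for x
    using equiv_class_eq[OF equiv_residue_rel residue_rel_rep[OF that]] by simp
  then show "(\<lambda>s. residue_rel `` {s}) ` reps = residue_field N"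
    by (auto simp: residue_field_eq quotient_def reps_def int_ring_def image_image)
qed

lemma finite_reps: "finite reps" and card_reps: "card reps = q"
proof -
  show "card reps = q" using bij_betw_same_card[OF bij_betw_reps] card_residue_field by simp
  then show "finite reps" using q_pos card_gt_0_iff by metis
qed

lemma q_ge_2: "2 \<le> q"
proof -
  have "rep 0 \<noteq> rep 1" using rep_eq_iff[of 0 1] by simp
  moreover have "{rep 0, rep 1} \<subseteq> reps" using rep_in_reps by simp
  ultimately show ?thesis using card_mono[OF finite_reps, of "{rep 0, rep 1}"] card_reps by simp
qed

text \<open>Translation by \<open>1\<close> permutes the residue classes; compare the sums over representatives.\<close>

lemma N_q_less_one: "N (of_nat q) < 1"
proof -
  define h where "h s = rep (s + 1)" for s
  have le: "N (s + 1) \<le> 1" if "s \<in> reps" for s using N_le_one_of_reps[OF that] by (simp add: N_add_le)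
  have "inj_on h reps"
  proof (rule inj_onI)
    fix s t assume st: "s \<in> reps" "t \<in> reps" "h s = h t"
    then have "N ((s + 1) - (t + 1)) < 1"
      using rep_eq_iff[OF le[OF st(1)] le[OF st(2)]] by (simp add: h_def)
    then show "s = t" using reps_eqI[OF st(1,2)] by simp
  qed
  moreover have "h ` reps \<subseteq> reps" using le rep_in_reps by (auto simp: h_def)
  ultimately have "bij_betw h reps reps"
    by (simp add: bij_betw_def endo_inj_surj[OF finite_reps])
  then have "(\<Sum>s\<in>reps. h s) = (\<Sum>s\<in>reps. s)" by (rule sum.reindex_bij_betw)
  then have "of_nat q = - (\<Sum>s\<in>reps. h s - (s + 1))"
    by (simp add: sum.distrib sum_subtractf card_reps)
  moreover have "N (\<Sum>s\<in>reps. h s - (s + 1)) < 1"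
    using N_rep_diff_less_one[OF le] by (intro N_sum_less) (simp_all add: h_def)
  ultimately show ?thesis by (simp only: N_minus)
qed

definition unit_reps :: "'a set" where "unit_reps = {s \<in> reps. N s = 1}"

lemma finite_unit_reps: "finite unit_reps"
  using finite_reps by (simp add: unit_reps_def)

lemma card_unit_reps: "card unit_reps = q - 1"
proof -
  have "reps = insert (rep 0) unit_reps"
  proof (intro set_eqI iffI)
    fix s assume s: "s \<in> reps"
    then have "N s \<le> 1" by (rule N_le_one_of_reps)
    then have "N s = 1 \<or> rep s = rep 0" using rep_eq_iff[of s 0] by auto
    then show "s \<in> insert (rep 0) unit_reps" using s rep_of_reps[OF s] by (auto simp: unit_reps_def)
  qed (use rep_in_reps in \<open>auto simp: unit_reps_def\<close>)
  moreover have "rep 0 \<notin> unit_reps" using N_rep_diff_less_one[of 0] by (simp add: unit_reps_def)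
  ultimately show ?thesis using card_reps finite_unit_reps by (metis card_insert_disjoint diff_Suc_1)
qed

lemma bij_betw_rep_mult:
  assumes x: "N x = 1" shows "bij_betw (\<lambda>s. rep (x * s)) unit_reps unit_reps"
proof -
  have N_xs: "N (x * s) = 1" if "s \<in> unit_reps" for s using that x by (simp add: unit_reps_def N_mult)
  have "rep (x * s) \<in> unit_reps" if s: "s \<in> unit_reps" for s
  proof -
    have "N (rep (x * s) - x * s) < N (x * s)" using N_rep_diff_less_one[of "x * s"] N_xs[OF s] by simp
    from N_add_eq_left[OF this] have "N (rep (x * s)) = 1" using N_xs[OF s] by simp
    then show ?thesis using rep_in_reps[of "x * s"] N_xs[OF s] by (simp add: unit_reps_def)
  qed
  moreover have "inj_on (\<lambda>s. rep (x * s)) unit_reps"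
  proof (rule inj_onI)
    fix s t assume st: "s \<in> unit_reps" "t \<in> unit_reps" "rep (x * s) = rep (x * t)"
    then have "N (x * (s - t)) < 1"
      using rep_eq_iff[of "x * s" "x * t"] N_xs by (simp add: right_diff_distrib)
    then have "N (s - t) < 1" using x by (simp add: N_mult)
    then show "s = t" using reps_eqI st by (simp add: unit_reps_def)
  qed
  ultimately show ?thesis
    by (simp add: bij_betw_def endo_inj_surj[OF finite_unit_reps] image_subset_iff)
qed

lemma N_power_q_diff_less_one:
  assumes "N x \<le> 1" shows "N (x ^ q - x) < 1"
proof (cases "N x < 1")
  case True
  have "N (x ^ q) \<le> N x" using power_decreasing[of 1 q "N x"] assms q_pos by (simp add: N_power)
  then show ?thesis using True by (intro N_diff_less) auto
next
  case False
  then have x: "N x = 1" using assms by simp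
  define P where "P = (\<Prod>s\<in>unit_reps. s)"
  have N_P: "N P = 1" by (simp add: P_def N_prod unit_reps_def)
  have "(\<Prod>s\<in>unit_reps. rep (x * s)) = P"
    unfolding P_def by (rule prod.reindex_bij_betw[OF bij_betw_rep_mult[OF x]])
  moreover have "(\<Prod>s\<in>unit_reps. x * s) = x ^ (q - 1) * P"
    by (simp add: P_def prod.distrib card_unit_reps)
  moreover have "N ((\<Prod>s\<in>unit_reps. rep (x * s)) - (\<Prod>s\<in>unit_reps. x * s)) < 1"
    using x N_rep_le_one N_rep_diff_less_one
    by (intro N_prod_diff_less_one[OF finite_unit_reps]) (simp_all add: unit_reps_def N_mult)
  ultimately have "N ((1 - x ^ (q - 1)) * P) < 1" by (simp add: left_diff_distrib)
  then have "N ((x ^ (q - 1) - 1) * x) < 1" using x N_P by (simp add: N_mult N_minus_commute)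
  then show ?thesis using power_minus_mult[OF q_pos, of x] by (simp add: left_diff_distrib)
qed

lemma teichmueller_unique:
  assumes "N s \<le> 1" "N t \<le> 1" "s ^ q = s" "t ^ q = t" "N (s - t) < 1"
  shows "s = t"
proof (rule ccontr)
  assume "s \<noteq> t"
  have "N (s - t) \<le> N (s - t) * max (N (of_nat q)) (N (s - t))"
    using N_power_diff_le_max[OF assms(1,2), of q] assms(3,4) by simp
  also have "\<dots> < N (s - t) * 1"
    using \<open>s \<noteq> t\<close> assms(5) N_q_less_one by (intro mult_strict_left_mono) auto
  finally show False by simp
qed

text \<open>Raising to the \<open>q\<close>-th power contracts by this factor, so that the powers \<open>x^(q^n)\<close> converge.\<close>

definition contraction :: "'a \<Rightarrow> real" where
  "contraction x = max (N (of_nat q)) (N (x ^ q - x))"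

lemma contraction_nonneg: "0 \<le> contraction x"
  by (simp add: contraction_def le_max_iff_disj)

lemma contraction_less_one: "N x \<le> 1 \<Longrightarrow> contraction x < 1"
  using N_q_less_one N_power_q_diff_less_one by (simp add: contraction_def)

lemma N_power_q_Suc_diff_le:
  assumes "N x \<le> 1"
  shows "N (x ^ (q ^ Suc n) - x ^ (q ^ n)) \<le> contraction x ^ Suc n"
proof (induction n)
  case 0
  then show ?case by (simp add: contraction_def)
next
  case (Suc n)
  define X where "X n = x ^ (q ^ n)" for n
  have X: "N (X n) \<le> 1" "X (Suc n) = X n ^ q" for n
    using assms by (simp_all add: X_def N_power_le_one mult.commute flip: power_mult)
  have IH: "N (X (Suc n) - X n) \<le> contraction x ^ Suc n" using Suc by (simp only: X_def)
  have "contraction x ^ Suc n \<le> contraction x ^ 1"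
    using contraction_nonneg contraction_less_one[OF assms] by (intro power_decreasing) simp_all
  then have "max (N (of_nat q)) (N (X (Suc n) - X n)) \<le> contraction x"
    using IH by (simp add: contraction_def)
  then have "N (X (Suc n) ^ q - X n ^ q) \<le> contraction x ^ Suc n * contraction x"
    using IH contraction_nonneg
    by (intro order_trans[OF N_power_diff_le_max[OF X(1) X(1)]] mult_mono) (simp_all add: le_max_iff_disj)
  then have "N (X (Suc (Suc n)) - X (Suc n)) \<le> contraction x ^ Suc (Suc n)"
    by (simp only: X(2) power_Suc2)
  then show ?case by (simp only: X_def)
qed

lemma N_power_q_diff_le:
  assumes "N x \<le> 1"
  shows "N (x ^ (q ^ (n + m)) - x ^ (q ^ n)) \<le> contraction x ^ Suc n"
proof (induction m)
  case 0
  then show ?case using contraction_nonneg by simp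
next
  case (Suc m)
  have "contraction x ^ Suc (n + m) \<le> contraction x ^ Suc n"
    using contraction_nonneg contraction_less_one[OF assms] by (intro power_decreasing) simp_all
  then have "N (x ^ (q ^ Suc (n + m)) - x ^ (q ^ (n + m))) \<le> contraction x ^ Suc n"
    by (rule order_trans[OF N_power_q_Suc_diff_le[OF assms]])
  from N_add_le[OF this Suc] show ?case by simp
qed

lemma power_q_limit:
  assumes "N x \<le> 1"
  obtains t where "(\<lambda>n. N (x ^ (q ^ n) - t)) \<longlonglongrightarrow> 0"
proof -
  have "(\<lambda>n. contraction x ^ Suc n) \<longlonglongrightarrow> 0"
    using contraction_nonneg contraction_less_one[OF assms]
    by (intro LIMSEQ_Suc LIMSEQ_realpow_zero) auto
  with N_power_q_diff_le[OF assms] have "N_Cauchy (\<lambda>n. x ^ (q ^ n))" by (rule N_CauchyI_vanishing)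
  then show thesis using complete that unfolding complete_on_iff by blast
qed

lemma teichmueller_exists:
  assumes x: "N x \<le> 1"
  shows "\<exists>t. N t \<le> 1 \<and> t ^ q = t \<and> N (x - t) < 1"
proof -
  define X where "X n = x ^ (q ^ n)" for n
  have X: "N (X n) \<le> 1" "X (Suc n) = X n ^ q" for n
    using x by (simp_all add: X_def N_power_le_one mult.commute flip: power_mult)
  obtain t where lim: "(\<lambda>n. N (X n - t)) \<longlonglongrightarrow> 0" using power_q_limit[OF x] unfolding X_def by blast
  obtain n where n: "N (X n - t) < 1"
    using order_tendstoD(2)[OF lim, of 1] by (auto simp: eventually_sequentially)
  have t: "N t \<le> 1" using N_diff_le[OF X(1)[of n] less_imp_le[OF n]] by simp
  have "N (t ^ q - t) \<le> max (N (X n - t)) (N (X (Suc n) - t))" for n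
  proof -
    have "N (X (Suc n) - t ^ q) \<le> N (X n - t)" unfolding X(2) by (rule N_power_diff_le[OF X(1) t])
    then have "N ((X (Suc n) - t) - (X (Suc n) - t ^ q)) \<le> max (N (X n - t)) (N (X (Suc n) - t))"
      by (intro N_diff_le[of "X (Suc n) - t" _ "X (Suc n) - t ^ q"]) (simp_all add: max.coboundedI1)
    then show ?thesis by simp
  qed
  then have "N (t ^ q - t) \<le> max 0 0"
    by (intro LIMSEQ_le_const[OF tendsto_max[OF lim LIMSEQ_Suc[OF lim]]]) blast
  then have "t ^ q = t" by simp
  moreover have "N (X n - x) < 1"
    using N_power_q_diff_le[OF x, of 0 n] contraction_less_one[OF x] by (simp add: X_def)
  with n have "N ((X n - t) - (X n - x)) < 1" by (rule N_diff_less)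
  ultimately show ?thesis using t by auto
qed

definition teich :: "'a set" where "teich = {t. t ^ q = t}"

lemma zero_in_teich: "0 \<in> teich"
  using q_pos by (simp add: teich_def power_0_left)

lemma N_teich_le_one: "t \<in> teich \<Longrightarrow> N t \<le> 1"
proof (rule ccontr)
  assume t: "t \<in> teich" and "\<not> N t \<le> 1"
  then have "N t ^ 1 < N t ^ q" using q_ge_2 by (intro power_strict_increasing) auto
  then show False using t N_power[of t q] by (simp add: teich_def)
qed

lemma N_teich_diff:
  assumes "s \<in> teich" "t \<in> teich" "s \<noteq> t" shows "N (s - t) = 1"
proof -
  have "\<not> N (s - t) < 1" using teichmueller_unique[of s t] assms N_teich_le_one
    by (auto simp: teich_def)
  then show ?thesis using N_diff_le[of s 1 t] assms N_teich_le_one by force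
qed

lemma ex_teich_near: "N x \<le> 1 \<Longrightarrow> \<exists>t\<in>teich. N (x - t) < 1"
  using teichmueller_exists[of x] by (auto simp: teich_def)

lemma bij_betw_rep_teich: "bij_betw rep teich reps"
proof (rule bij_betw_imageI)
  show "inj_on rep teich"
  proof (rule inj_onI)
    fix s t assume st: "s \<in> teich" "t \<in> teich" "rep s = rep t"
    then have "N (s - t) < 1" using rep_eq_iff[of s t] N_teich_le_one by simp
    then show "s = t" using N_teich_diff[OF st(1,2)] by fastforce
  qed
  have "\<exists>t\<in>teich. s = rep t" if s: "s \<in> reps" for s
  proof -
    obtain t where t: "t \<in> teich" "N (s - t) < 1" using ex_teich_near[OF N_le_one_of_reps[OF s]]
      by blast
    then have "rep s = rep t" using rep_eq_iff[of s t] N_le_one_of_reps[OF s] N_teich_le_one by simp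
    then show ?thesis using rep_of_reps[OF s] t(1) by auto
  qed
  then show "rep ` teich = reps" using rep_in_reps N_teich_le_one by auto
qed

lemma finite_teich: "finite teich" and card_teich: "card teich = q"
  using bij_betw_finite[OF bij_betw_rep_teich] finite_reps
    bij_betw_same_card[OF bij_betw_rep_teich] card_reps by auto

lemma teich_of_class_eq:
  assumes t: "t \<in> teich" shows "(THE s. s \<in> residue_rel `` {t} \<and> s ^ q = s) = t"
proof (rule the_equality)
  show "t \<in> residue_rel `` {t} \<and> t ^ q = t"
    using t N_teich_le_one[OF t] by (simp add: teich_def residue_rel_def int_ring_def)
  show "s = t" if "s \<in> residue_rel `` {t} \<and> s ^ q = s" for s
    using that N_teich_diff[OF t, of s] by (fastforce simp: residue_rel_def teich_def)
qed

lemma residue_field_eq_classes_of_teich: "residue_field N = (\<lambda>t. residue_rel `` {t}) ` teich"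
proof (intro set_eqI iffI)
  fix X assume "X \<in> residue_field N"
  then obtain x where x: "N x \<le> 1" "X = residue_rel `` {x}"
    by (auto simp: residue_field_eq quotient_def int_ring_def)
  obtain t where t: "t \<in> teich" "N (x - t) < 1" using ex_teich_near[OF x(1)] by blast
  then have "(x, t) \<in> residue_rel" using x N_teich_le_one by (simp add: residue_rel_def int_ring_def)
  then have "X = residue_rel `` {t}" using x(2) equiv_class_eq[OF equiv_residue_rel] by simp
  then show "X \<in> (\<lambda>t. residue_rel `` {t}) ` teich" using t(1) by blast
qed (use N_teich_le_one in \<open>auto simp: residue_field_eq quotient_def int_ring_def\<close>)

lemma teich_of_class_image: "(\<lambda>\<mu>. THE t. t \<in> \<mu> \<and> t ^ q = t) ` residue_field N = teich"
  unfolding residue_field_eq_classes_of_teich image_image using teich_of_class_eq by simp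

text \<open>The polynomial \<open>(y + 1)^q - y^q - 1\<close> is small at all Teichmueller representatives, since the
  \<open>q\<close>-th power map is the identity modulo the maximal ideal.\<close>

lemma N_binomial_q_less_one:
  assumes "0 < i" "i < q" shows "N (of_nat (q choose i)) < 1"
proof -
  define g :: "'a poly" where "g = (\<Sum>j\<in>{0<..<q}. monom (of_nat (q choose j)) j)"
  have coeff_g: "coeff g j = (if 0 < j \<and> j < q then of_nat (q choose j) else 0)" for j
    unfolding g_def by (simp add: coeff_sum)
  have "degree g \<le> q - 1" by (intro degree_le) (auto simp: coeff_g)
  then have deg: "degree g < card teich" using card_teich q_pos by linarith
  have N_poly: "N (poly g t) < 1" if t: "t \<in> teich" for t
  proof -
    have "{..q} = insert 0 (insert q {0<..<q})" using q_pos by auto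
    then have "(t + 1) ^ q = 1 + t ^ q + poly g t"
      unfolding g_def using q_pos by (simp add: binomial_ring poly_sum poly_monom)
    then have "poly g t = (t + 1) ^ q - (t + 1)" using t by (simp add: teich_def)
    then show ?thesis
      using N_power_q_diff_less_one[of "t + 1"] N_teich_le_one[OF t] by (simp add: N_add_le)
  qed
  define B where "B = Max ((\<lambda>t. N (poly g t)) ` teich)"
  have le: "N (poly g t) \<le> B" if "t \<in> teich" for t unfolding B_def using finite_teich that by simp
  have "gauss g \<le> B"
    using order_trans[OF N_nonneg le[OF zero_in_teich]]
    by (intro gauss_le_of_values[OF finite_teich N_teich_diff N_teich_le_one deg le])
  also have "B < 1"
    unfolding B_def using finite_teich zero_in_teich N_poly by (subst Max_less_iff) auto
  finally show ?thesis using N_coeff_le_gauss[of g i] assms by (simp add: coeff_g)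
qed

end

section \<open>The valuations on \<open>F\<close> and \<open>C\<close>\<close>

locale discretely_valued = nonarch N for N :: "'a::field \<Rightarrow> real" +
  fixes \<pi> :: 'a
  assumes uniformizer: "is_uniformizer N \<pi>" and unif_nonzero: "\<pi> \<noteq> 0"
begin

lemma N_less_one_iff: "N x < 1 \<longleftrightarrow> (\<exists>y. x = \<pi> * y \<and> N y \<le> 1)"
  using uniformizer unfolding is_uniformizer_def int_ring_def by (auto simp: set_eq_iff)

lemma N_unif_less_one: "N \<pi> < 1"
  using N_less_one_iff[of \<pi>] by (metis N_one mult_1_right order_refl)

lemma N_unif_pos: "0 < N \<pi>"
  using unif_nonzero by simp

lemma N_le_unif: "N x < 1 \<Longrightarrow> N x \<le> N \<pi>"
  unfolding N_less_one_iff using mult_left_le[of "N _" "N \<pi>"] by (auto simp: N_mult)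

lemma N_eq_unif_power:
  assumes "x \<noteq> 0" "N x \<le> 1" shows "\<exists>n. N x = N \<pi> ^ n"
proof -
  have "\<exists>m. N x = N \<pi> ^ m" if "x \<noteq> 0" "N x \<le> 1" "N \<pi> ^ n < N x" for n x
    using that
  proof (induction n arbitrary: x)
    case (Suc n)
    show ?case
    proof (cases "N x = 1")
      case True
      then show ?thesis by (intro exI[of _ 0]) simp
    next
      case False
      then obtain y where y: "x = \<pi> * y" "N y \<le> 1" using N_less_one_iff[of x] Suc.prems by auto
      have "y \<noteq> 0" using y Suc.prems by auto
      moreover have "N \<pi> ^ n < N y" using Suc.prems(3) N_unif_pos by (simp add: y(1) N_mult)
      ultimately obtain m where "N y = N \<pi> ^ m" using Suc.IH y(2) by blast
      then show ?thesis by (intro exI[of _ "Suc m"]) (simp add: y(1) N_mult)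
    qed
  qed simp
  moreover obtain n where "N \<pi> ^ n < N x"
    using real_arch_pow_inv[of "N x" "N \<pi>"] assms N_unif_less_one by auto
  ultimately show ?thesis using assms by blast
qed

lemma N_unif_powi_less_iff: "N \<pi> powi m < N \<pi> powi n \<longleftrightarrow> n < m"
  using power_int_strict_decreasing[OF _ N_unif_pos N_unif_less_one]
  by (metis less_asym less_irrefl linorder_less_linear)

lemma N_unif_powi_le_iff: "N \<pi> powi m \<le> N \<pi> powi n \<longleftrightarrow> n \<le> m"
  by (simp add: N_unif_powi_less_iff flip: not_less)

lemma N_unif_powi_eq_iff: "N \<pi> powi m = N \<pi> powi n \<longleftrightarrow> m = n"
  by (simp add: eq_iff N_unif_powi_le_iff conj_commute)

lemma N_unif_powi_add: "N \<pi> powi (m + n) = N \<pi> powi m * N \<pi> powi n"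
  using unif_nonzero by (intro power_int_add) simp

lemma N_eq_unif_powi:
  assumes "x \<noteq> 0" shows "\<exists>!n. N x = N \<pi> powi n"
proof -
  have "\<exists>n. N x = N \<pi> powi n"
  proof (cases "N x \<le> 1")
    case True
    then obtain n where "N x = N \<pi> ^ n" using N_eq_unif_power[OF assms] by blast
    then show ?thesis by (intro exI[of _ "int n"]) simp
  next
    case False
    then have "N (inverse x) \<le> 1" by (simp add: N_inverse inverse_le_1_iff)
    then obtain n where "inverse (N x) = N \<pi> ^ n"
      using N_eq_unif_power[of "inverse x"] assms by (auto simp: N_inverse)
    then have "N x = inverse (N \<pi> ^ n)" by (metis inverse_inverse_eq)
    then show ?thesis by (intro exI[of _ "- int n"]) (simp add: power_int_minus)
  qed
  then show ?thesis by (auto simp: N_unif_powi_eq_iff)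
qed

end

lemma le_of_power_le_mult_power:
  fixes x y K :: real
  assumes "0 \<le> x" "0 \<le> y" "\<And>n::nat. x ^ n \<le> K * y ^ n"
  shows "x \<le> y"
proof (rule ccontr)
  assume less: "\<not> x \<le> y"
  show False
  proof (cases "y = 0")
    case True
    then show ?thesis using assms(3)[of 1] less by simp
  next
    case False
    then have "1 < x / y" using assms(2) less by simp
    then obtain n where "K < (x / y) ^ n" using real_arch_pow by blast
    then show ?thesis using assms(3)[of n] False assms(2) by (simp add: power_divide field_simps)
  qed
qed

lemma padic_abs_rat_of_nat:
  assumes "0 < n"
  shows "padic_abs_rat p (of_nat n) = real p powi (- int (multiplicity (int p) (int n)))"
  using assms quotient_of_int[of "int n"] by (simp add: padic_abs_rat_def)

context padic_setting
begin

abbreviation "NQ \<equiv> absQ D"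
abbreviation "NF \<equiv> absF D"
abbreviation "NC \<equiv> absC D"
abbreviation "\<pi> \<equiv> unif D"
abbreviation "p \<equiv> res_char D"

sublocale Q: nonarch NQ
  using padic_field unfolding is_padic_field_def by unfold_locales auto
sublocale C: nonarch NC
  using ext_C unfolding finite_valued_ext_def by unfold_locales auto
sublocale F: nonarch NF
  using ext_F unfolding finite_valued_ext_def by unfold_locales auto

sublocale FQ: complete_base_ext NQ NF "mapF D"
proof
  show "is_ring_hom (mapF D)" "\<And>x. NF (mapF D x) = NQ x"
    using ext_F unfolding finite_valued_ext_def by auto
  show "Q.complete_on UNIV"
    using padic_field unfolding is_padic_field_def Q.complete_on_def by blast
qed

lemma N_of_nat: "0 < n \<Longrightarrow> NF (of_nat n) = real p powi (- int (multiplicity (int p) (int n)))"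
  using FQ.N_hom[of "of_nat n"] padic_field padic_abs_rat_of_nat[of n p] of_rat_of_nat_eq[of n]
  unfolding is_padic_field_def FQ.hom.of_nat by metis

lemma p_gt_one: "1 < p"
  using prime_res_char by (rule prime_gt_1_nat)

lemma N_p: "NF (of_nat p) = inverse (real p)"
proof -
  have "multiplicity (int p) (int p) = 1" using p_gt_one by (intro multiplicity_self) auto
  then show ?thesis using N_of_nat[of p] p_gt_one by (simp add: power_int_minus)
qed

lemma N_p_less_one: "NF (of_nat p) < 1"
  using p_gt_one by (simp add: N_p inverse_less_1_iff)

lemma p_nonzero: "of_nat p \<noteq> (0 :: 'f)"
proof
  assume "of_nat p = (0 :: 'f)"
  then have "NF (of_nat p) = 0" by simp
  then show False using p_gt_one unfolding N_p by simp
qed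

lemma p_dvd_of_N_less_one:
  assumes "NF (of_nat n) < 1" shows "p dvd n"
proof (cases "n = 0")
  case False
  then have "int p dvd int n"
    using assms N_of_nat[of n] not_dvd_imp_multiplicity_0[of "int p" "int n"] by fastforce
  then show ?thesis by simp
qed simp

sublocale F: discretely_valued NF \<pi>
proof
  show "is_uniformizer NF \<pi>" by (rule uniformizer)
  then have "of_nat p \<in> (\<lambda>y. \<pi> * y) ` int_ring NF"
    using N_p_less_one unfolding is_uniformizer_def by blast
  then show "\<pi> \<noteq> 0" using p_nonzero by auto
qed

lemma finite_spanning_set: obtains B where "finite B" "FQ.vs.span B = UNIV"
  using ext_F unfolding finite_valued_ext_def by blast

lemma complete_F: "F.complete_on UNIV"
  using FQ.complete_on_span finite_spanning_set by metis

lemma finite_embeddings: "finite (embeddings D)"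
proof (rule ccontr)
  assume "infinite (embeddings D)"
  then have dim: "FQ.vs.dim UNIV = 0" using card_embeddings by (simp add: ext_degree_def)
  obtain B0 where B0: "finite B0" "FQ.vs.span B0 = UNIV" by (rule finite_spanning_set)
  obtain B where B: "FQ.vs.independent B" "UNIV \<subseteq> FQ.vs.span B" "card B = FQ.vs.dim UNIV"
    by (rule FQ.vs.basis_exists[of UNIV])
  have "finite B" using FQ.vs.independent_span_bound[OF B0(1) B(1)] B0(2) by simp
  then have "B = {}" using B(3) dim by simp
  then have "(1 :: 'f) \<in> FQ.vs.span {}" using B(2) by blast
  then show False by simp
qed

text \<open>Two multiplicative norms that are comparable up to a constant coincide.\<close>

lemma N_embedding:
  assumes "\<sigma> \<in> embeddings D"
  shows "NC (\<sigma> x) = NF x"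
proof -
  interpret hom: field_hom \<sigma> using assms by unfold_locales (simp add: embeddings_def)
  have scale: "NC (\<sigma> (mapF D c * x)) = NQ c * NC (\<sigma> x)" for c x
    using assms ext_C by (simp add: embeddings_def finite_valued_ext_def hom.mult C.N_mult)
  obtain B where B: "finite B" "FQ.vs.span B = UNIV" by (rule finite_spanning_set)
  obtain K where K: "\<forall>x. NC (\<sigma> x) \<le> K * NF x"
    using FQ.seminorm_bounded_on_span[OF B(1), of "\<lambda>x. NC (\<sigma> x)"] scale C.N_add_le_max B(2)
    by (auto simp: hom.add)
  have le: "NC (\<sigma> x) \<le> NF x" for x
  proof (rule le_of_power_le_mult_power)
    show "NC (\<sigma> x) ^ n \<le> K * NF x ^ n" for n
      using K[rule_format, of "x ^ n"] by (simp only: hom.power C.N_power F.N_power)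
  qed simp_all
  show ?thesis
  proof (cases "x = 0")
    case False
    have "inverse (NC (\<sigma> x)) \<le> inverse (NF x)"
      using le[of "inverse x"] by (simp add: hom.inverse C.N_inverse F.N_inverse)
    then have "NF x \<le> NC (\<sigma> x)" using False hom.nonzero[OF False] by (simp add: inverse_le_iff_le)
    then show ?thesis using le[of x] by simp
  qed (simp add: hom.zero)
qed

lemma N_eq_powi_ordF: "x \<noteq> 0 \<Longrightarrow> NF x = NF \<pi> powi ordF D x"
  unfolding ordF_def by (rule theI'[OF F.N_eq_unif_powi])

lemma ordF_eqI: "NF x = NF \<pi> powi n \<Longrightarrow> ordF D x = n"
  using N_eq_powi_ordF[of x] F.N_unif_powi_eq_iff F.N_unif_pos by (cases "x = 0") auto

lemma ordF_mult: "x \<noteq> 0 \<Longrightarrow> y \<noteq> 0 \<Longrightarrow> ordF D (x * y) = ordF D x + ordF D y"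
  using N_eq_powi_ordF[of x] N_eq_powi_ordF[of y] F.N_unif_pos F.unif_nonzero
  by (intro ordF_eqI) (simp add: F.N_mult power_int_add)

lemma N_p_eq_unif_power: "NF (of_nat p) = NF \<pi> ^ ram_index D"
proof -
  obtain n where n: "NF (of_nat p) = NF \<pi> ^ n"
    using F.N_eq_unif_power[OF p_nonzero] N_p_less_one by auto
  then have "ordF D (of_nat p) = int n" by (intro ordF_eqI) simp
  then show ?thesis using n by (simp add: ram_index_def)
qed

lemma valF_eq_ereal_iff: "valF D a = ereal l \<longleftrightarrow> a \<noteq> 0 \<and> NC a = NF \<pi> powr l"
proof (cases "a = 0")
  case False
  then have "log (NF \<pi>) (NC a) = l \<longleftrightarrow> NC a = NF \<pi> powr l"
    using F.N_unif_pos F.N_unif_less_one by auto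
  then show ?thesis using False by (simp add: valF_def)
qed (simp add: valF_def)

lemma N_unif_powr_le_iff: "NF \<pi> powr x \<le> NF \<pi> powr y \<longleftrightarrow> y \<le> x"
  using powr_less_mono'[OF F.N_unif_pos F.N_unif_less_one] powr_mono'[of x y "NF \<pi>"]
    powr_mono'[of y x "NF \<pi>"] F.N_unif_pos F.N_unif_less_one by (smt (verit))

lemma valF_le_iff:
  "valF D a \<le> ereal x \<longleftrightarrow> a \<noteq> 0 \<and> NF \<pi> powr x \<le> NC a"
proof (cases "a = 0")
  case False
  then obtain l where l: "valF D a = ereal l" by (simp add: valF_def)
  then have "NC a = NF \<pi> powr l" by (simp only: valF_eq_ereal_iff)
  then show ?thesis using False by (simp add: l N_unif_powr_le_iff)
qed (simp add: valF_def)

lemma valF_pos_iff: "0 < valF D a \<longleftrightarrow> NC a < 1"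
proof -
  have "0 < valF D a \<longleftrightarrow> \<not> (a \<noteq> 0 \<and> NF \<pi> powr 0 \<le> NC a)"
    using valF_le_iff[of a 0] by (simp add: zero_ereal_def flip: not_le)
  then show ?thesis using F.N_unif_pos by auto
qed

lemma N_p_le_of_valF_le: "valF D a \<le> ereal (real (ram_index D)) \<Longrightarrow> NF (of_nat p) \<le> NC a"
  using F.N_unif_pos by (simp add: valF_le_iff N_p_eq_unif_power powr_realpow)

lemma N_unif_le_of_valF_le: "valF D a \<le> 1 \<Longrightarrow> NF \<pi> \<le> NC a"
  using valF_le_iff[of a 1] F.N_unif_pos by (simp add: one_ereal_def)

lemma N_unif_power_le_of_valF_le:
  assumes "a \<noteq> 0" "2 * valF D a - 1 \<le> ereal (real r)"
  shows "NF \<pi> ^ Suc r \<le> NC a * NC a"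
proof -
  obtain l where l: "valF D a = ereal l" using assms(1) by (simp add: valF_def)
  have "2 * valF D a - 1 = ereal (2 * l - 1)" by (simp add: l one_ereal_def numeral_eq_ereal)
  then have "l + l \<le> real (Suc r)" using assms(2) by simp
  then have "NF \<pi> powr real (Suc r) \<le> NF \<pi> powr (l + l)" by (simp only: N_unif_powr_le_iff)
  moreover have "NC a = NF \<pi> powr l" using l by (simp add: valF_eq_ereal_iff)
  ultimately show ?thesis using F.N_unif_pos by (simp only: powr_realpow powr_add)
qed

end

section \<open>Double cosets in \<open>GL\<^sub>2\<close>\<close>

text \<open>With both meanings of \<open>$\<close> in scope, the parse trees of matrix entries multiply exponentially.\<close>

no_notation fps_nth (infixl "$" 75)

lemma matrix_inv_right: "invertible A \<Longrightarrow> A ** matrix_inv A = (mat 1 :: 'a::semiring_1^'n^'n)"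
  and matrix_inv_left: "invertible A \<Longrightarrow> matrix_inv A ** A = (mat 1 :: 'a::semiring_1^'n^'n)"
  using someI_ex[of "\<lambda>B. A ** B = mat 1 \<and> B ** A = mat 1"]
  unfolding invertible_def matrix_inv_def by blast+

lemma invertible_matrix_inv: "invertible A \<Longrightarrow> invertible (matrix_inv A :: 'a::semiring_1^'n^'n)"
  using matrix_inv_right matrix_inv_left unfolding invertible_def by blast

lemma matrix_inv_cancel:
  fixes A :: "'a::semiring_1^'n^'n"
  assumes "invertible A"
  shows "A ** (matrix_inv A ** B) = B" "matrix_inv A ** (A ** B) = B"
  using assms by (simp_all add: matrix_mul_assoc matrix_inv_right matrix_inv_left)

lemma matrix_inv_eqI:
  fixes A :: "'a::field^'n^'n"
  assumes "A ** B = mat 1" shows "matrix_inv A = B"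
proof -
  have "invertible A" using assms matrix_left_right_inverse unfolding invertible_def by blast
  from matrix_inv_cancel(2)[OF this, of B] show ?thesis by (simp add: assms)
qed

lemma matrix_inv_mult:
  fixes A B :: "'a::field^'n^'n"
  assumes "invertible A" "invertible B"
  shows "matrix_inv (A ** B) = matrix_inv B ** matrix_inv A"
  by (intro matrix_inv_eqI) (simp add: assms matrix_inv_cancel matrix_inv_right flip: matrix_mul_assoc)

lemma matrix_inv_matrix_inv: "invertible A \<Longrightarrow> matrix_inv (matrix_inv A) = (A :: 'a::field^'n^'n)"
  by (intro matrix_inv_eqI matrix_inv_left)

lemma det_matrix_inv: "invertible A \<Longrightarrow> det (matrix_inv A) = inverse (det (A :: 'a::field^'n^'n))"
  by (metis det_I det_mul inverse_unique matrix_inv_right)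

lemma mat2_nth [simp]: "mat2 a b c d $ 1 $ 1 = a" "mat2 a b c d $ 1 $ 2 = b"
  "mat2 a b c d $ 2 $ 1 = c" "mat2 a b c d $ 2 $ 2 = d"
  by (simp_all add: mat2_def)

lemma mat2_eqI:
  fixes A :: "'a^2^2"
  assumes "A $ 1 $ 1 = B $ 1 $ 1" "A $ 1 $ 2 = B $ 1 $ 2" "A $ 2 $ 1 = B $ 2 $ 1" "A $ 2 $ 2 = B $ 2 $ 2"
  shows "A = B"
  using assms by (simp add: vec_eq_iff forall_2)

lemma matrix_mult_nth_2:
  "((A :: 'a::semiring_1^2^2) ** B) $ i $ j = A $ i $ 1 * B $ 1 $ j + A $ i $ 2 * B $ 2 $ j"
  by (simp add: matrix_matrix_mult_def sum_2)

lemma mat_1_eq_mat2: "mat 1 = (mat2 1 0 0 1 :: 'a::semiring_1^2^2)"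
  by (rule mat2_eqI) (simp_all add: mat_def)

lemma mat2_mult: "mat2 a b c d ** mat2 a' b' c' d'
    = mat2 (a * a' + b * c') (a * b' + b * d') (c * a' + d * c') (c * b' + d * (d' :: 'a::semiring_1))"
  by (intro mat2_eqI) (simp_all add: matrix_mult_nth_2)

lemma det_mat2 [simp]: "det (mat2 a b c d) = a * d - b * (c :: 'a::comm_ring_1)"
  by (simp add: det_2)

lemma matrix_inv_mat2:
  assumes "det g \<noteq> (0 :: 'a::field)"
  shows "matrix_inv g
    = mat2 (g $ 2 $ 2 / det g) (- (g $ 1 $ 2) / det g) (- (g $ 2 $ 1) / det g) (g $ 1 $ 1 / det g)"
    (is "_ = ?h")
proof (rule matrix_inv_eqI)
  have "g ** ?h = mat2 (det g / det g) 0 0 (det g / det g)"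
    by (intro mat2_eqI) (simp_all only: matrix_mult_nth_2 mat2_nth times_divide_eq_right
        add_divide_distrib[symmetric] det_2, simp_all add: mult.commute)
  then show "g ** ?h = mat 1" using assms by (simp add: mat_1_eq_mat2)
qed

lemma GL2_iff: "g \<in> GL2 \<longleftrightarrow> invertible g"
  by (simp add: GL2_def)

lemma center_iff: "z \<in> centerGL2 \<longleftrightarrow> (\<exists>c. c \<noteq> 0 \<and> z = mat2 c 0 0 (c :: 'a::field))"
proof
  assume z: "z \<in> centerGL2"
  have "mat2 1 1 0 1 \<in> (GL2 :: ('a^2^2) set)" "mat2 1 0 1 1 \<in> (GL2 :: ('a^2^2) set)"
    by (simp_all add: GL2_iff invertible_det_nz)
  then have comm: "z ** mat2 1 1 0 1 = mat2 1 1 0 1 ** z" "z ** mat2 1 0 1 1 = mat2 1 0 1 1 ** z"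
    using z unfolding centerGL2_def by blast+
  have "z $ 2 $ 1 = 0" using arg_cong[OF comm(1), of "\<lambda>A. A $ 1 $ 1"] by (simp add: matrix_mult_nth_2)
  moreover have "z $ 1 $ 2 = 0"
    using arg_cong[OF comm(2), of "\<lambda>A. A $ 1 $ 1"] by (simp add: matrix_mult_nth_2)
  moreover have "z $ 1 $ 1 = z $ 2 $ 2"
    using arg_cong[OF comm(1), of "\<lambda>A. A $ 1 $ 2"] by (simp add: matrix_mult_nth_2 add.commute)
  ultimately have z_eq: "z = mat2 (z $ 1 $ 1) 0 0 (z $ 1 $ 1)" by (intro mat2_eqI) simp_all
  moreover have "det z \<noteq> 0" using z unfolding centerGL2_def by (simp add: GL2_iff invertible_det_nz)
  ultimately have "z $ 1 $ 1 \<noteq> 0" by (metis det_mat2 diff_zero mult_zero_left)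
  then show "\<exists>c. c \<noteq> 0 \<and> z = mat2 c 0 0 c" using z_eq by blast
next
  assume "\<exists>c. c \<noteq> 0 \<and> z = mat2 c 0 0 c"
  then obtain c where c: "c \<noteq> 0" "z = mat2 c 0 0 c" by blast
  then have "z ** g = g ** z" for g
    by (intro mat2_eqI) (simp_all add: matrix_mult_nth_2 mult.commute)
  then show "z \<in> centerGL2" using c by (simp add: centerGL2_def GL2_iff invertible_det_nz)
qed

context nonarch
begin

definition entries_le :: "real \<Rightarrow> 'a^2^2 \<Rightarrow> bool" where
  "entries_le B g \<longleftrightarrow> (\<forall>i j. N (g $ i $ j) \<le> B)"

lemma entries_le_mat2 [simp]:
  "entries_le B (mat2 a b c d) \<longleftrightarrow> N a \<le> B \<and> N b \<le> B \<and> N c \<le> B \<and> N d \<le> B"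
  by (auto simp: entries_le_def forall_2)

lemma entries_le_nth: "entries_le B g \<Longrightarrow> N (g $ i $ j) \<le> B"
  by (simp add: entries_le_def)

lemma entries_le_mult: "entries_le A g \<Longrightarrow> entries_le B h \<Longrightarrow> entries_le (A * B) (g ** h)"
  unfolding entries_le_def matrix_mult_nth_2 by (intro allI N_add_le N_mult_le) simp_all

lemma N_det_le: "entries_le A g \<Longrightarrow> N (det g) \<le> A * A"
  unfolding entries_le_def det_2 by (intro N_diff_le N_mult_le) simp_all

end

context padic_setting
begin

definition scaled_integral :: "nat \<Rightarrow> 'f^2^2 \<Rightarrow> bool" where
  "scaled_integral i g \<longleftrightarrow>
    (\<exists>c. c \<noteq> 0 \<and> F.entries_le (NF c) g \<and> NF (det g) = NF c * NF c * NF \<pi> ^ i)"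

lemma scaled_integralI:
  "c \<noteq> 0 \<Longrightarrow> F.entries_le (NF c) g \<Longrightarrow> NF (det g) = NF c * NF c * NF \<pi> ^ i \<Longrightarrow> scaled_integral i g"
  unfolding scaled_integral_def by blast

lemma scaled_integralE:
  assumes "scaled_integral i g"
  obtains c where "c \<noteq> 0" "F.entries_le (NF c) g" "NF (det g) = NF c * NF c * NF \<pi> ^ i"
  using assms unfolding scaled_integral_def by blast

lemma scaled_integral_mult:
  assumes "scaled_integral i g" "scaled_integral j h"
  shows "scaled_integral (i + j) (g ** h)"
proof -
  obtain c where c: "c \<noteq> 0" "F.entries_le (NF c) g" "NF (det g) = NF c * NF c * NF \<pi> ^ i"
    using assms(1) by (rule scaled_integralE)
  obtain b where b: "b \<noteq> 0" "F.entries_le (NF b) h" "NF (det h) = NF b * NF b * NF \<pi> ^ j"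
    using assms(2) by (rule scaled_integralE)
  show ?thesis
  proof (rule scaled_integralI)
    show "c * b \<noteq> 0" using c(1) b(1) by simp
    show "F.entries_le (NF (c * b)) (g ** h)" unfolding F.N_mult by (intro F.entries_le_mult c b)
    show "NF (det (g ** h)) = NF (c * b) * NF (c * b) * NF \<pi> ^ (i + j)"
      by (simp add: det_mul F.N_mult c b power_add)
  qed
qed

lemma invertible_of_scaled_integral: "scaled_integral i g \<Longrightarrow> invertible g"
  using F.unif_nonzero by (elim scaled_integralE) (force simp: invertible_det_nz)

lemma scaled_integral_matrix_inv:
  assumes "scaled_integral 0 g" shows "scaled_integral 0 (matrix_inv g)"
proof -
  obtain c where c: "c \<noteq> 0" "F.entries_le (NF c) g" "NF (det g) = NF c * NF c * NF \<pi> ^ 0"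
    using assms by (rule scaled_integralE)
  have g: "invertible g" by (rule invertible_of_scaled_integral[OF assms])
  have "x / (NF c * NF c) \<le> NF (1 / c)" if "x \<le> NF c" for x
    using that c(1) by (simp add: F.N_divide field_simps)
  then have "F.entries_le (NF (1 / c)) (matrix_inv g)"
    using c(2) g by (simp add: matrix_inv_mat2 invertible_det_nz F.N_divide c(3) F.entries_le_nth)
  moreover have "NF (det (matrix_inv g)) = NF (1 / c) * NF (1 / c) * NF \<pi> ^ 0"
    using c(3) by (simp add: det_matrix_inv[OF g] F.N_inverse F.N_divide divide_inverse)
  ultimately show ?thesis using c(1) by (intro scaled_integralI[of "1 / c"]) simp_all
qed

lemma scaled_integral_upper:
  assumes "scaled_integral i (mat2 (\<pi> powi s) \<beta> 0 1)"
  obtains m where "s = m + m + int i" "m \<le> s" "m \<le> 0" "NF \<beta> \<le> NF \<pi> powi m"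
proof -
  obtain c where c: "c \<noteq> 0" "F.entries_le (NF c) (mat2 (\<pi> powi s) \<beta> 0 1)"
    "NF (det (mat2 (\<pi> powi s) \<beta> 0 1)) = NF c * NF c * NF \<pi> ^ i" using assms by (rule scaled_integralE)
  obtain m where m: "NF c = NF \<pi> powi m" using N_eq_powi_ordF[OF c(1)] by blast
  have "NF \<pi> powi s \<le> NF \<pi> powi m" "NF \<pi> powi 0 \<le> NF \<pi> powi m" and \<beta>: "NF \<beta> \<le> NF \<pi> powi m"
    using c(2) by (simp_all add: F.N_power_int m)
  then have "m \<le> s" "m \<le> 0" unfolding F.N_unif_powi_le_iff by auto
  moreover have "NF (det (mat2 (\<pi> powi s) \<beta> 0 1)) = NF \<pi> powi s" by (simp add: F.N_power_int)
  then have "NF \<pi> powi s = NF \<pi> powi (m + m + int i)"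
    using c(3) by (simp only: m F.N_unif_powi_add power_int_of_nat)
  then have "s = m + m + int i" unfolding F.N_unif_powi_eq_iff .
  ultimately show thesis using that \<beta> by blast
qed

lemma maxcompact_iff: "g \<in> maxcompact D \<longleftrightarrow> F.entries_le 1 g \<and> NF (det g) = 1"
proof
  assume "g \<in> maxcompact D"
  then obtain h where h: "F.entries_le 1 g" "F.entries_le 1 h" "g ** h = mat 1"
    unfolding maxcompact_def F.entries_le_def int_ring_def by blast
  have "NF (det g) * NF (det h) = 1" by (metis F.N_one F.N_mult det_I det_mul h(3))
  moreover have "NF (det g) \<le> 1" "NF (det h) \<le> 1" using F.N_det_le h(1,2) by force+
  ultimately have "NF (det g) = 1" by (metis F.N_nonneg antisym mult_left_le mult.commute)
  then show "F.entries_le 1 g \<and> NF (det g) = 1" using h(1) by simp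
next
  assume g: "F.entries_le 1 g \<and> NF (det g) = 1"
  then have nz: "det g \<noteq> 0" by auto
  then have inv: "g ** matrix_inv g = mat 1" "matrix_inv g ** g = mat 1"
    by (simp_all add: matrix_inv_right matrix_inv_left invertible_det_nz)
  have "F.entries_le 1 (matrix_inv g)"
    using g by (simp add: matrix_inv_mat2[OF nz] F.N_divide F.entries_le_nth)
  then show "g \<in> maxcompact D"
    using g inv unfolding maxcompact_def F.entries_le_def int_ring_def by blast
qed

lemma KZ_iff: "g \<in> KZ D \<longleftrightarrow> scaled_integral 0 g"
proof
  assume "g \<in> KZ D"
  then obtain h c where h: "F.entries_le 1 h" "NF (det h) = 1" "c \<noteq> 0" "g = h ** mat2 c 0 0 c"
    unfolding KZ_def center_iff maxcompact_iff by auto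
  have "scaled_integral 0 h" using h by (intro scaled_integralI[of 1]) simp_all
  moreover have "scaled_integral 0 (mat2 c 0 0 c)"
    using h(3) by (intro scaled_integralI[of c]) (simp_all add: F.N_mult)
  ultimately show "scaled_integral 0 g" using scaled_integral_mult[of 0 h 0] by (simp add: h(4))
next
  assume "scaled_integral 0 g"
  then obtain c where c: "c \<noteq> 0" "F.entries_le (NF c) g" "NF (det g) = NF c * NF c * NF \<pi> ^ 0"
    by (rule scaled_integralE)
  define h where "h = g ** mat2 (1 / c) 0 0 (1 / c)"
  have "F.entries_le (NF c * NF (1 / c)) h" unfolding h_def by (intro F.entries_le_mult c) simp
  then have "F.entries_le 1 h" using c(1) by (simp add: F.N_divide)
  moreover have "NF (det h) = 1" unfolding h_def det_mul using c by (simp add: F.N_mult F.N_divide)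
  moreover have "g = h ** mat2 c 0 0 c" unfolding h_def
    using c(1) by (intro mat2_eqI) (simp_all add: matrix_mult_nth_2)
  ultimately show "g \<in> KZ D" unfolding KZ_def center_iff maxcompact_iff using c(1) by blast
qed

lemma KZ_invertible: "g \<in> KZ D \<Longrightarrow> invertible g"
  unfolding KZ_iff by (rule invertible_of_scaled_integral)

lemma KZ_mult: "g \<in> KZ D \<Longrightarrow> h \<in> KZ D \<Longrightarrow> g ** h \<in> KZ D"
  unfolding KZ_iff using scaled_integral_mult[of 0 g 0 h] by simp

lemma KZ_matrix_inv: "g \<in> KZ D \<Longrightarrow> matrix_inv g \<in> KZ D"
  unfolding KZ_iff by (rule scaled_integral_matrix_inv)

lemma mat_1_in_KZ: "mat 1 \<in> KZ D"
  unfolding KZ_iff mat_1_eq_mat2 by (rule scaled_integralI[of 1]) simp_all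

lemma scalar_in_KZ: "c \<noteq> 0 \<Longrightarrow> mat2 c 0 0 c \<in> KZ D"
  unfolding KZ_iff by (rule scaled_integralI[of c]) (simp_all add: F.N_mult)

lemma swap_in_KZ: "mat2 0 1 1 0 \<in> KZ D"
  unfolding KZ_iff by (rule scaled_integralI[of 1]) simp_all

lemma unipotent_in_KZ: "NF x \<le> 1 \<Longrightarrow> mat2 1 x 0 1 \<in> KZ D"
  unfolding KZ_iff by (rule scaled_integralI[of 1]) simp_all

lemma KZ_cancel_left: "\<kappa> \<in> KZ D \<Longrightarrow> \<kappa> ** g \<in> KZ D \<longleftrightarrow> g \<in> KZ D"
  using KZ_mult[of "matrix_inv \<kappa>" "\<kappa> ** g"] KZ_mult[of \<kappa> g] KZ_matrix_inv[of \<kappa>]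
  by (auto simp: matrix_inv_cancel KZ_invertible)

lemma upper_in_KZ_D: "mat2 (\<pi> powi s) \<beta> 0 1 \<in> KZ D \<Longrightarrow> s = 0 \<and> NF \<beta> \<le> 1"
  unfolding KZ_iff by (erule scaled_integral_upper) auto

definition double_coset :: "('f^2^2) set" where
  "double_coset = {\<kappa>1 ** matrix_inv (alpha D) ** \<kappa>2 | \<kappa>1 \<kappa>2. \<kappa>1 \<in> KZ D \<and> \<kappa>2 \<in> KZ D}"

lemma double_cosetI:
  "\<kappa>1 \<in> KZ D \<Longrightarrow> \<kappa>2 \<in> KZ D \<Longrightarrow> x = \<kappa>1 ** matrix_inv (alpha D) ** \<kappa>2 \<Longrightarrow> x \<in> double_coset"
  unfolding double_coset_def by blast

lemma double_cosetE:
  assumes "x \<in> double_coset"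
  obtains \<kappa>1 \<kappa>2 where "\<kappa>1 \<in> KZ D" "\<kappa>2 \<in> KZ D" "x = \<kappa>1 ** matrix_inv (alpha D) ** \<kappa>2"
  using assms unfolding double_coset_def by blast

lemma invertible_alpha: "invertible (alpha D)"
  using F.unif_nonzero by (simp add: alpha_def invertible_det_nz)

lemma matrix_inv_alpha: "matrix_inv (alpha D) = mat2 1 0 0 (1 / \<pi>)"
  unfolding alpha_def using F.unif_nonzero by (subst matrix_inv_mat2) simp_all

lemma double_coset_mult_left: "\<kappa> \<in> KZ D \<Longrightarrow> x \<in> double_coset \<Longrightarrow> \<kappa> ** x \<in> double_coset"
  by (elim double_cosetE) (rule double_cosetI[OF KZ_mult], auto simp: matrix_mul_assoc)

lemma double_coset_mult_right: "\<kappa> \<in> KZ D \<Longrightarrow> x \<in> double_coset \<Longrightarrow> x ** \<kappa> \<in> double_coset"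
  by (elim double_cosetE) (rule double_cosetI[OF _ KZ_mult], auto simp: matrix_mul_assoc)

lemma double_coset_cancel_left: "\<kappa> \<in> KZ D \<Longrightarrow> \<kappa> ** x \<in> double_coset \<longleftrightarrow> x \<in> double_coset"
  using double_coset_mult_left[of "matrix_inv \<kappa>" "\<kappa> ** x"] double_coset_mult_left[of \<kappa> x]
  by (auto simp: matrix_inv_cancel KZ_invertible KZ_matrix_inv)

lemma double_coset_cancel_right: "\<kappa> \<in> KZ D \<Longrightarrow> x ** \<kappa> \<in> double_coset \<longleftrightarrow> x \<in> double_coset"
  using double_coset_mult_right[of "matrix_inv \<kappa>" "x ** \<kappa>"] double_coset_mult_right[of \<kappa> x]
  by (auto simp: matrix_inv_right KZ_invertible KZ_matrix_inv simp flip: matrix_mul_assoc)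

lemma scaled_integral_of_double_coset:
  assumes "x \<in> double_coset" shows "scaled_integral 1 x"
proof -
  obtain \<kappa>1 \<kappa>2 where \<kappa>: "\<kappa>1 \<in> KZ D" "\<kappa>2 \<in> KZ D" "x = \<kappa>1 ** matrix_inv (alpha D) ** \<kappa>2"
    using assms by (rule double_cosetE)
  have "scaled_integral 1 (matrix_inv (alpha D))"
    unfolding matrix_inv_alpha using F.N_unif_pos F.N_unif_less_one F.unif_nonzero
    by (intro scaled_integralI[of "1 / \<pi>"]) (simp_all add: F.N_divide)
  then have "scaled_integral (0 + 1 + 0) x"
    unfolding \<kappa>(3) using \<kappa>(1,2) by (intro scaled_integral_mult) (simp_all add: KZ_iff)
  then show ?thesis by simp
qed

lemma upper_in_double_coset_D:
  assumes "mat2 (\<pi> powi s) \<beta> 0 1 \<in> double_coset"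
  shows "s = 1 \<and> NF \<beta> \<le> 1 \<or> s = -1 \<and> NF \<beta> \<le> inverse (NF \<pi>)"
proof -
  obtain m where m: "s = m + m + int 1" "m \<le> s" "m \<le> 0" "NF \<beta> \<le> NF \<pi> powi m"
    using scaled_integral_upper[OF scaled_integral_of_double_coset[OF assms]] .
  then have "m = 0 \<or> m = -1" by linarith
  then show ?thesis using m(1,4) by (auto simp: power_int_minus)
qed

lemma child_in_double_coset:
  assumes "NF s \<le> 1" shows "mat2 \<pi> s 0 1 \<in> double_coset"
proof (rule double_cosetI)
  show "mat2 1 s 0 1 ** mat2 \<pi> 0 0 \<pi> \<in> KZ D"
    using assms F.unif_nonzero by (intro KZ_mult unipotent_in_KZ scalar_in_KZ)
  show "mat2 \<pi> s 0 1 = (mat2 1 s 0 1 ** mat2 \<pi> 0 0 \<pi>) ** matrix_inv (alpha D) ** mat 1"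
    unfolding matrix_inv_alpha using F.unif_nonzero by (simp add: mat2_mult)
qed (rule mat_1_in_KZ)

lemma parent_in_double_coset:
  assumes "NF t \<le> 1" shows "mat2 (1 / \<pi>) (- t / \<pi>) 0 1 \<in> double_coset"
proof (rule double_cosetI)
  show "mat2 0 1 1 0 \<in> KZ D" by (rule swap_in_KZ)
  show "mat2 0 1 1 0 ** mat2 1 (- t) 0 1 \<in> KZ D"
    using assms by (intro KZ_mult unipotent_in_KZ swap_in_KZ) simp
  show "mat2 (1 / \<pi>) (- t / \<pi>) 0 1
      = mat2 0 1 1 0 ** matrix_inv (alpha D) ** (mat2 0 1 1 0 ** mat2 1 (- t) 0 1)"
    unfolding matrix_inv_alpha using F.unif_nonzero by (simp add: mat2_mult)
qed

lemma invertible_g0: "invertible (g0 D n \<mu>)"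
  using F.unif_nonzero by (simp add: g0_def invertible_det_nz)

lemma matrix_inv_g0: "matrix_inv (g0 D n \<mu>) = mat2 (1 / \<pi> ^ n) (- \<mu> / \<pi> ^ n) 0 1"
  unfolding g0_def using F.unif_nonzero by (subst matrix_inv_mat2) simp_all

lemma matrix_inv_g0_mult_g0:
  "matrix_inv (g0 D n \<mu>) ** g0 D m \<nu> = mat2 (\<pi> powi (int m - int n)) ((\<nu> - \<mu>) / \<pi> ^ n) 0 1"
  unfolding matrix_inv_g0 unfolding g0_def
  by (simp add: mat2_mult power_int_diff F.unif_nonzero diff_divide_distrib)

text \<open>The top left entry has the unit numerator \<open>1 - \<pi>\<mu>\<nu>\<close>, so that scaling into the integral
  matrices costs \<open>\<pi>^n\<close> and leaves a determinant of valuation at least \<open>m + 1 + n\<close>.\<close>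

lemma matrix_inv_g0_mult_g1_notin_KZ:
  assumes "NF \<mu> \<le> 1" "NF \<nu> \<le> 1"
  shows "matrix_inv (g0 D n \<mu>) ** g1 D m \<nu> \<notin> KZ D" (is "?g \<notin> _")
proof
  assume "?g \<in> KZ D"
  then obtain c where c: "c \<noteq> 0" "F.entries_le (NF c) ?g" "NF (det ?g) = NF c * NF c * NF \<pi> ^ 0"
    unfolding KZ_iff by (rule scaled_integralE)
  obtain l where l: "NF c = NF \<pi> powi l" using N_eq_powi_ordF[OF c(1)] by blast
  have "NF (\<pi> * (\<mu> * \<nu>)) \<le> NF \<pi> * (1 * 1)" by (intro F.N_mult_le assms order_refl)
  then have "NF (- (\<mu> * (\<pi> * \<nu>))) < NF 1" using F.N_unif_less_one by (simp add: mult_ac)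
  from F.N_add_eq_left[OF this] have unit: "NF (1 - \<mu> * (\<pi> * \<nu>)) = 1" by simp
  have "?g $ 1 $ 1 = (1 - \<mu> * (\<pi> * \<nu>)) / \<pi> ^ n"
    unfolding matrix_inv_g0 g1_def by (simp add: mat2_mult diff_divide_distrib)
  then have "NF ((1 - \<mu> * (\<pi> * \<nu>)) / \<pi> ^ n) \<le> NF c" using F.entries_le_nth[OF c(2), of 1 1] by simp
  then have "NF \<pi> powi (- int n) \<le> NF \<pi> powi l"
    unfolding F.N_divide unit l by (simp add: F.N_power power_int_minus divide_inverse)
  then have l_le: "l \<le> - int n" unfolding F.N_unif_powi_le_iff .
  have "det ?g = \<pi> ^ (m + 1) * inverse (\<pi> ^ n)"
    unfolding det_mul det_matrix_inv[OF invertible_g0] by (simp add: g0_def g1_def)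
  then have "NF (det ?g) = NF \<pi> powi (int (m + 1) + - int n)"
    by (simp only: F.N_mult F.N_inverse F.N_power F.N_unif_powi_add power_int_minus power_int_of_nat)
  then have "NF \<pi> powi (int (m + 1) + - int n) = NF \<pi> powi (l + l)"
    using c(3) by (simp only: l F.N_unif_powi_add power_0 mult_1_right)
  then have "int (m + 1) + - int n = l + l" unfolding F.N_unif_powi_eq_iff .
  then show False using l_le by simp
qed

end

section \<open>The weight representation\<close>

definition binary_form :: "nat \<Rightarrow> 'a::comm_ring_1 poly \<Rightarrow> 'a poly \<Rightarrow> 'a poly \<Rightarrow> 'a poly" where
  "binary_form n P X Y = (\<Sum>j\<le>n. smult (coeff P j) (X ^ (n - j) * Y ^ j))"

lemma smult_sum_right: "smult c (\<Sum>i\<in>S. P i) = (\<Sum>i\<in>S. smult c (P i))"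
  by (induction S rule: infinite_finite_induct) (simp_all add: smult_add_right)

lemma binary_form_sum:
  "binary_form n (\<Sum>i\<in>S. smult (c i) (P i)) X Y = (\<Sum>i\<in>S. smult (c i) (binary_form n (P i) X Y))"
proof -
  have "binary_form n (\<Sum>i\<in>S. smult (c i) (P i)) X Y
      = (\<Sum>j\<le>n. \<Sum>i\<in>S. smult (c i) (smult (coeff (P i) j) (X ^ (n - j) * Y ^ j)))"
    unfolding binary_form_def by (intro sum.cong refl) (simp add: coeff_sum smult_sum)
  also have "\<dots> = (\<Sum>i\<in>S. \<Sum>j\<le>n. smult (c i) (smult (coeff (P i) j) (X ^ (n - j) * Y ^ j)))"
    by (rule sum.swap)
  finally show ?thesis by (simp add: binary_form_def smult_sum_right)
qed

lemma binary_form_linear_mult: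
  assumes "degree P \<le> n"
  shows "binary_form (Suc n) ([:x, y:] * P) X Y = (smult x X + smult y Y) * binary_form n P X Y"
proof -
  let ?shift = "\<lambda>j. case j of 0 \<Rightarrow> 0 | Suc i \<Rightarrow> y * coeff P i"
  have "coeff ([:x, y:] * P) j = x * coeff P j + ?shift j" for j by (cases j) simp_all
  then have "binary_form (Suc n) ([:x, y:] * P) X Y
      = (\<Sum>j\<le>Suc n. smult (x * coeff P j) (X ^ (Suc n - j) * Y ^ j))
        + (\<Sum>j\<le>Suc n. smult (?shift j) (X ^ (Suc n - j) * Y ^ j))"
    unfolding binary_form_def by (simp only: smult_add_left sum.distrib)
  also have "(\<Sum>j\<le>Suc n. smult (x * coeff P j) (X ^ (Suc n - j) * Y ^ j))
      = (\<Sum>j\<le>n. smult (x * coeff P j) (X ^ (Suc n - j) * Y ^ j))"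
    using assms by (simp add: coeff_eq_0)
  also have "\<dots> = smult x X * binary_form n P X Y"
    unfolding binary_form_def sum_distrib_left
    by (intro sum.cong refl) (simp add: Suc_diff_le mult.assoc mult.commute[of x])
  also have "(\<Sum>j\<le>Suc n. smult (?shift j) (X ^ (Suc n - j) * Y ^ j)) = smult y Y * binary_form n P X Y"
    unfolding binary_form_def sum_distrib_left
    by (subst sum.atMost_Suc_shift) (simp add: mult_ac)
  finally show ?thesis by (simp add: distrib_right)
qed

lemma binary_form_linear_powers:
  "binary_form (m + n) ([:x, y:] ^ m * [:u, v:] ^ n) X Y
    = (smult x X + smult y Y) ^ m * (smult u X + smult v (Y :: 'a::comm_ring_1 poly)) ^ n"
proof (induction m)
  case 0
  show ?case
  proof (induction n)
    case 0
    show ?case by (simp add: binary_form_def)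
  next
    case (Suc n)
    then show ?case using binary_form_linear_mult[OF degree_linear_power_le, of n u v u v] by simp
  qed
next
  case (Suc m)
  have "degree ([:x, y:] ^ m * [:u, v:] ^ n) \<le> m + n"
    using degree_mult_le[of "[:x, y:] ^ m" "[:u, v:] ^ n"]
      degree_linear_power_le[of x y m] degree_linear_power_le[of u v n] by linarith
  from binary_form_linear_mult[OF this, of x y X Y] Suc show ?case
    by (simp only: power_Suc mult.assoc add_Suc)
qed

lemma degree_binary_form_le:
  assumes "degree X \<le> 1" "degree Y \<le> 1" shows "degree (binary_form n P X Y) \<le> n"
  unfolding binary_form_def
proof (rule degree_sum_le)
  fix j assume j: "j \<in> {..n}"
  have "degree (X ^ (n - j) * Y ^ j) \<le> degree X * (n - j) + degree Y * j"
    using degree_mult_le[of "X ^ (n - j)" "Y ^ j"] degree_power_le[of X "n - j"] degree_power_le[of Y j]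
    by linarith
  also have "\<dots> \<le> 1 * (n - j) + 1 * j" by (intro add_mono mult_right_mono assms) auto
  finally show "degree (smult (coeff P j) (X ^ (n - j) * Y ^ j)) \<le> n"
    using j degree_smult_le[of "coeff P j" "X ^ (n - j) * Y ^ j"] by simp
qed simp

lemma (in nonarch) gauss_binary_form_le:
  assumes "gauss X \<le> B" "gauss Y \<le> B"
  shows "gauss (binary_form n P X Y) \<le> gauss P * B ^ n"
proof -
  have "0 \<le> B" using order_trans[OF gauss_nonneg assms(1)] .
  have gauss_term: "gauss (smult (coeff P j) (X ^ (n - j) * Y ^ j)) \<le> gauss P * B ^ n" if "j \<le> n" for j
  proof -
    have "gauss (X ^ (n - j) * Y ^ j) \<le> B ^ (n - j) * B ^ j"
      unfolding gauss_mult gauss_power using assms \<open>0 \<le> B\<close> by (intro mult_mono power_mono) simp_all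
    also have "\<dots> = B ^ n" using that by (simp flip: power_add)
    finally show ?thesis
      unfolding gauss_smult by (intro mult_mono N_coeff_le_gauss) simp_all
  qed
  show ?thesis
    unfolding gauss_le_iff binary_form_def coeff_sum
    using gauss_term \<open>0 \<le> B\<close> by (intro allI N_sum_le) (simp_all only: gauss_le_iff atMost_iff, simp)
qed

locale weight_setting = padic_setting D
  for D :: "('k::field_char_0, 'f::field, 'c::field) padic_data" +
  fixes k :: "('f \<Rightarrow> 'c) \<Rightarrow> nat" and \<sigma> :: "'f \<Rightarrow> 'c"
  assumes embedding: "\<sigma> \<in> embeddings D"
    and k_other: "\<And>\<tau>. \<tau> \<in> embeddings D \<Longrightarrow> \<tau> \<noteq> \<sigma> \<Longrightarrow> k \<tau> = 0"
    and res_card_pos: "0 < res_card D"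
begin

sublocale R: finite_residue_field NF "res_card D"
  using res_card_pos complete_F by unfold_locales (simp_all add: res_card_def)

sublocale \<sigma>: field_hom \<sigma>
  using embedding by unfold_locales (simp add: embeddings_def)

abbreviation "q \<equiv> res_card D"
abbreviation "sqrt_unif \<equiv> root_unif D \<sigma>"

lemma N_\<sigma>: "NC (\<sigma> x) = NF x"
  by (rule N_embedding[OF embedding])

lemma sqrt_unif_square: "sqrt_unif * sqrt_unif = \<sigma> \<pi>"
  using root_unif[OF embedding] by (simp add: power2_eq_square)

lemma sqrt_unif_nonzero: "sqrt_unif \<noteq> 0"
  using sqrt_unif_square \<sigma>.nonzero[OF F.unif_nonzero] by auto

definition exponent :: "nat \<Rightarrow> ('f \<Rightarrow> 'c) \<Rightarrow> nat" where
  "exponent m = (\<lambda>\<tau>. if \<tau> = \<sigma> then m else 0)"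

lemma inj_exponent: "inj exponent"
  by (rule injI) (auto simp: exponent_def fun_eq_iff split: if_splits)

lemma monomials_eq: "monomials D k = exponent ` {..k \<sigma>}"
proof (intro set_eqI iffI)
  fix i assume i: "i \<in> monomials D k"
  have "i = exponent (i \<sigma>)"
  proof
    fix \<tau> show "i \<tau> = exponent (i \<sigma>) \<tau>"
      using i k_other[of \<tau>] by (cases "\<tau> \<in> embeddings D") (auto simp: monomials_def exponent_def)
  qed
  moreover have "i \<sigma> \<le> k \<sigma>" using i embedding by (auto simp: monomials_def)
  ultimately show "i \<in> exponent ` {..k \<sigma>}" by blast
next
  fix i assume "i \<in> exponent ` {..k \<sigma>}"
  then show "i \<in> monomials D k" using embedding by (auto simp: monomials_def exponent_def)
qed

lemma prod_embeddings: "(\<And>\<tau>. \<tau> \<in> embeddings D \<Longrightarrow> \<tau> \<noteq> \<sigma> \<Longrightarrow> g \<tau> = 1) \<Longrightarrow> prod g (embeddings D) = g \<sigma>"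
  by (subst prod.remove[OF finite_embeddings embedding], subst prod.neutral) simp_all

definition to_poly :: "('f, 'c) weight_vec \<Rightarrow> 'c poly" where
  "to_poly v = (\<Sum>m\<le>k \<sigma>. monom (v (exponent m)) m)"

lemma coeff_to_poly: "coeff (to_poly v) m = (if m \<le> k \<sigma> then v (exponent m) else 0)"
  by (simp add: to_poly_def coeff_sum)

lemma degree_to_poly_le: "degree (to_poly v) \<le> k \<sigma>"
  by (intro degree_le) (simp add: coeff_to_poly)

lemma to_poly_zero [simp]: "to_poly 0 = 0"
  and to_poly_add: "to_poly (u + v) = to_poly u + to_poly v"
  and to_poly_scale: "to_poly (\<lambda>i. c * v i) = smult c (to_poly v)"
  by (rule poly_eqI; simp add: coeff_to_poly)+

lemma to_poly_sum: "to_poly (\<Sum>i\<in>I. v i) = (\<Sum>i\<in>I. to_poly (v i))"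
  by (induction I rule: infinite_finite_induct)
    (simp_all only: sum.infinite sum.empty sum.insert to_poly_zero to_poly_add simp_thms not_False_eq_True)

lemma weight_eqI:
  assumes "v \<in> weight D k" "v' \<in> weight D k" "to_poly v = to_poly v'" shows "v = v'"
proof
  fix i show "v i = v' i"
  proof (cases "i \<in> monomials D k")
    case True
    then obtain m where "m \<le> k \<sigma>" "i = exponent m" unfolding monomials_eq by auto
    then show ?thesis using arg_cong[OF assms(3), of "\<lambda>P. coeff P m"] by (simp add: coeff_to_poly)
  qed (use assms in \<open>simp add: weight_def\<close>)
qed

lemma gauss_to_poly_le_iff:
  assumes "v \<in> weight D k" "0 \<le> B"
  shows "C.gauss (to_poly v) \<le> B \<longleftrightarrow> (\<forall>i. NC (v i) \<le> B)"
proof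
  show "\<forall>i. NC (v i) \<le> B" if le: "C.gauss (to_poly v) \<le> B"
  proof
    fix i show "NC (v i) \<le> B"
    proof (cases "i \<in> monomials D k")
      case True
      then obtain m where "m \<le> k \<sigma>" "i = exponent m" unfolding monomials_eq by auto
      then show ?thesis using le[unfolded C.gauss_le_iff, rule_format, of m]
        by (simp add: coeff_to_poly)
    qed (use assms in \<open>simp add: weight_def\<close>)
  qed
qed (simp add: C.gauss_le_iff coeff_to_poly assms(2))

lemma weight_lattice_iff: "v \<in> weight_lattice D k \<longleftrightarrow> v \<in> weight D k \<and> C.gauss (to_poly v) \<le> 1"
  by (auto simp: weight_lattice_def int_ring_def gauss_to_poly_le_iff)

definition act :: "'f^2^2 \<Rightarrow> 'c poly \<Rightarrow> 'c poly" where
  "act g P = binary_form (k \<sigma>) P [:\<sigma> (g $ 1 $ 1), \<sigma> (g $ 2 $ 1):] [:\<sigma> (g $ 1 $ 2), \<sigma> (g $ 2 $ 2):]"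

lemma degree_act_le: "degree (act g P) \<le> k \<sigma>"
  unfolding act_def by (rule degree_binary_form_le) simp_all

lemma act_smult: "act g (smult c P) = smult c (act g P)"
  unfolding act_def binary_form_def by (simp add: smult_sum_right)

lemma act_upper:
  "act (mat2 x y 0 z) P = (\<Sum>i\<le>k \<sigma>. smult (coeff P i * \<sigma> x ^ (k \<sigma> - i)) ([:\<sigma> y, \<sigma> z:] ^ i))"
  unfolding act_def binary_form_def by (simp add: \<sigma>.zero poly_const_pow)

lemma act_mult:
  assumes "degree P \<le> k \<sigma>" shows "act (g ** h) P = act g (act h P)"
proof -
  let ?X = "[:\<sigma> (g $ 1 $ 1), \<sigma> (g $ 2 $ 1):]" and ?Y = "[:\<sigma> (g $ 1 $ 2), \<sigma> (g $ 2 $ 2):]"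
  let ?A = "[:\<sigma> (h $ 1 $ 1), \<sigma> (h $ 2 $ 1):]" and ?B = "[:\<sigma> (h $ 1 $ 2), \<sigma> (h $ 2 $ 2):]"
  let ?AXY = "smult (\<sigma> (h $ 1 $ 1)) ?X + smult (\<sigma> (h $ 2 $ 1)) ?Y"
  let ?BXY = "smult (\<sigma> (h $ 1 $ 2)) ?X + smult (\<sigma> (h $ 2 $ 2)) ?Y"
  have form: "binary_form (k \<sigma>) (?A ^ (k \<sigma> - m) * ?B ^ m) ?X ?Y = ?AXY ^ (k \<sigma> - m) * ?BXY ^ m"
    if "m \<le> k \<sigma>" for m
    using binary_form_linear_powers[of "k \<sigma> - m" m _ _ _ _ ?X ?Y] that
    by (simp only: le_add_diff_inverse2)
  have "act g (act h P) = (\<Sum>m\<le>k \<sigma>. smult (coeff P m) (binary_form (k \<sigma>) (?A ^ (k \<sigma> - m) * ?B ^ m) ?X ?Y))"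
    unfolding act_def binary_form_def[of "k \<sigma>" P] by (rule binary_form_sum)
  also have "\<dots> = (\<Sum>m\<le>k \<sigma>. smult (coeff P m) (?AXY ^ (k \<sigma> - m) * ?BXY ^ m))"
    using form by (intro sum.cong) simp_all
  also have "\<dots> = act (g ** h) P"
    unfolding act_def binary_form_def by (simp add: matrix_mult_nth_2 \<sigma>.add \<sigma>.mult mult.commute)
  finally show ?thesis by simp
qed

abbreviation twist :: "'f^2^2 \<Rightarrow> 'c" where
  "twist g \<equiv> sqrt_unif powi (- ordF D (det g) * int (k \<sigma>))"

lemma to_poly_rho: "to_poly (rho D k g v) = smult (twist g) (act g (to_poly v))"
proof (rule poly_eqI)
  fix j
  let ?X = "[:\<sigma> (g $ 1 $ 1), \<sigma> (g $ 2 $ 1):]" and ?Y = "[:\<sigma> (g $ 1 $ 2), \<sigma> (g $ 2 $ 2):]"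
  show "coeff (to_poly (rho D k g v)) j = coeff (smult (twist g) (act g (to_poly v))) j"
  proof (cases "j \<le> k \<sigma>")
    case True
    have factor: "(\<Prod>\<tau>\<in>embeddings D. root_unif D \<tau> powi (- ordF D (det g) * int (k \<tau>)) *
            coeff ([:\<tau> (g $ 1 $ 1), \<tau> (g $ 2 $ 1):] ^ (k \<tau> - exponent m \<tau>) *
                   [:\<tau> (g $ 1 $ 2), \<tau> (g $ 2 $ 2):] ^ exponent m \<tau>) (exponent j \<tau>))
        = twist g * coeff (?X ^ (k \<sigma> - m) * ?Y ^ m) j" for m
      by (subst prod_embeddings) (simp_all add: exponent_def k_other)
    have "exponent j \<in> exponent ` {..k \<sigma>}" "inj_on exponent {..k \<sigma>}"
      using True inj_on_subset[OF inj_exponent subset_UNIV] by simp_all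
    then have "rho D k g v (exponent j)
        = (\<Sum>m\<le>k \<sigma>. v (exponent m) * (twist g * coeff (?X ^ (k \<sigma> - m) * ?Y ^ m) j))"
      unfolding rho_def monomials_eq by (simp only: if_P sum.reindex o_def factor)
    also have "\<dots> = twist g * (\<Sum>m\<le>k \<sigma>. coeff (to_poly v) m * coeff (?X ^ (k \<sigma> - m) * ?Y ^ m) j)"
      unfolding sum_distrib_left by (intro sum.cong refl) (simp add: coeff_to_poly mult_ac)
    also have "\<dots> = coeff (smult (twist g) (act g (to_poly v))) j"
      by (simp add: act_def binary_form_def coeff_sum)
    finally show ?thesis using True by (simp add: coeff_to_poly)
  next
    case False
    then show ?thesis using degree_act_le[of g "to_poly v"] by (simp add: coeff_to_poly coeff_eq_0)
  qed
qed

lemma rho_in_weight: "rho D k g v \<in> weight D k"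
  by (simp add: weight_def rho_def)

lemma twist_mult:
  assumes "invertible g" "invertible h" shows "twist (g ** h) = twist g * twist h"
proof -
  have "- ordF D (det (g ** h)) * int (k \<sigma>) = - ordF D (det g) * int (k \<sigma>) + - ordF D (det h) * int (k \<sigma>)"
    using assms by (simp add: det_mul ordF_mult invertible_det_nz algebra_simps)
  then show ?thesis by (simp only:) (rule power_int_add, simp add: sqrt_unif_nonzero)
qed

lemma rho_mult:
  assumes "invertible g" "invertible h" shows "rho D k (g ** h) v = rho D k g (rho D k h v)"
proof (rule weight_eqI[OF rho_in_weight rho_in_weight])
  show "to_poly (rho D k (g ** h) v) = to_poly (rho D k g (rho D k h v))"
    unfolding to_poly_rho twist_mult[OF assms] act_mult[OF degree_to_poly_le] act_smult by simp
qed

lemma rho_scale: "rho D k g (\<lambda>i. c * v i) = (\<lambda>i. c * rho D k g v i)"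
  by (rule weight_eqI[OF rho_in_weight])
    (simp_all add: to_poly_rho to_poly_scale act_smult mult.commute,
      use rho_in_weight in \<open>simp add: weight_def\<close>)

lemma rho_zero [simp]: "rho D k g 0 = 0"
  by (rule ext) (simp add: rho_def)

lemma rho_sum: "rho D k g (\<Sum>i\<in>I. v i) = (\<Sum>i\<in>I. rho D k g (v i))"
proof -
  have "rho D k g (u + v) = rho D k g u + rho D k g v" for u v
    by (rule ext) (simp add: rho_def distrib_right sum.distrib)
  then show ?thesis
    by (induction I rule: infinite_finite_induct)
      (simp_all only: sum.infinite sum.empty sum.insert rho_zero simp_thms not_False_eq_True)
qed

lemma N_twist:
  assumes "c \<noteq> 0" "NF (det g) = NF c * NF c" shows "NC (twist g) = inverse (NF c ^ k \<sigma>)"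
proof -
  define l where "l = ordF D c"
  have l: "NF c = NF \<pi> powi l" unfolding l_def by (rule N_eq_powi_ordF[OF assms(1)])
  have "ordF D (det g) = l + l" using assms(2) by (intro ordF_eqI) (simp only: F.N_unif_powi_add l)
  then have "twist g = (sqrt_unif powi (l + l)) powi (- int (k \<sigma>))"
    by (simp only: mult_minus_left flip: power_int_mult mult_minus_right)
  also have "sqrt_unif powi (l + l) = \<sigma> \<pi> powi l"
    unfolding sqrt_unif_square[symmetric] power_int_mult_distrib
    by (rule power_int_add) (simp add: sqrt_unif_nonzero)
  finally have "NC (twist g) = (NF \<pi> powi l) powi (- int (k \<sigma>))" by (simp only: C.N_power_int N_\<sigma>)
  then show ?thesis by (simp add: l power_int_minus)
qed

text \<open>Up to a scalar \<open>c\<close> the matrix \<open>\<kappa>\<close> is integral, and the twist compensates the factor \<open>c^k\<close>.\<close>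

lemma rho_in_weight_lattice:
  assumes "\<kappa> \<in> KZ D" "v \<in> weight_lattice D k"
  shows "rho D k \<kappa> v \<in> weight_lattice D k"
proof -
  obtain c where c: "c \<noteq> 0" "F.entries_le (NF c) \<kappa>" "NF (det \<kappa>) = NF c * NF c * NF \<pi> ^ 0"
    using assms(1) unfolding KZ_iff by (rule scaled_integralE)
  have "C.gauss (act \<kappa> (to_poly v)) \<le> C.gauss (to_poly v) * NF c ^ k \<sigma>"
    unfolding act_def
    using c(2) by (intro C.gauss_binary_form_le) (simp_all add: C.gauss_pCons N_\<sigma> F.entries_le_nth)
  also have "\<dots> \<le> 1 * NF c ^ k \<sigma>"
    using assms(2) by (intro mult_right_mono) (simp_all add: weight_lattice_iff)
  finally have "NC (twist \<kappa>) * C.gauss (act \<kappa> (to_poly v)) \<le> NC (twist \<kappa>) * (1 * NF c ^ k \<sigma>)"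
    by (intro mult_left_mono) simp_all
  also have "\<dots> = 1" using c(1) N_twist[OF c(1)] c(3) by simp
  finally show ?thesis
    by (simp only: weight_lattice_iff rho_in_weight to_poly_rho C.gauss_smult simp_thms)
qed

end

section \<open>The Hecke operator\<close>

lemma sum_fun_apply: "(\<Sum>i\<in>S. F i) x = (\<Sum>i\<in>S. F i x)" for F :: "'i \<Rightarrow> 'a \<Rightarrow> 'b::comm_monoid_add"
  by (induction S rule: infinite_finite_induct) simp_all

lemma finite_image_of_factor:
  assumes "finite (g ` A)" "\<And>x y. x \<in> A \<Longrightarrow> y \<in> A \<Longrightarrow> g x = g y \<Longrightarrow> f x = f y"
  shows "finite (f ` A)"
proof -
  have "f ` A \<subseteq> (\<lambda>y. f (inv_into A g y)) ` g ` A"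
  proof
    fix z assume "z \<in> f ` A"
    then obtain x where x: "x \<in> A" "z = f x" by blast
    then have "f x = f (inv_into A g (g x))"
      by (intro assms(2)) (simp_all add: inv_into_into f_inv_into_f)
    then show "z \<in> (\<lambda>y. f (inv_into A g y)) ` g ` A" using x by blast
  qed
  then show ?thesis using assms(1) finite_surj by blast
qed

context padic_setting
begin

definition left_coset :: "'f^2^2 \<Rightarrow> ('f^2^2) set" where
  "left_coset x = (\<lambda>\<kappa>. x ** \<kappa>) ` KZ D"

definition right_coset :: "'f^2^2 \<Rightarrow> ('f^2^2) set" where
  "right_coset x = (\<lambda>\<kappa>. \<kappa> ** x) ` KZ D"

lemma KZ_mult_left_image: "\<kappa> \<in> KZ D \<Longrightarrow> (\<lambda>\<kappa>'. \<kappa> ** \<kappa>') ` KZ D = KZ D"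
proof (intro set_eqI iffI)
  fix x assume "\<kappa> \<in> KZ D" "x \<in> KZ D"
  then show "x \<in> (\<lambda>\<kappa>'. \<kappa> ** \<kappa>') ` KZ D"
    by (intro image_eqI[of _ _ "matrix_inv \<kappa> ** x"] KZ_mult KZ_matrix_inv)
      (simp add: matrix_inv_cancel KZ_invertible)
qed (auto intro: KZ_mult)

lemma KZ_mult_right_image: "\<kappa> \<in> KZ D \<Longrightarrow> (\<lambda>\<kappa>'. \<kappa>' ** \<kappa>) ` KZ D = KZ D"
proof (intro set_eqI iffI)
  fix x assume "\<kappa> \<in> KZ D" "x \<in> KZ D"
  then show "x \<in> (\<lambda>\<kappa>'. \<kappa>' ** \<kappa>) ` KZ D"
    by (intro image_eqI[of _ _ "x ** matrix_inv \<kappa>"] KZ_mult KZ_matrix_inv)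
      (simp add: matrix_inv_left KZ_invertible flip: matrix_mul_assoc)
qed (auto intro: KZ_mult)

lemma left_coset_mult: "\<kappa> \<in> KZ D \<Longrightarrow> left_coset (x ** \<kappa>) = left_coset x"
  using arg_cong[OF KZ_mult_left_image, of \<kappa> "(`) ((**) x)"]
  by (simp add: left_coset_def image_image matrix_mul_assoc)

lemma right_coset_mult: "\<kappa> \<in> KZ D \<Longrightarrow> right_coset (\<kappa> ** x) = right_coset x"
  using arg_cong[OF KZ_mult_right_image, of \<kappa> "(`) (\<lambda>\<kappa>'. \<kappa>' ** x)"]
  by (simp add: right_coset_def image_image matrix_mul_assoc)

lemma in_left_coset: "x \<in> left_coset x"
  unfolding left_coset_def using mat_1_in_KZ by (intro image_eqI[of _ _ "mat 1"]) simp_all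

lemma in_right_coset: "x \<in> right_coset x"
  unfolding right_coset_def using mat_1_in_KZ by (intro image_eqI[of _ _ "mat 1"]) simp_all

lemma left_coset_eq_iff:
  assumes "invertible x" shows "left_coset x = left_coset y \<longleftrightarrow> matrix_inv x ** y \<in> KZ D"
proof
  assume "left_coset x = left_coset y"
  then obtain \<kappa> where "\<kappa> \<in> KZ D" "y = x ** \<kappa>" using in_left_coset[of y] unfolding left_coset_def by auto
  then show "matrix_inv x ** y \<in> KZ D" using assms by (simp add: matrix_inv_cancel)
next
  assume "matrix_inv x ** y \<in> KZ D"
  from left_coset_mult[OF this, of x] show "left_coset x = left_coset y"
    using assms by (simp add: matrix_inv_cancel)
qed

lemma right_coset_eq_iff:
  assumes "invertible x" shows "right_coset x = right_coset y \<longleftrightarrow> y ** matrix_inv x \<in> KZ D"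
proof
  assume "right_coset x = right_coset y"
  then obtain \<kappa> where "\<kappa> \<in> KZ D" "y = \<kappa> ** x" using in_right_coset[of y] unfolding right_coset_def
    by auto
  then show "y ** matrix_inv x \<in> KZ D" using assms
    by (simp add: matrix_inv_right flip: matrix_mul_assoc)
next
  assume "y ** matrix_inv x \<in> KZ D"
  from right_coset_mult[OF this, of x] show "right_coset x = right_coset y"
    using assms by (simp add: matrix_inv_left flip: matrix_mul_assoc)
qed

lemma some_in_left_coset: obtains \<kappa> where "\<kappa> \<in> KZ D" "(SOME y. y \<in> left_coset x) = x ** \<kappa>"
  using someI[of "\<lambda>y. y \<in> left_coset x", OF in_left_coset] unfolding left_coset_def by blast

lemma some_in_right_coset: obtains \<kappa> where "\<kappa> \<in> KZ D" "(SOME y. y \<in> right_coset x) = \<kappa> ** x"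
  using someI[of "\<lambda>y. y \<in> right_coset x", OF in_right_coset] unfolding right_coset_def by blast

lemma left_coset_alpha_cong:
  assumes \<kappa>: "\<kappa> \<in> maxcompact D" "\<kappa>' \<in> maxcompact D"
    and col: "NF (\<kappa>' $ 1 $ 1 - \<kappa> $ 1 $ 1) < 1" "NF (\<kappa>' $ 2 $ 1 - \<kappa> $ 2 $ 1) < 1"
  shows "left_coset (\<kappa> ** alpha D) = left_coset (\<kappa>' ** alpha D)"
proof -
  have \<kappa>_le: "F.entries_le 1 \<kappa>" "F.entries_le 1 \<kappa>'" and N_det: "NF (det \<kappa>) = 1" "NF (det \<kappa>') = 1"
    using \<kappa> unfolding maxcompact_iff by simp_all
  then have inv: "invertible \<kappa>" by (auto simp: invertible_det_nz)
  note inv_eq = matrix_inv_mat2[OF inv[unfolded invertible_det_nz]]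
  have inv_le: "F.entries_le 1 (matrix_inv \<kappa>)"
    using \<kappa>_le(1) by (simp add: inv_eq N_det F.N_divide F.entries_le_nth)
  define \<delta> where "\<delta> = matrix_inv \<kappa> ** \<kappa>'"
  have "F.entries_le (1 * 1) \<delta>" unfolding \<delta>_def by (intro F.entries_le_mult inv_le \<kappa>_le)
  then have \<delta>_le: "NF (\<delta> $ i $ j) \<le> 1" for i j by (simp add: F.entries_le_nth)
  have "\<delta> $ 2 $ 1 = matrix_inv \<kappa> $ 2 $ 1 * (\<kappa>' $ 1 $ 1 - \<kappa> $ 1 $ 1)
      + matrix_inv \<kappa> $ 2 $ 2 * (\<kappa>' $ 2 $ 1 - \<kappa> $ 2 $ 1)"
    unfolding \<delta>_def matrix_mult_nth_2 inv_eq by (simp add: algebra_simps)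
  also have "NF \<dots> \<le> NF \<pi>"
    using F.entries_le_nth[OF inv_le]
    by (intro F.N_add_le F.N_mult_le[of _ 1 _ "NF \<pi>", simplified] F.N_le_unif col)
  finally have \<delta>_21: "NF (\<delta> $ 2 $ 1) \<le> NF \<pi>" .
  define \<mu> where "\<mu> = mat2 (\<delta> $ 1 $ 1) (\<pi> * \<delta> $ 1 $ 2) (\<delta> $ 2 $ 1 / \<pi>) (\<delta> $ 2 $ 2)"
  have "det \<mu> = det \<delta>" unfolding \<mu>_def det_2 using F.unif_nonzero by simp
  then have "NF (det \<mu>) = 1"
    by (simp add: \<delta>_def det_mul F.N_mult det_matrix_inv[OF inv] F.N_inverse N_det)
  moreover have "NF (\<pi> * \<delta> $ 1 $ 2) \<le> 1 * 1"
    using F.N_unif_less_one \<delta>_le by (intro F.N_mult_le) simp_all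
  then have "F.entries_le 1 \<mu>" using \<delta>_le \<delta>_21 F.unif_nonzero by (simp add: \<mu>_def F.N_divide)
  ultimately have "\<mu> \<in> KZ D" unfolding KZ_iff by (intro scaled_integralI[of 1]) simp_all
  moreover have "\<kappa> ** alpha D ** \<mu> = \<kappa>' ** alpha D"
  proof -
    have "alpha D ** \<mu> = \<delta> ** alpha D"
      unfolding \<mu>_def alpha_def using F.unif_nonzero
      by (intro mat2_eqI) (simp_all add: matrix_mult_nth_2 mult.commute)
    moreover have "\<kappa> ** \<delta> = \<kappa>'" unfolding \<delta>_def using inv by (simp add: matrix_inv_cancel)
    ultimately show ?thesis by (metis matrix_mul_assoc)
  qed
  ultimately show ?thesis using left_coset_mult by metis
qed

lemma left_coset_of_matrix_inv_in_double_coset: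
  assumes x: "invertible x" "matrix_inv x \<in> double_coset"
  shows "\<exists>\<kappa>\<in>maxcompact D. left_coset x = left_coset (\<kappa> ** alpha D)"
proof -
  obtain \<kappa>1 \<kappa>2 where \<kappa>: "\<kappa>1 \<in> KZ D" "\<kappa>2 \<in> KZ D" "matrix_inv x = \<kappa>1 ** matrix_inv (alpha D) ** \<kappa>2"
    using x(2) by (rule double_cosetE)
  have "x = matrix_inv (\<kappa>1 ** matrix_inv (alpha D) ** \<kappa>2)"
    using \<kappa>(3) matrix_inv_matrix_inv[OF x(1)] by simp
  also have "\<dots> = matrix_inv \<kappa>2 ** alpha D ** matrix_inv \<kappa>1"
    using \<kappa>(1,2) by (simp add: matrix_inv_mult matrix_inv_matrix_inv invertible_mult KZ_invertible
        invertible_alpha invertible_matrix_inv matrix_mul_assoc)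
  finally have left: "left_coset x = left_coset (matrix_inv \<kappa>2 ** alpha D)"
    using left_coset_mult[OF KZ_matrix_inv[OF \<kappa>(1)]] by simp
  obtain \<kappa> z where \<kappa>z: "\<kappa> \<in> maxcompact D" "z \<in> centerGL2" "matrix_inv \<kappa>2 = \<kappa> ** z"
    using KZ_matrix_inv[OF \<kappa>(2)] unfolding KZ_def by blast
  have "z ** alpha D = alpha D ** z"
    using \<kappa>z(2) invertible_alpha unfolding centerGL2_def GL2_def by blast
  then have "matrix_inv \<kappa>2 ** alpha D = \<kappa> ** alpha D ** z" unfolding \<kappa>z(3) by (metis matrix_mul_assoc)
  moreover have "z \<in> KZ D" using \<kappa>z(2) scalar_in_KZ unfolding center_iff by auto
  ultimately show ?thesis using \<kappa>z(1) left left_coset_mult by metis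
qed

end

context weight_setting
begin

lemma finite_left_cosets_of_double_coset:
  "finite {left_coset x | x. invertible x \<and> matrix_inv x \<in> double_coset}"
proof (rule finite_subset)
  show "{left_coset x | x. invertible x \<and> matrix_inv x \<in> double_coset}
      \<subseteq> (\<lambda>\<kappa>. left_coset (\<kappa> ** alpha D)) ` maxcompact D"
    using left_coset_of_matrix_inv_in_double_coset by blast
  define first_col where "first_col \<kappa> = (R.rep (\<kappa> $ 1 $ 1), R.rep (\<kappa> $ 2 $ 1))" for \<kappa> :: "'f^2^2"
  have le: "NF (\<kappa> $ i $ j) \<le> 1" if "\<kappa> \<in> maxcompact D" for \<kappa> i j
    using that F.entries_le_nth unfolding maxcompact_iff by blast
  show "finite ((\<lambda>\<kappa>. left_coset (\<kappa> ** alpha D)) ` maxcompact D)"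
  proof (rule finite_image_of_factor)
    have "first_col ` maxcompact D \<subseteq> R.reps \<times> R.reps" using le R.rep_in_reps
      by (auto simp: first_col_def)
    then show "finite (first_col ` maxcompact D)" by (rule finite_subset) (simp add: R.finite_reps)
    show "left_coset (\<kappa> ** alpha D) = left_coset (\<kappa>' ** alpha D)"
      if "\<kappa> \<in> maxcompact D" "\<kappa>' \<in> maxcompact D" "first_col \<kappa> = first_col \<kappa>'" for \<kappa> \<kappa>'
      using that le R.rep_eq_iff
      by (intro left_coset_alpha_cong) (simp_all add: first_col_def F.N_minus_commute)
  qed
qed

definition hecke_kernel :: "'f^2^2 \<Rightarrow> ('f, 'c) weight_vec \<Rightarrow> ('f, 'c) weight_vec" where
  "hecke_kernel x v = (if x \<in> double_coset then (\<lambda>i. sqrt_unif ^ k \<sigma> * rho D k x v i) else 0)"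

lemma hecke_kernel_zero [simp]: "hecke_kernel x 0 = 0"
  by (rule ext) (simp add: hecke_kernel_def)

lemma rho_hecke_kernel:
  "\<kappa> \<in> KZ D \<Longrightarrow> invertible x \<Longrightarrow> rho D k \<kappa> (hecke_kernel x v) = hecke_kernel (\<kappa> ** x) v"
  by (simp add: hecke_kernel_def double_coset_cancel_left rho_scale rho_mult KZ_invertible)

lemma hecke_kernel_rho:
  "\<kappa> \<in> KZ D \<Longrightarrow> invertible x \<Longrightarrow> hecke_kernel x (rho D k \<kappa> v) = hecke_kernel (x ** \<kappa>) v"
  by (simp add: hecke_kernel_def double_coset_cancel_right rho_mult KZ_invertible)

lemma to_poly_hecke_kernel:
  assumes "x \<in> double_coset"
  shows "to_poly (hecke_kernel x v) = smult (sqrt_unif ^ k \<sigma> * twist x) (act x (to_poly v))"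
  using assms by (simp add: hecke_kernel_def to_poly_scale to_poly_rho)

lemma twist_of_ord_minus_one:
  assumes "ordF D (det x) = -1" shows "sqrt_unif ^ k \<sigma> * twist x = \<sigma> \<pi> ^ k \<sigma>"
  by (simp add: assms sqrt_unif_square flip: power_mult_distrib)

lemma matrix_inv_alpha_in_double_coset: "matrix_inv (alpha D) \<in> double_coset"
  using mat_1_in_KZ by (intro double_cosetI[of "mat 1" "mat 1"]) simp_all

lemma U_op_eq:
  assumes "v \<in> weight D k"
  shows "U_op D k v = hecke_kernel (matrix_inv (alpha D)) v"
proof (rule weight_eqI)
  show "U_op D k v \<in> weight D k" using assms by (simp add: U_op_def weight_def)
  show "hecke_kernel (matrix_inv (alpha D)) v \<in> weight D k"
    using rho_in_weight by (simp add: weight_def hecke_kernel_def)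
  have ord: "ordF D (det (matrix_inv (alpha D))) = -1"
    unfolding matrix_inv_alpha by (rule ordF_eqI) (simp add: F.N_inverse power_int_minus divide_inverse)
  have diag: "coeff ([:0, c:] ^ i) m = (if i = m then c ^ m else 0)" for c :: 'c and i m
    by (cases i m rule: linorder_cases) (simp_all add: coeff_linear_power binomial_eq_0)
  show "to_poly (U_op D k v) = to_poly (hecke_kernel (matrix_inv (alpha D)) v)"
  proof (rule poly_eqI)
    fix m
    have "coeff (to_poly (U_op D k v)) m = \<sigma> \<pi> ^ (k \<sigma> - m) * coeff (to_poly v) m"
      by (simp add: coeff_to_poly U_op_def exponent_def k_other prod_embeddings)
    also have "\<sigma> \<pi> ^ (k \<sigma> - m) * coeff (to_poly v) m
        = \<sigma> \<pi> ^ k \<sigma> * (coeff (to_poly v) m * inverse (\<sigma> \<pi>) ^ m)"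
      using \<sigma>.nonzero[OF F.unif_nonzero]
      by (simp add: coeff_to_poly power_diff power_inverse divide_inverse)
    also have "coeff (to_poly v) m * inverse (\<sigma> \<pi>) ^ m = coeff (act (matrix_inv (alpha D)) (to_poly v)) m"
      unfolding matrix_inv_alpha act_upper coeff_sum
      by (simp add: \<sigma>.one \<sigma>.zero \<sigma>.inverse divide_inverse diag coeff_to_poly
          if_distrib[of "(*) _"] cong: if_cong)
    finally show "coeff (to_poly (U_op D k v)) m = coeff (to_poly (hecke_kernel (matrix_inv (alpha D)) v)) m"
      unfolding to_poly_hecke_kernel[OF matrix_inv_alpha_in_double_coset] twist_of_ord_minus_one[OF ord]
      by simp
  qed
qed

lemma psi_eq: "psi D k = hecke_kernel"
  unfolding psi_def double_coset_def[symmetric]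
proof (rule the_equality)
  have kernel: "hecke_kernel (\<kappa>1 ** matrix_inv (alpha D) ** \<kappa>2) = rho D k \<kappa>1 \<circ> U_op D k \<circ> rho D k \<kappa>2"
    if "\<kappa>1 \<in> KZ D" "\<kappa>2 \<in> KZ D" for \<kappa>1 \<kappa>2
    using that by (intro ext) (simp add: U_op_eq[OF rho_in_weight] rho_hecke_kernel hecke_kernel_rho
        KZ_invertible invertible_mult invertible_matrix_inv invertible_alpha matrix_mul_assoc)
  show "(\<forall>x. x \<notin> double_coset \<longrightarrow> hecke_kernel x = (\<lambda>v. 0)) \<and> (\<forall>\<kappa>1\<in>KZ D. \<forall>\<kappa>2\<in>KZ D.
      hecke_kernel (\<kappa>1 ** matrix_inv (alpha D) ** \<kappa>2) = rho D k \<kappa>1 \<circ> U_op D k \<circ> rho D k \<kappa>2)"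
    using kernel by (auto simp: hecke_kernel_def fun_eq_iff)
  fix \<psi> assume \<psi>: "(\<forall>x. x \<notin> double_coset \<longrightarrow> \<psi> x = (\<lambda>v. 0)) \<and> (\<forall>\<kappa>1\<in>KZ D. \<forall>\<kappa>2\<in>KZ D.
      \<psi> (\<kappa>1 ** matrix_inv (alpha D) ** \<kappa>2) = rho D k \<kappa>1 \<circ> U_op D k \<circ> rho D k \<kappa>2)"
  show "\<psi> = hecke_kernel"
  proof
    fix x show "\<psi> x = hecke_kernel x"
    proof (cases "x \<in> double_coset")
      case True
      then show ?thesis using \<psi> kernel by (auto elim!: double_cosetE)
    next
      case False
      then show ?thesis using \<psi> by (auto simp: hecke_kernel_def fun_eq_iff)
    qed
  qed
qed

lemma elem_zero [simp]: "elem D k g 0 = 0"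
  by (rule ext) (simp add: elem_def)

lemma elem_outside_GL2:
  assumes "\<not> invertible h" shows "elem D k g v h = 0"
proof -
  have "h ** g \<notin> KZ D" using assms KZ_invertible[of "h ** g"] by (auto simp: invertible_det_nz det_mul)
  then show ?thesis by (simp add: elem_def)
qed

lemma elem_mult_left:
  assumes "\<kappa> \<in> KZ D" "invertible g" "invertible h"
  shows "elem D k g v (\<kappa> ** h) = rho D k \<kappa> (elem D k g v h)"
  using assms by (simp add: elem_def KZ_cancel_left rho_mult KZ_invertible invertible_mult
      flip: matrix_mul_assoc)

definition coset_term ::
  "'f^2^2 \<Rightarrow> ('f, 'c) weight_vec \<Rightarrow> ('f^2^2) set \<Rightarrow> ('f, 'c) ind_fun" where
  "coset_term g v X = (let x = (SOME x. x \<in> X) in elem D k (g ** x) (psi D k (matrix_inv x) v))"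

lemma coset_term_apply:
  assumes "invertible g" "invertible h" "invertible x"
  shows "coset_term g v (left_coset x) h
    = (if left_coset x = left_coset (matrix_inv (h ** g)) then hecke_kernel (h ** g) v else 0)"
proof -
  obtain \<kappa> where \<kappa>: "\<kappa> \<in> KZ D" "(SOME y. y \<in> left_coset x) = x ** \<kappa>" by (rule some_in_left_coset)
  define y where "y = x ** \<kappa>"
  have y: "invertible y" "left_coset y = left_coset x"
    using \<kappa>(1) assms by (simp_all add: y_def left_coset_mult invertible_mult KZ_invertible)
  have hg: "invertible (h ** g)" using assms by (intro invertible_mult)
  have "left_coset (matrix_inv (h ** g)) = left_coset y \<longleftrightarrow> h ** g ** y \<in> KZ D"
    using hg by (simp add: left_coset_eq_iff invertible_matrix_inv matrix_inv_matrix_inv)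
  moreover have "rho D k (h ** g ** y) (hecke_kernel (matrix_inv y) v) = hecke_kernel (h ** g) v"
    if "h ** g ** y \<in> KZ D"
    using that y(1)
    by (simp add: rho_hecke_kernel invertible_matrix_inv matrix_inv_right flip: matrix_mul_assoc)
  ultimately show ?thesis
    unfolding coset_term_def \<kappa>(2) y_def[symmetric] Let_def psi_eq elem_def y(2)
    by (auto simp: matrix_mul_assoc)
qed

lemma finite_coset_terms:
  assumes "invertible g"
  shows "finite {X \<in> {left_coset x | x. invertible x}. coset_term g v X \<noteq> 0}"
proof (rule finite_subset[OF _ finite_left_cosets_of_double_coset], rule subsetI)
  fix X assume "X \<in> {X \<in> {left_coset x | x. invertible x}. coset_term g v X \<noteq> 0}"
  then obtain x where x: "invertible x" "X = left_coset x" "coset_term g v X \<noteq> 0" by blast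
  obtain \<kappa> where \<kappa>: "\<kappa> \<in> KZ D" "(SOME y. y \<in> left_coset x) = x ** \<kappa>" by (rule some_in_left_coset)
  have "hecke_kernel (matrix_inv (x ** \<kappa>)) v \<noteq> 0"
    using x(2,3) unfolding coset_term_def Let_def psi_eq by (auto simp: \<kappa>(2))
  then have "matrix_inv (x ** \<kappa>) \<in> double_coset" unfolding hecke_kernel_def by (auto split: if_splits)
  moreover have "invertible (x ** \<kappa>)" using x(1) \<kappa>(1) by (simp add: invertible_mult KZ_invertible)
  ultimately show "X \<in> {left_coset x | x. invertible x \<and> matrix_inv x \<in> double_coset}"
    using left_coset_mult[OF \<kappa>(1)] x(2) by blast
qed

lemma hecke_elem_apply:
  assumes "invertible g" "invertible h"
  shows "hecke_elem D k g v h = hecke_kernel (h ** g) v"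
proof -
  define \<X> where "\<X> = {X \<in> {left_coset x | x. invertible x}. coset_term g v X \<noteq> 0}"
  define X0 where "X0 = left_coset (matrix_inv (h ** g))"
  have hg: "invertible (matrix_inv (h ** g))" using assms
    by (intro invertible_matrix_inv invertible_mult)
  have "hecke_elem D k g v h = (\<Sum>X\<in>\<X>. coset_term g v X h)"
    unfolding hecke_elem_def coset_term_def[symmetric] \<X>_def left_coset_def GL2_def
    by (simp only: Let_def sum_fun_apply mem_Collect_eq)
  also have "\<dots> = (\<Sum>X\<in>\<X>. if X = X0 then hecke_kernel (h ** g) v else 0)"
  proof (intro sum.cong refl)
    fix X assume "X \<in> \<X>"
    then obtain x where "invertible x" "X = left_coset x" by (auto simp: \<X>_def)
    then show "coset_term g v X h = (if X = X0 then hecke_kernel (h ** g) v else 0)"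
      by (simp add: coset_term_apply[OF assms] X0_def)
  qed
  also have "\<dots> = (if X0 \<in> \<X> then hecke_kernel (h ** g) v else 0)"
    using finite_coset_terms[OF assms(1)] by (simp add: \<X>_def)
  also have "\<dots> = hecke_kernel (h ** g) v"
    using coset_term_apply[OF assms hg, of v] hg by (auto simp: \<X>_def X0_def)
  finally show ?thesis .
qed

end

section \<open>Functions in the compact induction\<close>

context weight_setting
begin

definition KZ_stable :: "('f, 'c) weight_vec set \<Rightarrow> bool" where
  "KZ_stable W \<longleftrightarrow> W \<subseteq> weight D k \<and> 0 \<in> W \<and> (\<forall>u\<in>W. \<forall>v\<in>W. u + v \<in> W) \<and>
    (\<forall>\<kappa>\<in>KZ D. \<forall>v\<in>W. rho D k \<kappa> v \<in> W)"

lemma KZ_stable_weight: "KZ_stable (weight D k)"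
  using rho_in_weight by (auto simp: KZ_stable_def weight_def)

lemma KZ_stable_weight_lattice: "KZ_stable (weight_lattice D k)"
  using rho_in_weight_lattice C.N_add_le
  by (auto simp: KZ_stable_def weight_lattice_def weight_def int_ring_def)

lemma KZ_stable_sum: "KZ_stable W \<Longrightarrow> (\<And>i. i \<in> I \<Longrightarrow> v i \<in> W) \<Longrightarrow> (\<Sum>i\<in>I. v i) \<in> W"
  by (induction I rule: infinite_finite_induct) (auto simp: KZ_stable_def)

lemma c_ind_KZ: "f \<in> c_ind D k W \<Longrightarrow> \<kappa> \<in> KZ D \<Longrightarrow> invertible g \<Longrightarrow> f (\<kappa> ** g) = rho D k \<kappa> (f g)"
  and c_ind_in: "f \<in> c_ind D k W \<Longrightarrow> invertible g \<Longrightarrow> f g \<in> W"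
  and finite_right_cosets_supp:
    "f \<in> c_ind D k W \<Longrightarrow> finite {right_coset g | g. invertible g \<and> f g \<noteq> 0}"
  by (simp_all add: c_ind_def GL2_iff right_coset_def)

lemma right_coset_eq_matrix_inv:
  assumes "invertible x" "g ** x \<in> KZ D" shows "right_coset g = right_coset (matrix_inv x)"
  using right_coset_eq_iff[OF invertible_matrix_inv[OF assms(1)], of g] assms
  by (simp add: matrix_inv_matrix_inv)

lemma elem_sum_apply:
  "(\<Sum>i\<in>I. elem D k (G i) (v i)) g = (\<Sum>i\<in>I. elem D k (G i) (v i) g)"
  by (rule sum_fun_apply)

lemma elem_sum_support:
  assumes "(\<Sum>i\<in>I. elem D k (G i) (v i)) g \<noteq> 0"
  obtains i where "i \<in> I" "v i \<noteq> 0" "g ** G i \<in> KZ D"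
proof -
  obtain i where i: "i \<in> I" "elem D k (G i) (v i) g \<noteq> 0"
    using assms unfolding elem_sum_apply by (rule sum.not_neutral_contains_not_neutral)
  then have "v i \<noteq> 0" using elem_zero by auto
  moreover have "g ** G i \<in> KZ D" using i(2) by (auto simp: elem_def split: if_splits)
  ultimately show thesis using i(1) that by blast
qed

lemma elem_sum_in_c_ind:
  assumes W: "KZ_stable W" and "finite I"
    and G: "\<And>i. i \<in> I \<Longrightarrow> invertible (G i)" and v: "\<And>i. i \<in> I \<Longrightarrow> v i \<in> W"
  shows "(\<Sum>i\<in>I. elem D k (G i) (v i)) \<in> c_ind D k W" (is "?f \<in> _")
proof -
  have "?f g \<in> W" for g
    unfolding elem_sum_apply using W v by (intro KZ_stable_sum) (auto simp: elem_def KZ_stable_def)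
  moreover have "?f g = 0" if "\<not> invertible g" for g
    unfolding elem_sum_apply using elem_outside_GL2[OF that] by (intro sum.neutral) blast
  moreover have "?f (\<kappa> ** g) = rho D k \<kappa> (?f g)" if "\<kappa> \<in> KZ D" "invertible g" for \<kappa> g
    unfolding elem_sum_apply rho_sum using that G by (intro sum.cong elem_mult_left) simp_all
  moreover have "finite {right_coset g | g. invertible g \<and> ?f g \<noteq> 0}"
  proof (rule finite_subset)
    show "finite ((\<lambda>i. right_coset (matrix_inv (G i))) ` I)" using \<open>finite I\<close> by simp
    show "{right_coset g | g. invertible g \<and> ?f g \<noteq> 0} \<subseteq> (\<lambda>i. right_coset (matrix_inv (G i))) ` I"
      using right_coset_eq_matrix_inv G by (auto elim!: elem_sum_support)
  qed
  ultimately show ?thesis unfolding c_ind_def by (simp add: GL2_iff right_coset_def)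
qed

lemma smul_elem_sum:
  "smul c (\<Sum>i\<in>I. elem D k (G i) (v i)) = (\<Sum>i\<in>I. elem D k (G i) (\<lambda>j. c * v i j))"
proof (intro ext)
  fix g j
  have "c * elem D k (G i) (v i) g j = elem D k (G i) (\<lambda>j. c * v i j) g j" for i
    by (simp add: elem_def rho_scale)
  then show "smul c (\<Sum>i\<in>I. elem D k (G i) (v i)) g j = (\<Sum>i\<in>I. elem D k (G i) (\<lambda>j. c * v i j)) g j"
    by (simp add: smul_def sum_fun_apply sum_distrib_left)
qed

lemma elem_sum_eq_smul_lattice:
  assumes "finite I" "\<And>i. i \<in> I \<Longrightarrow> invertible (G i)" and v: "\<And>i. i \<in> I \<Longrightarrow> v i \<in> weight D k"
    and "c \<noteq> 0" and le: "\<And>i. i \<in> I \<Longrightarrow> C.gauss (to_poly (v i)) \<le> NC c"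
  obtains h where "h \<in> c_ind D k (weight_lattice D k)" "(\<Sum>i\<in>I. elem D k (G i) (v i)) = smul c h"
proof
  have "(\<lambda>j. v i j / c) \<in> weight_lattice D k" if "i \<in> I" for i
  proof -
    have "NC (v i j) \<le> NC c" for j using gauss_to_poly_le_iff[OF v[OF that]] le[OF that] by simp
    then show ?thesis
      using v[OF that] \<open>c \<noteq> 0\<close> by (simp add: weight_lattice_def weight_def int_ring_def C.N_divide)
  qed
  then show "(\<Sum>i\<in>I. elem D k (G i) (\<lambda>j. v i j / c)) \<in> c_ind D k (weight_lattice D k)"
    using assms(1,2) by (intro elem_sum_in_c_ind KZ_stable_weight_lattice)
  show "(\<Sum>i\<in>I. elem D k (G i) (v i)) = smul c (\<Sum>i\<in>I. elem D k (G i) (\<lambda>j. v i j / c))"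
    unfolding smul_elem_sum using \<open>c \<noteq> 0\<close> by simp
qed

definition inequivalent :: "'i set \<Rightarrow> ('i \<Rightarrow> 'f^2^2) \<Rightarrow> bool" where
  "inequivalent I G \<longleftrightarrow> (\<forall>i\<in>I. invertible (G i)) \<and>
    (\<forall>i\<in>I. \<forall>j\<in>I. matrix_inv (G i) ** G j \<in> KZ D \<longrightarrow> i = j)"

definition supported_on :: "'i set \<Rightarrow> ('i \<Rightarrow> 'f^2^2) \<Rightarrow> ('f, 'c) ind_fun \<Rightarrow> bool" where
  "supported_on I G f \<longleftrightarrow> (\<forall>g. f g \<noteq> 0 \<longrightarrow> (\<exists>i\<in>I. g ** G i \<in> KZ D))"

lemma supported_on_elem_sum:
  assumes "J \<subseteq> I" shows "supported_on I G (\<Sum>i\<in>J. elem D k (G i) (v i))"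
  unfolding supported_on_def
proof (intro allI impI)
  fix g assume "(\<Sum>i\<in>J. elem D k (G i) (v i)) g \<noteq> 0"
  then obtain i where "i \<in> J" "g ** G i \<in> KZ D" by (rule elem_sum_support)
  then show "\<exists>i\<in>I. g ** G i \<in> KZ D" using assms by blast
qed

lemma inequivalent_invertible: "inequivalent I G \<Longrightarrow> i \<in> I \<Longrightarrow> invertible (G i)"
  by (simp add: inequivalent_def)

lemma inequivalent_subset: "inequivalent I G \<Longrightarrow> J \<subseteq> I \<Longrightarrow> inequivalent J G"
  unfolding inequivalent_def by (meson subsetD)

lemma inequivalentD:
  assumes "inequivalent I G" "i \<in> I" "j \<in> I" "g ** G i \<in> KZ D" "g ** G j \<in> KZ D"
  shows "i = j"
proof -
  have "invertible (g ** G i)" by (rule KZ_invertible[OF assms(4)])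
  then have "invertible g" by (auto simp: invertible_det_nz det_mul)
  then have "matrix_inv (g ** G i) ** (g ** G j) = matrix_inv (G i) ** G j"
    using inequivalent_invertible[OF assms(1,2)]
    by (simp add: matrix_inv_mult matrix_inv_cancel flip: matrix_mul_assoc)
  then show ?thesis using assms KZ_mult[OF KZ_matrix_inv[OF assms(4)] assms(5)]
    by (simp add: inequivalent_def)
qed

lemma inj_on_right_coset_matrix_inv:
  assumes "inequivalent I G" shows "inj_on (\<lambda>i. right_coset (matrix_inv (G i))) I"
proof (rule inj_onI)
  fix i j assume ij: "i \<in> I" "j \<in> I" "right_coset (matrix_inv (G i)) = right_coset (matrix_inv (G j))"
  then have "matrix_inv (G j) ** G i \<in> KZ D"
    using inequivalent_invertible[OF assms]
    by (simp add: right_coset_eq_iff invertible_matrix_inv matrix_inv_matrix_inv)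
  then show "i = j" using assms ij by (auto simp: inequivalent_def)
qed

lemma c_ind_value_of_equivalent:
  assumes "f \<in> c_ind D k W" "invertible x" "g ** x \<in> KZ D"
  shows "f g = rho D k (g ** x) (f (matrix_inv x))"
  using c_ind_KZ[OF assms(1,3) invertible_matrix_inv[OF assms(2)]] assms(2)
  by (simp add: matrix_inv_right flip: matrix_mul_assoc)

lemma finite_supported_indices:
  assumes "f \<in> c_ind D k W" "inequivalent I G"
  shows "finite {i \<in> I. f (matrix_inv (G i)) \<noteq> 0}"
proof (rule inj_on_finite)
  show "inj_on (\<lambda>i. right_coset (matrix_inv (G i))) {i \<in> I. f (matrix_inv (G i)) \<noteq> 0}"
    using inj_on_right_coset_matrix_inv[OF assms(2)] by (rule inj_on_subset) blast
  show "(\<lambda>i. right_coset (matrix_inv (G i))) ` {i \<in> I. f (matrix_inv (G i)) \<noteq> 0}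
      \<subseteq> {right_coset g | g. invertible g \<and> f g \<noteq> 0}"
    using inequivalent_invertible[OF assms(2)] invertible_matrix_inv by blast
qed (rule finite_right_cosets_supp[OF assms(1)])

lemma supported_on_nonzero_indices:
  assumes "f \<in> c_ind D k W" "inequivalent I G" "supported_on I G f"
  shows "supported_on {i \<in> I. f (matrix_inv (G i)) \<noteq> 0} G f"
  unfolding supported_on_def
proof (intro allI impI)
  fix g assume "f g \<noteq> 0"
  then obtain i where i: "i \<in> I" "g ** G i \<in> KZ D" using assms(3) unfolding supported_on_def by blast
  have "f g = rho D k (g ** G i) (f (matrix_inv (G i)))"
    using c_ind_value_of_equivalent[OF assms(1) inequivalent_invertible[OF assms(2) i(1)] i(2)] .
  then have "f (matrix_inv (G i)) \<noteq> 0" using \<open>f g \<noteq> 0\<close> by auto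
  then show "\<exists>i\<in>{i \<in> I. f (matrix_inv (G i)) \<noteq> 0}. g ** G i \<in> KZ D" using i by blast
qed

lemma c_ind_eq_elem_sum:
  assumes f: "f \<in> c_ind D k W" and "finite I" and I: "inequivalent I G" "supported_on I G f"
  shows "f = (\<Sum>i\<in>I. elem D k (G i) (f (matrix_inv (G i))))" (is "_ = ?e")
proof
  fix g
  show "f g = ?e g"
  proof (cases "\<exists>i\<in>I. g ** G i \<in> KZ D")
    case True
    then obtain i where i: "i \<in> I" "g ** G i \<in> KZ D" by blast
    have "elem D k (G j) (f (matrix_inv (G j))) g = 0" if "j \<in> I" "j \<noteq> i" for j
      using inequivalentD[OF I(1) i(1) that(1) i(2)] that(2) by (auto simp: elem_def)
    then have "?e g = (\<Sum>j\<in>{i}. elem D k (G j) (f (matrix_inv (G j))) g)"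
      unfolding elem_sum_apply using \<open>finite I\<close> i(1) by (intro sum.mono_neutral_right) auto
    also have "\<dots> = rho D k (g ** G i) (f (matrix_inv (G i)))" using i(2) by (simp add: elem_def)
    also have "\<dots> = f g"
      using c_ind_value_of_equivalent[OF f inequivalent_invertible[OF I(1) i(1)] i(2)] ..
    finally show ?thesis ..
  next
    case False
    then have "f g = 0" "elem D k (G i) (f (matrix_inv (G i))) g = 0" if "i \<in> I" for i
      using that I(2) by (auto simp: supported_on_def elem_def)
    moreover have "f g = 0" using False I(2) unfolding supported_on_def by blast
    ultimately show ?thesis by (simp add: elem_sum_apply)
  qed
qed

lemma hecke_elem_some_in_right_coset:
  assumes f: "f \<in> c_ind D k W" and inv: "invertible x" "invertible h"
  shows "(let y = (SOME y. y \<in> right_coset x) in hecke_elem D k (matrix_inv y) (f y)) h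
    = hecke_kernel (h ** matrix_inv x) (f x)"
proof -
  obtain \<kappa> where \<kappa>: "\<kappa> \<in> KZ D" "(SOME y. y \<in> right_coset x) = \<kappa> ** x" by (rule some_in_right_coset)
  have "hecke_elem D k (matrix_inv (\<kappa> ** x)) (f (\<kappa> ** x)) h
      = hecke_kernel (h ** matrix_inv (\<kappa> ** x)) (rho D k \<kappa> (f x))"
    using inv \<kappa>(1) by (simp add: hecke_elem_apply invertible_matrix_inv invertible_mult KZ_invertible
        c_ind_KZ[OF f])
  also have "\<dots> = hecke_kernel (h ** matrix_inv x) (f x)"
    using inv \<kappa>(1) by (simp add: hecke_kernel_rho invertible_matrix_inv invertible_mult KZ_invertible
        matrix_inv_mult matrix_inv_left flip: matrix_mul_assoc)
  finally show ?thesis unfolding \<kappa>(2) Let_def .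
qed

theorem hecke_apply:
  assumes f: "f \<in> c_ind D k W" and "finite I" and I: "inequivalent I G" "supported_on I G f"
    and h: "invertible h"
  shows "hecke D k f h = (\<Sum>i\<in>I. hecke_kernel (h ** G i) (f (matrix_inv (G i))))"
proof -
  define J where "J = {i \<in> I. f (matrix_inv (G i)) \<noteq> 0}"
  have J: "J \<subseteq> I" "supported_on J G f"
    using supported_on_nonzero_indices[OF f I] by (auto simp: J_def)
  define Y where "Y i = right_coset (matrix_inv (G i))" for i
  have cosets: "{right_coset g | g. invertible g \<and> f g \<noteq> 0} = Y ` J"
  proof (intro set_eqI iffI)
    fix X assume "X \<in> {right_coset g | g. invertible g \<and> f g \<noteq> 0}"
    then obtain g i where "X = right_coset g" "i \<in> J" "g ** G i \<in> KZ D"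
      using J(2) unfolding supported_on_def by blast
    then have "X = Y i"
      using right_coset_eq_matrix_inv inequivalent_invertible[OF I(1)] J(1) unfolding Y_def by blast
    then show "X \<in> Y ` J" using \<open>i \<in> J\<close> by blast
  next
    fix X assume "X \<in> Y ` J"
    then show "X \<in> {right_coset g | g. invertible g \<and> f g \<noteq> 0}"
      using inequivalent_invertible[OF I(1)] invertible_matrix_inv unfolding Y_def J_def by blast
  qed
  have inj: "inj_on Y J"
    unfolding Y_def using inj_on_right_coset_matrix_inv[OF I(1)] J(1) by (rule inj_on_subset)
  have "hecke D k f h = (\<Sum>i\<in>J. (let y = (SOME y. y \<in> Y i) in hecke_elem D k (matrix_inv y) (f y)) h)"
    unfolding hecke_def GL2_iff right_coset_def[symmetric] cosets sum_fun_apply sum.reindex[OF inj] o_def ..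
  also have "\<dots> = (\<Sum>i\<in>J. hecke_kernel (h ** G i) (f (matrix_inv (G i))))"
  proof (intro sum.cong refl)
    fix i assume "i \<in> J"
    then have "invertible (G i)" using J(1) inequivalent_invertible[OF I(1)] by blast
    then show "(let y = (SOME y. y \<in> Y i) in hecke_elem D k (matrix_inv y) (f y)) h
        = hecke_kernel (h ** G i) (f (matrix_inv (G i)))"
      unfolding Y_def
      using hecke_elem_some_in_right_coset[OF f invertible_matrix_inv h]
      by (simp add: matrix_inv_matrix_inv)
  qed
  also have "\<dots> = (\<Sum>i\<in>I. hecke_kernel (h ** G i) (f (matrix_inv (G i))))"
    using \<open>finite I\<close> by (intro sum.mono_neutral_left) (auto simp: J_def)
  finally show ?thesis .
qed

end

section \<open>From the tree to the compact induction\<close>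

context weight_setting
begin

lemma teichmueller_image: "teichmueller D ` residue_field NF = R.teich"
  using R.teich_of_class_image by (simp add: teichmueller_def)

text \<open>A vertex is addressed by the word of its Teichmueller digits, the most significant power of
  the uniformizer first, so that the neighbours of \<open>w\<close> further out are the words \<open>s # w\<close>.\<close>

primrec digit_sum :: "'f list \<Rightarrow> 'f" where
  "digit_sum [] = 0"
| "digit_sum (t # w) = digit_sum w + \<pi> ^ length w * t"

lemma digit_sum_map_rev_upt: "digit_sum (map g (rev [0..<n])) = (\<Sum>i<n. \<pi> ^ i * g i)"
  by (induction n) simp_all

lemma digits_eq: "digits D n = digit_sum ` {w \<in> lists R.teich. length w = n}"
proof (intro set_eqI iffI)
  fix x assume "x \<in> digits D n"
  then obtain \<mu> where \<mu>: "x = (\<Sum>i<n. \<pi> ^ i * teichmueller D (\<mu> i))" "\<forall>i<n. \<mu> i \<in> residue_field NF"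
    unfolding digits_def by blast
  let ?w = "map (\<lambda>i. teichmueller D (\<mu> i)) (rev [0..<n])"
  have "set ?w \<subseteq> R.teich" using \<mu>(2) teichmueller_image by auto
  then have "?w \<in> {w \<in> lists R.teich. length w = n}" by (simp add: in_lists_conv_set subset_iff)
  moreover have "x = digit_sum ?w" unfolding \<mu>(1) digit_sum_map_rev_upt ..
  ultimately show "x \<in> digit_sum ` {w \<in> lists R.teich. length w = n}" by (rule rev_image_eqI)
next
  fix x assume "x \<in> digit_sum ` {w \<in> lists R.teich. length w = n}"
  then obtain w where w: "w \<in> lists R.teich" "length w = n" "x = digit_sum w" by blast
  have "\<exists>m. m \<in> residue_field NF \<and> teichmueller D m = rev w ! i" if "i < n" for i
  proof -
    have "rev w ! i \<in> R.teich" using that w(1,2) nth_mem[of i "rev w"] by (auto simp: in_lists_conv_set)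
    then show ?thesis unfolding teichmueller_image[symmetric] by auto
  qed
  then obtain \<mu> where \<mu>: "\<And>i. i < n \<Longrightarrow> \<mu> i \<in> residue_field NF \<and> teichmueller D (\<mu> i) = rev w ! i"
    by metis
  have "w = map ((!) (rev w)) (rev [0..<n])"
    using map_nth[of "rev w"] w(2) by (metis length_rev rev_map rev_rev_ident)
  then have "x = (\<Sum>i<n. \<pi> ^ i * rev w ! i)" unfolding w(3) by (metis digit_sum_map_rev_upt)
  also have "\<dots> = (\<Sum>i<n. \<pi> ^ i * teichmueller D (\<mu> i))" using \<mu> by (intro sum.cong) simp_all
  finally show "x \<in> digits D n" unfolding digits_def using \<mu> by blast
qed

lemma N_digit_sum_le_one: "w \<in> lists R.teich \<Longrightarrow> NF (digit_sum w) \<le> 1"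
proof (induction w)
  case (Cons t w)
  have "NF (\<pi> ^ length w * t) \<le> 1 * 1"
    using Cons.prems R.N_teich_le_one[of t] F.N_unif_less_one
    by (intro F.N_mult_le F.N_power_le_one) simp_all
  then show ?case using Cons by (simp add: F.N_add_le)
qed simp

lemma N_digit_sum_append_diff_le:
  "u \<in> lists R.teich \<Longrightarrow> NF (digit_sum (u @ w) - digit_sum w) \<le> NF \<pi> ^ length w"
proof (induction u)
  case (Cons t u)
  have "NF (\<pi> ^ length (u @ w) * t) \<le> NF \<pi> ^ length w * 1"
    using Cons.prems R.N_teich_le_one[of t] F.N_unif_less_one F.N_unif_pos
    by (intro F.N_mult_le) (auto simp: F.N_power intro!: power_decreasing)
  then have "NF ((digit_sum (u @ w) - digit_sum w) + \<pi> ^ length (u @ w) * t) \<le> NF \<pi> ^ length w"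
    using Cons by (intro F.N_add_le) simp_all
  then show ?case by (simp add: algebra_simps)
qed simp

lemma digit_sum_inj:
  assumes "length w = length w'" "w \<in> lists R.teich" "w' \<in> lists R.teich"
    and "NF (digit_sum w' - digit_sum w) \<le> NF \<pi> ^ length w"
  shows "w = w'"
  using assms
proof (induction w w' rule: list_induct2)
  case (Cons t w t' w')
  have t: "t \<in> R.teich" "t' \<in> R.teich" using Cons.prems by auto
  have diff: "digit_sum (t' # w') - digit_sum (t # w)
      = (digit_sum w' - digit_sum w) + \<pi> ^ length w * (t' - t)"
    using Cons.hyps by (simp add: algebra_simps)
  have small: "NF (digit_sum (t' # w') - digit_sum (t # w)) \<le> NF \<pi> * NF \<pi> ^ length w"
    using Cons.prems by simp
  have top_le: "NF (\<pi> ^ length w * (t' - t)) \<le> NF \<pi> ^ length w * 1"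
    using t by (intro F.N_mult_le F.N_diff_le R.N_teich_le_one) (simp_all add: F.N_power)
  have "NF \<pi> * NF \<pi> ^ length w \<le> NF \<pi> ^ length w"
    using F.N_unif_less_one by (simp add: mult_left_le_one_le)
  then have "NF ((digit_sum (t' # w') - digit_sum (t # w)) - \<pi> ^ length w * (t' - t)) \<le> NF \<pi> ^ length w"
    using top_le by (intro F.N_diff_le[OF order_trans[OF small]]) simp_all
  then have "NF (digit_sum w' - digit_sum w) \<le> NF \<pi> ^ length w" unfolding diff by simp
  then have w_eq: "w = w'" using Cons by auto
  then have "NF \<pi> ^ length w * NF (t' - t) \<le> NF \<pi> ^ length w * NF \<pi>"
    using small unfolding diff by (simp add: F.N_mult F.N_power mult.commute)
  then have "NF (t' - t) < 1" using F.N_unif_pos F.N_unif_less_one by simp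
  then have "t' = t" using R.N_teich_diff[OF t(2,1)] by fastforce
  then show ?case using w_eq by simp
qed simp

lemma digit_sum_close_imp_suffix:
  assumes "w \<in> lists R.teich" "w' \<in> lists R.teich" "length w \<le> length w'"
    and "NF (digit_sum w' - digit_sum w) \<le> NF \<pi> ^ length w"
  shows "\<exists>u. w' = u @ w"
proof -
  define u z where "u = take (length w' - length w) w'" and "z = drop (length w' - length w) w'"
  have w': "w' = u @ z" "length z = length w" using assms(3) by (simp_all add: u_def z_def)
  then have uz: "u \<in> lists R.teich" "z \<in> lists R.teich" using assms(2) by auto
  have "NF (digit_sum w' - digit_sum z) \<le> NF \<pi> ^ length w"
    using N_digit_sum_append_diff_le[OF uz(1), of z] w' by simp
  from F.N_diff_le[OF assms(4) this] have "NF (digit_sum z - digit_sum w) \<le> NF \<pi> ^ length w" by simp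
  then have "w = z" using w'(2) assms(1) uz(2) by (intro digit_sum_inj) simp_all
  then show ?thesis using w'(1) by blast
qed

definition vertex :: "'f list \<Rightarrow> 'f^2^2" where
  "vertex w = g0 D (length w) (digit_sum w)"

lemma invertible_vertex: "invertible (vertex w)"
  unfolding vertex_def by (rule invertible_g0)

lemma matrix_inv_vertex_mult_vertex: "matrix_inv (vertex w) ** vertex w'
    = mat2 (\<pi> powi (int (length w') - int (length w))) ((digit_sum w' - digit_sum w) / \<pi> ^ length w) 0 1"
  unfolding vertex_def by (rule matrix_inv_g0_mult_g0)

lemma vertex_to_child: "matrix_inv (vertex w) ** vertex (s # w) = mat2 \<pi> s 0 1"
  unfolding matrix_inv_vertex_mult_vertex using F.unif_nonzero by simp

lemma vertex_to_parent: "matrix_inv (vertex (t # w)) ** vertex w = mat2 (1 / \<pi>) (- t / \<pi>) 0 1"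
  unfolding matrix_inv_vertex_mult_vertex using F.unif_nonzero
  by (simp add: power_int_minus inverse_eq_divide)

lemma inequivalent_vertices: "inequivalent (lists R.teich) vertex"
  unfolding inequivalent_def
proof (intro conjI ballI impI)
  fix w w' assume w: "w \<in> lists R.teich" "w' \<in> lists R.teich"
    and "matrix_inv (vertex w) ** vertex w' \<in> KZ D"
  then have "length w = length w'" "NF ((digit_sum w' - digit_sum w) / \<pi> ^ length w) \<le> 1"
    using upper_in_KZ_D unfolding matrix_inv_vertex_mult_vertex by fastforce+
  then show "w = w'"
    using w F.N_unif_pos by (intro digit_sum_inj) (simp_all add: F.N_divide F.N_power)
qed (rule invertible_vertex)

lemma vertex_neighbour:
  assumes w: "w \<in> lists R.teich" "w' \<in> lists R.teich"
    and "matrix_inv (vertex w) ** vertex w' \<in> double_coset"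
  shows "(\<exists>s\<in>R.teich. w' = s # w) \<or> (\<exists>t. w = t # w')"
proof -
  have singleton: "\<exists>s. u = [s]" if "length u = 1" for u :: "'f list" using that by (cases u) auto
  consider "length w' = Suc (length w)" "NF ((digit_sum w' - digit_sum w) / \<pi> ^ length w) \<le> 1"
    | "length w = Suc (length w')" "NF ((digit_sum w' - digit_sum w) / \<pi> ^ length w) \<le> inverse (NF \<pi>)"
    using upper_in_double_coset_D[OF assms(3)[unfolded matrix_inv_vertex_mult_vertex]] by fastforce
  then show ?thesis
  proof cases
    case 1
    then have "NF (digit_sum w' - digit_sum w) \<le> NF \<pi> ^ length w"
      using F.N_unif_pos by (simp add: F.N_divide F.N_power)
    from digit_sum_close_imp_suffix[OF w _ this] 1(1) obtain u where u: "w' = u @ w" by auto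
    then obtain s where "w' = s # w" using singleton[of u] 1(1) by auto
    then show ?thesis using w(2) by auto
  next
    case 2
    have "NF (digit_sum w' - digit_sum w) \<le> inverse (NF \<pi>) * NF \<pi> ^ length w"
      using 2(2) F.N_unif_pos by (simp add: F.N_divide F.N_power divide_le_eq)
    then have "NF (digit_sum w - digit_sum w') \<le> NF \<pi> ^ length w'"
      using F.unif_nonzero 2(1) F.N_minus_commute[of "digit_sum w" "digit_sum w'"]
      by (simp flip: mult.assoc)
    from digit_sum_close_imp_suffix[OF w(2,1) _ this] 2(1) obtain u where u: "w = u @ w'" by auto
    then show ?thesis using singleton[of u] 2(1) by auto
  qed
qed

lemma hecke_kernel_child:
  assumes "NF s \<le> 1"
  shows "to_poly (hecke_kernel (mat2 \<pi> s 0 1) v) = act (mat2 \<pi> s 0 1) (to_poly v)"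
proof -
  have "ordF D (det (mat2 \<pi> s 0 1)) = 1" by (intro ordF_eqI) simp
  then have "sqrt_unif ^ k \<sigma> * twist (mat2 \<pi> s 0 1) = 1"
    using sqrt_unif_nonzero by (simp add: power_int_minus)
  then show ?thesis using to_poly_hecke_kernel[OF child_in_double_coset[OF assms]] by simp
qed

lemma hecke_kernel_parent:
  assumes "NF t \<le> 1"
  shows "to_poly (hecke_kernel (mat2 (1 / \<pi>) (- t / \<pi>) 0 1) v) = pcompose (to_poly v) [:- \<sigma> t, \<sigma> \<pi>:]"
proof -
  let ?g = "mat2 (1 / \<pi>) (- t / \<pi>) 0 1"
  have "ordF D (det ?g) = - 1"
    by (intro ordF_eqI) (simp add: F.N_inverse power_int_minus divide_inverse)
  then have "to_poly (hecke_kernel ?g v) = smult (\<sigma> \<pi> ^ k \<sigma>) (act ?g (to_poly v))"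
    unfolding to_poly_hecke_kernel[OF parent_in_double_coset[OF assms]]
    by (subst twist_of_ord_minus_one) simp_all
  also have "\<dots> = (\<Sum>i\<le>k \<sigma>. smult (coeff (to_poly v) i) ([:- \<sigma> t, \<sigma> \<pi>:] ^ i))"
    unfolding act_upper smult_sum_right
  proof (intro sum.cong refl)
    fix i assume "i \<in> {..k \<sigma>}"
    then have "\<sigma> \<pi> ^ k \<sigma> * \<sigma> (1 / \<pi>) ^ (k \<sigma> - i) = \<sigma> \<pi> ^ i"
      using \<sigma>.nonzero[OF F.unif_nonzero]
      by (simp add: divide_inverse \<sigma>.one \<sigma>.inverse power_inverse power_diff)
    moreover have "smult (\<sigma> \<pi>) [:\<sigma> (- t / \<pi>), \<sigma> 1:] = [:- \<sigma> t, \<sigma> \<pi>:]"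
      using F.unif_nonzero by (simp add: \<sigma>.one \<sigma>.minus flip: \<sigma>.mult)
    then have "smult (\<sigma> \<pi> ^ i) ([:\<sigma> (- t / \<pi>), \<sigma> 1:] ^ i) = [:- \<sigma> t, \<sigma> \<pi>:] ^ i"
      by (simp only: flip: smult_power)
    moreover have "smult (\<sigma> \<pi> ^ k \<sigma>) (smult (coeff (to_poly v) i * x) P)
        = smult (coeff (to_poly v) i) (smult (\<sigma> \<pi> ^ k \<sigma> * x) P)" for x P
      by (simp add: mult_ac)
    ultimately show "smult (\<sigma> \<pi> ^ k \<sigma>)
          (smult (coeff (to_poly v) i * \<sigma> (1 / \<pi>) ^ (k \<sigma> - i)) ([:\<sigma> (- t / \<pi>), \<sigma> 1:] ^ i))
        = smult (coeff (to_poly v) i) ([:- \<sigma> t, \<sigma> \<pi>:] ^ i)"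
      by (simp only:)
  qed
  also have "\<dots> = pcompose (to_poly v) [:- \<sigma> t, \<sigma> \<pi>:]" using pcompose_conv_sum[OF degree_to_poly_le]
    by simp
  finally show ?thesis .
qed

definition vertex_poly :: "('f, 'c) ind_fun \<Rightarrow> 'f list \<Rightarrow> 'c poly" where
  "vertex_poly f w = to_poly (f (matrix_inv (vertex w)))"

lemma vertex_poly_eq_0_iff:
  assumes "f \<in> c_ind D k (weight D k)"
  shows "vertex_poly f w = 0 \<longleftrightarrow> f (matrix_inv (vertex w)) = 0"
  using weight_eqI[of "f (matrix_inv (vertex w))" 0] c_ind_in[OF assms]
    invertible_matrix_inv[OF invertible_vertex]
  by (auto simp: vertex_poly_def weight_def)

lemma to_poly_hecke_at_vertex:
  assumes f: "f \<in> c_ind D k (weight D k)" "supported_on (lists R.teich) vertex f"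
    and w: "w \<in> lists R.teich" "t \<in> R.teich"
  shows "to_poly (hecke D k f (matrix_inv (vertex (t # w))))
    = pcompose (vertex_poly f w) [:- \<sigma> t, \<sigma> \<pi>:]
      + (\<Sum>s\<in>R.teich. act (mat2 \<pi> s 0 1) (vertex_poly f (s # t # w)))"
proof -
  define z h where "z = t # w" and "h = matrix_inv (vertex z)"
  define P where "P = insert w ((\<lambda>s. s # z) ` R.teich)"
  define I where "I = {u \<in> lists R.teich. f (matrix_inv (vertex u)) \<noteq> 0}"
  have z: "z \<in> lists R.teich" using w by (simp add: z_def)
  have P: "finite P" "P \<subseteq> lists R.teich" using R.finite_teich w z by (auto simp: P_def)
  have I: "finite I" "supported_on I vertex f" "inequivalent I vertex"
    unfolding I_def
    by (rule finite_supported_indices[OF f(1) inequivalent_vertices],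
      rule supported_on_nonzero_indices[OF f(1) inequivalent_vertices f(2)],
      rule inequivalent_subset[OF inequivalent_vertices]) blast
  have "hecke D k f h = (\<Sum>u\<in>I. hecke_kernel (h ** vertex u) (f (matrix_inv (vertex u))))"
    unfolding h_def using hecke_apply[OF f(1) I(1,3,2)] invertible_matrix_inv[OF invertible_vertex]
    by blast
  also have "\<dots> = (\<Sum>u\<in>P. hecke_kernel (h ** vertex u) (f (matrix_inv (vertex u))))"
  proof (rule sum.mono_neutral_cong[OF P(1) I(1)])
    fix u assume "u \<in> I - P"
    then have "h ** vertex u \<notin> double_coset"
      using vertex_neighbour[OF z, of u] unfolding h_def by (auto simp: P_def I_def z_def)
    then show "hecke_kernel (h ** vertex u) (f (matrix_inv (vertex u))) = 0"
      by (simp add: hecke_kernel_def)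
  qed (use P(2) in \<open>auto simp: I_def\<close>)
  also have "\<dots> = hecke_kernel (h ** vertex w) (f (matrix_inv (vertex w)))
      + (\<Sum>s\<in>R.teich. hecke_kernel (h ** vertex (s # z)) (f (matrix_inv (vertex (s # z)))))"
  proof -
    have "w \<notin> (\<lambda>s. s # z) ` R.teich" by (auto simp: z_def dest: arg_cong[of _ _ length])
    then show ?thesis unfolding P_def using R.finite_teich by (simp add: sum.reindex inj_on_def)
  qed
  finally have hecke: "hecke D k f h = hecke_kernel (mat2 (1 / \<pi>) (- t / \<pi>) 0 1) (f (matrix_inv (vertex w)))
      + (\<Sum>s\<in>R.teich. hecke_kernel (mat2 \<pi> s 0 1) (f (matrix_inv (vertex (s # z)))))"
    unfolding h_def vertex_to_child unfolding z_def vertex_to_parent .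
  show ?thesis
    unfolding vertex_poly_def z_def[symmetric] h_def[symmetric] hecke to_poly_add to_poly_sum
      hecke_kernel_parent[OF R.N_teich_le_one[OF w(2)]]
    by (intro arg_cong2[of _ _ _ _ "(+)"] refl sum.cong hecke_kernel_child R.N_teich_le_one)
qed

lemma digitsE:
  assumes "\<mu> \<in> digits D n"
  obtains w where "w \<in> lists R.teich" "n = length w" "g0 D n \<mu> = vertex w" "\<mu> = digit_sum w"
  using assms unfolding digits_eq vertex_def by blast

lemma zero_supp_supported_on_vertices:
  assumes "f \<in> zero_supp D k"
  shows "supported_on (lists R.teich) vertex f"
  unfolding supported_on_def
proof (intro allI impI)
  fix g assume "f g \<noteq> 0"
  obtain v0 v1 where ex: "is_expansion D k f v0 v1" and v1: "\<And>n \<mu>. v1 n \<mu> = 0"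
    using assms unfolding zero_supp_def by blast
  define I where "I = {(n, \<mu>). v0 n \<mu> \<noteq> 0 \<or> v1 n \<mu> \<noteq> 0}"
  have "f = (\<Sum>i\<in>I. elem D k (g0 D (fst i) (snd i)) (v0 (fst i) (snd i)))"
    using ex v1 unfolding is_expansion_def I_def by (simp add: case_prod_unfold)
  with \<open>f g \<noteq> 0\<close> have "(\<Sum>i\<in>I. elem D k (g0 D (fst i) (snd i)) (v0 (fst i) (snd i))) g \<noteq> 0" by simp
  then obtain i where i: "i \<in> I" "v0 (fst i) (snd i) \<noteq> 0" "g ** g0 D (fst i) (snd i) \<in> KZ D"
    by (rule elem_sum_support)
  then have "snd i \<in> digits D (fst i)" using ex unfolding is_expansion_def by blast
  then show "\<exists>w\<in>lists R.teich. g ** vertex w \<in> KZ D" using i(3) by (metis digitsE)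
qed

lemma ball_supp_vanishes:
  assumes "b \<in> ball_supp D k N" "w \<in> lists R.teich" "N < length w"
  shows "b (matrix_inv (vertex w)) = 0"
proof -
  obtain v0 v1 where ex: "is_expansion D k b v0 v1" and v0: "\<And>n \<mu>. N < n \<Longrightarrow> v0 n \<mu> = 0"
    using assms(1) unfolding ball_supp_def by blast
  define I where "I = {(n, \<mu>). v0 n \<mu> \<noteq> 0 \<or> v1 n \<mu> \<noteq> 0}"
  let ?h = "matrix_inv (vertex w)"
  have vanish: "elem D k (g0 D n \<mu>) (v0 n \<mu>) ?h = 0" "elem D k (g1 D n \<mu>) (v1 n \<mu>) ?h = 0"
    if "(n, \<mu>) \<in> I" for n \<mu>
  proof -
    have "\<mu> \<in> digits D n" using ex that unfolding is_expansion_def I_def by blast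
    then obtain z where z: "z \<in> lists R.teich" "n = length z" "g0 D n \<mu> = vertex z" "\<mu> = digit_sum z"
      by (rule digitsE)
    show "elem D k (g1 D n \<mu>) (v1 n \<mu>) ?h = 0"
      unfolding elem_def vertex_def z(4)
      using matrix_inv_g0_mult_g1_notin_KZ[OF N_digit_sum_le_one[OF assms(2)] N_digit_sum_le_one[OF z(1)]]
      by simp
    show "elem D k (g0 D n \<mu>) (v0 n \<mu>) ?h = 0"
    proof (cases "z = w")
      case True
      then show ?thesis using v0 z(2) assms(3) by simp
    next
      case False
      then have "?h ** vertex z \<notin> KZ D"
        using inequivalent_vertices assms(2) z(1) unfolding inequivalent_def by metis
      then show ?thesis unfolding z(3) by (simp add: elem_def)
    qed
  qed
  have "b = (\<Sum>(n, \<mu>)\<in>I. elem D k (g0 D n \<mu>) (v0 n \<mu>) + elem D k (g1 D n \<mu>) (v1 n \<mu>))"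
    using ex unfolding is_expansion_def I_def by simp
  then have "b ?h = (\<Sum>(n, \<mu>)\<in>I. elem D k (g0 D n \<mu>) (v0 n \<mu>) ?h + elem D k (g1 D n \<mu>) (v1 n \<mu>) ?h)"
    by (simp only: sum_fun_apply case_prod_unfold plus_fun_apply)
  then show ?thesis using vanish by (auto intro!: sum.neutral)
qed

lemma in_ball_supp:
  assumes f: "f \<in> c_ind D k (weight D k)"
    and supp: "supported_on {w \<in> lists R.teich. length w \<le> M} vertex f"
  shows "f \<in> ball_supp D k M"
proof -
  define v0 where "v0 n \<mu> = (if n \<le> M \<and> \<mu> \<in> digits D n then f (matrix_inv (g0 D n \<mu>)) else 0)" for n \<mu>
  define J where "J = {w \<in> {w \<in> lists R.teich. length w \<le> M}. f (matrix_inv (vertex w)) \<noteq> 0}"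
  have ineq: "inequivalent {w \<in> lists R.teich. length w \<le> M} vertex"
    by (rule inequivalent_subset[OF inequivalent_vertices]) blast
  have J: "finite J" "supported_on J vertex f"
    unfolding J_def
    using finite_supported_indices[OF f ineq] supported_on_nonzero_indices[OF f ineq supp] by simp_all
  have inj: "inj_on (\<lambda>w. (length w, digit_sum w)) J"
    by (rule inj_onI) (auto simp: J_def intro: digit_sum_inj)
  have v0_vertex: "v0 (length w) (digit_sum w) = f (matrix_inv (vertex w))" if "w \<in> J" for w
    using that by (auto simp: v0_def J_def vertex_def digits_eq)
  have v0_supp: "{(n, \<mu>). v0 n \<mu> \<noteq> 0} = (\<lambda>w. (length w, digit_sum w)) ` J"
  proof (intro set_eqI iffI)
    fix x assume "x \<in> {(n, \<mu>). v0 n \<mu> \<noteq> 0}"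
    then obtain n \<mu> where x: "x = (n, \<mu>)" "n \<le> M" "\<mu> \<in> digits D n" "f (matrix_inv (g0 D n \<mu>)) \<noteq> 0"
      by (auto simp: v0_def split: if_splits)
    from x(3) obtain w where "w \<in> lists R.teich" "n = length w" "g0 D n \<mu> = vertex w" "\<mu> = digit_sum w"
      by (rule digitsE)
    then show "x \<in> (\<lambda>w. (length w, digit_sum w)) ` J" using x by (auto simp: J_def)
  next
    fix x assume "x \<in> (\<lambda>w. (length w, digit_sum w)) ` J"
    then obtain w where "w \<in> J" "x = (length w, digit_sum w)" by blast
    then show "x \<in> {(n, \<mu>). v0 n \<mu> \<noteq> 0}" using v0_vertex[of w] by (simp add: J_def)
  qed
  have "f = (\<Sum>w\<in>J. elem D k (vertex w) (f (matrix_inv (vertex w))))"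
    using c_ind_eq_elem_sum[OF f J(1) inequivalent_subset[OF inequivalent_vertices] J(2)]
    by (auto simp: J_def)
  also have "\<dots> = (\<Sum>w\<in>J. elem D k (g0 D (length w) (digit_sum w)) (v0 (length w) (digit_sum w)))"
    using v0_vertex by (intro sum.cong refl) (simp add: vertex_def)
  also have "\<dots> = (\<Sum>(n, \<mu>)\<in>(\<lambda>w. (length w, digit_sum w)) ` J.
      elem D k (g0 D n \<mu>) (v0 n \<mu>) + elem D k (g1 D n \<mu>) 0)"
    by (simp add: sum.reindex[OF inj])
  finally have "is_expansion D k f v0 (\<lambda>n \<mu>. 0)"
    unfolding is_expansion_def simp_thms v0_supp
    using J(1) c_ind_in[OF f invertible_matrix_inv[OF invertible_g0]]
    by (simp add: v0_def weight_def)
  moreover have "\<forall>n \<mu>. n > M \<longrightarrow> v0 n \<mu> = 0" by (simp add: v0_def)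
  ultimately show ?thesis unfolding ball_supp_def using f by blast
qed

lemma gauss_vertex_poly_le_of_ball_plus_lattice:
  assumes f: "f \<in> ball_plus_lattice D k N m" and w: "w \<in> lists R.teich" "N < length w"
  shows "C.gauss (vertex_poly f w) \<le> NF \<pi> powi m"
proof -
  obtain b h where bh: "f = b + smul (base_emb D \<pi> powi m) h" "b \<in> ball_supp D k N"
    "h \<in> c_ind D k (weight_lattice D k)"
    using f unfolding ball_plus_lattice_def by blast
  let ?g = "matrix_inv (vertex w)"
  have "f ?g = (\<lambda>i. base_emb D \<pi> powi m * h ?g i)"
    by (rule ext) (simp add: bh(1) ball_supp_vanishes[OF bh(2) w] smul_def)
  then have "vertex_poly f w = smult (base_emb D \<pi> powi m) (to_poly (h ?g))"
    by (simp add: vertex_poly_def to_poly_scale)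
  moreover have "C.gauss (to_poly (h ?g)) \<le> 1"
    using c_ind_in[OF bh(3) invertible_matrix_inv[OF invertible_vertex]]
    by (simp add: weight_lattice_iff)
  ultimately show ?thesis
    by (simp add: C.gauss_smult C.N_power_int N_embedding[OF base_emb] mult_left_le)
qed

lemma in_ball_plus_lattice:
  assumes f: "f \<in> c_ind D k (weight D k)" "supported_on (lists R.teich) vertex f"
    and le: "\<And>w. w \<in> lists R.teich \<Longrightarrow> N < length w \<Longrightarrow> C.gauss (vertex_poly f w) \<le> NF \<pi> powi m"
  shows "f \<in> ball_plus_lattice D k N m"
proof -
  define V where "V w = f (matrix_inv (vertex w))" for w
  define J where "J = {w \<in> lists R.teich. V w \<noteq> 0}"
  define inner outer where "inner = {w \<in> J. length w \<le> N}" and "outer = {w \<in> J. \<not> length w \<le> N}"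
  have N_c: "NC (base_emb D \<pi> powi m) = NF \<pi> powi m"
    by (simp add: C.N_power_int N_embedding[OF base_emb])
  have V: "V w \<in> weight D k" for w
    unfolding V_def by (rule c_ind_in[OF f(1) invertible_matrix_inv[OF invertible_vertex]])
  have J: "finite J" "supported_on J vertex f" "inequivalent J vertex"
    unfolding J_def V_def
    by (rule finite_supported_indices[OF f(1) inequivalent_vertices],
      rule supported_on_nonzero_indices[OF f(1) inequivalent_vertices f(2)],
      rule inequivalent_subset[OF inequivalent_vertices]) blast
  have "f = (\<Sum>w\<in>J. elem D k (vertex w) (V w))"
    unfolding V_def by (rule c_ind_eq_elem_sum[OF f(1) J(1,3,2)])
  also have "J = inner \<union> outer" by (auto simp: inner_def outer_def)
  also have "(\<Sum>w\<in>inner \<union> outer. elem D k (vertex w) (V w))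
      = (\<Sum>w\<in>inner. elem D k (vertex w) (V w)) + (\<Sum>w\<in>outer. elem D k (vertex w) (V w))"
    using J(1) by (intro sum.union_disjoint) (auto simp: inner_def outer_def)
  finally have split: "f = (\<Sum>w\<in>inner. elem D k (vertex w) (V w)) + (\<Sum>w\<in>outer. elem D k (vertex w) (V w))" .
  have inner: "(\<Sum>w\<in>inner. elem D k (vertex w) (V w)) \<in> ball_supp D k N"
  proof (rule in_ball_supp)
    show "(\<Sum>w\<in>inner. elem D k (vertex w) (V w)) \<in> c_ind D k (weight D k)"
      using J(1) V invertible_vertex
      by (intro elem_sum_in_c_ind KZ_stable_weight) (simp_all add: inner_def)
    show "supported_on {w \<in> lists R.teich. length w \<le> N} vertex (\<Sum>w\<in>inner. elem D k (vertex w) (V w))"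
      by (rule supported_on_elem_sum) (auto simp: inner_def J_def)
  qed
  obtain h where h: "h \<in> c_ind D k (weight_lattice D k)"
    "(\<Sum>w\<in>outer. elem D k (vertex w) (V w)) = smul (base_emb D \<pi> powi m) h"
  proof (rule elem_sum_eq_smul_lattice[OF _ invertible_vertex V])
    show "finite outer" using J(1) by (simp add: outer_def)
    show "base_emb D \<pi> powi m \<noteq> 0"
      unfolding C.N_pos_iff[symmetric] N_c using F.N_unif_pos by (rule zero_less_power_int)
    show "C.gauss (to_poly (V w)) \<le> NC (base_emb D \<pi> powi m)" if "w \<in> outer" for w
      using le[of w] that by (simp add: N_c vertex_poly_def V_def outer_def J_def)
  qed
  show ?thesis unfolding ball_plus_lattice_def split h(2) using inner h(1) by blast
qed

end

locale hecke_weight = weight_setting D k \<sigma>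
  for D :: "('k::field_char_0, 'f::field, 'c::field) padic_data"
    and k :: "('f \<Rightarrow> 'c) \<Rightarrow> nat" and \<sigma> :: "'f \<Rightarrow> 'c" +
  fixes a :: 'c and d r :: nat
  assumes k_\<sigma>: "k \<sigma> = d * res_card D + r" and r_d_less: "r + d < res_card D"
    and a_nonzero: "a \<noteq> 0" and a_less_one: "NC a < 1" and p_le_a: "NF (of_nat p) \<le> NC a"
begin

sublocale T: hecke_tree NC "\<sigma> \<pi>" "\<sigma> ` R.teich" q a p d r "k \<sigma>"
proof
  have inj: "inj_on \<sigma> R.teich" using \<sigma>.inj by (rule inj_on_subset) simp
  show "finite (\<sigma> ` R.teich)" "card (\<sigma> ` R.teich) = q"
    using R.finite_teich card_image[OF inj] R.card_teich by simp_all
  show "t ^ q = t" if "t \<in> \<sigma> ` R.teich" for t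
    using that by (auto simp: R.teich_def simp flip: \<sigma>.power)
  show "NC (s - t) = 1" if st: "s \<in> \<sigma> ` R.teich" "t \<in> \<sigma> ` R.teich" "s \<noteq> t" for s t
  proof -
    obtain x y where "x \<in> R.teich" "y \<in> R.teich" "s = \<sigma> x" "t = \<sigma> y" using st(1,2) by blast
    then show ?thesis using st(3) R.N_teich_diff[of x y] by (auto simp: N_\<sigma> simp flip: \<sigma>.diff)
  qed
  show "0 \<in> \<sigma> ` R.teich" using R.zero_in_teich \<sigma>.zero by (metis imageI)
  show "0 < NC (\<sigma> \<pi>)" "NC (\<sigma> \<pi>) < 1" using F.N_unif_pos F.N_unif_less_one by (simp_all only: N_\<sigma>)
  have N_of_nat: "NC (of_nat n) = NF (of_nat n)" for n using N_\<sigma>[of "of_nat n"] by (simp add: \<sigma>.of_nat)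
  show "NC (of_nat q) \<le> NC (\<sigma> \<pi>)" "NC (of_nat p) \<le> NC a"
    unfolding N_of_nat N_\<sigma> using F.N_le_unif[OF R.N_q_less_one] p_le_a by simp_all
  show "p dvd (q choose i)" if "0 < i" "i < q" for i
    by (rule p_dvd_of_N_less_one[OF R.N_binomial_q_less_one[OF that]])
  show "0 < NC a" "NC a < 1" using a_nonzero a_less_one by simp_all
qed (use R.q_ge_2 k_\<sigma> r_d_less in simp_all)

lemma T_minus_eq_act: "T.T_minus (\<sigma> s) v = act (mat2 \<pi> s 0 1) v"
  unfolding T.T_minus_def act_upper pcompose_conv_sum[OF T.degree_U]
  by (intro sum.cong refl) (simp add: T.coeff_U \<sigma>.one mult.commute)

lemma vertex_poly_hecke_minus:
  assumes "f \<in> c_ind D k (weight D k)" "supported_on (lists R.teich) vertex f"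
    and "w \<in> lists R.teich" "t \<in> R.teich"
  shows "vertex_poly (hecke D k f - smul a f) (t # w)
    = T.T_plus (\<sigma> t) (vertex_poly f w) + (\<Sum>s\<in>R.teich. T.T_minus (\<sigma> s) (vertex_poly f (s # t # w)))
      - smult a (vertex_poly f (t # w))"
proof -
  have "vertex_poly (g - smul a f) (t # w) = vertex_poly g (t # w) - smult a (vertex_poly f (t # w))" for g
    by (rule poly_eqI) (simp add: vertex_poly_def coeff_to_poly smul_def)
  then show ?thesis
    using to_poly_hecke_at_vertex[OF assms]
    by (simp add: T.T_plus_def T_minus_eq_act vertex_poly_def[of "hecke D k f"])
qed

lemma hecke_solution_of_ball_plus_lattice:
  assumes f: "f \<in> c_ind D k (weight D k)" "supported_on (lists R.teich) vertex f"
    and eq: "hecke D k f - smul a f \<in> ball_plus_lattice D k N m"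
    and w0: "w0 \<in> lists R.teich" "N \<le> length w0"
  obtains M where "hecke_solution NC (\<sigma> \<pi>) (\<sigma> ` R.teich) q a p d r (k \<sigma>)
    (\<lambda>w. if w \<in> lists (\<sigma> ` R.teich) then vertex_poly f (map (inv \<sigma>) w @ w0) else 0) M (NF \<pi> powi m)"
proof -
  let ?word = "\<lambda>w. map (inv \<sigma>) w @ w0"
  let ?f = "\<lambda>w. if w \<in> lists (\<sigma> ` R.teich) then vertex_poly f (?word w) else 0"
  have word: "?word w \<in> lists R.teich" if "w \<in> lists (\<sigma> ` R.teich)" for w
    using that w0(1) by (auto simp: in_lists_conv_set inv_f_f[OF \<sigma>.inj])
  have "finite (length ` {w \<in> lists R.teich. f (matrix_inv (vertex w)) \<noteq> 0})"
    using finite_supported_indices[OF f(1) inequivalent_vertices] by simp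
  then obtain M where M: "\<And>w. w \<in> lists R.teich \<Longrightarrow> f (matrix_inv (vertex w)) \<noteq> 0 \<Longrightarrow> length w \<le> M"
    unfolding finite_nat_set_iff_bounded_le by blast
  have "hecke_solution NC (\<sigma> \<pi>) (\<sigma> ` R.teich) q a p d r (k \<sigma>) ?f M (NF \<pi> powi m)"
  proof
    show "degree (?f w) \<le> k \<sigma>" for w by (simp add: vertex_poly_def degree_to_poly_le)
    show "?f w = 0" if "M < length w" for w
      using M[OF word, of w] that vertex_poly_eq_0_iff[OF f(1), of "?word w"] by auto
    fix w t assume w: "w \<in> lists (\<sigma> ` R.teich)" and "t \<in> \<sigma> ` R.teich"
    then obtain \<tau> where \<tau>: "\<tau> \<in> R.teich" "t = \<sigma> \<tau>" by blast
    have "(\<Sum>s\<in>\<sigma> ` R.teich. T.T_minus s (?f (s # t # w)))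
        = (\<Sum>s\<in>R.teich. T.T_minus (\<sigma> s) (vertex_poly f (s # \<tau> # ?word w)))"
      using w \<tau> by (subst sum.reindex) (auto simp: inj_on_subset[OF \<sigma>.inj] inv_f_f[OF \<sigma>.inj])
    then have "smult a (?f (t # w)) - T.T_plus t (?f w) - (\<Sum>s\<in>\<sigma> ` R.teich. T.T_minus s (?f (s # t # w)))
        = - vertex_poly (hecke D k f - smul a f) (\<tau> # ?word w)"
      using w \<tau> by (simp add: vertex_poly_hecke_minus[OF f word[OF w] \<tau>(1)] inv_f_f[OF \<sigma>.inj])
    moreover have "C.gauss (vertex_poly (hecke D k f - smul a f) (\<tau> # ?word w)) \<le> NF \<pi> powi m"
      using word[OF w] \<tau>(1) w0(2) by (intro gauss_vertex_poly_le_of_ball_plus_lattice[OF eq]) simp_all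
    ultimately show "C.gauss (smult a (?f (t # w)) - T.T_plus t (?f w)
        - (\<Sum>s\<in>\<sigma> ` R.teich. T.T_minus s (?f (s # t # w)))) \<le> NF \<pi> powi m"
      by (simp only: C.gauss_minus)
  qed
  then show thesis by (rule that)
qed

theorem separated_of_N_unif_le:
  assumes "NF \<pi> \<le> NC a \<or> NF \<pi> ^ Suc r \<le> NC a * NC a"
  shows "separated D k a"
proof -
  define b where "b = NF \<pi> * (NC a * NC a) * NF \<pi> ^ d"
  have "0 < b" using F.N_unif_pos a_nonzero by (simp add: b_def)
  then obtain \<epsilon> where \<epsilon>: "NF \<pi> ^ \<epsilon> < b" using real_arch_pow_inv[of b "NF \<pi>"] F.N_unif_less_one by blast
  have "f \<in> ball_plus_lattice D k (N - 1) (int n - int \<epsilon>)"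
    if "1 \<le> N" and f: "f \<in> zero_supp D k"
      and eq: "hecke D k f - smul a f \<in> ball_plus_lattice D k N (int n)" for N n f
  proof (rule in_ball_plus_lattice)
    show f_c_ind: "f \<in> c_ind D k (weight D k)" using f by (simp add: zero_supp_def)
    show f_supp: "supported_on (lists R.teich) vertex f" by (rule zero_supp_supported_on_vertices[OF f])
    fix w assume w: "w \<in> lists R.teich" "N - 1 < length w"
    define u w0 where "u = take (length w - N) w" and "w0 = drop (length w - N) w"
    have uw: "w = u @ w0" "N \<le> length w0" using w(2) \<open>1 \<le> N\<close> by (simp_all add: u_def w0_def)
    then have words: "u \<in> lists R.teich" "w0 \<in> lists R.teich" using w(1) by auto
    obtain M where M: "hecke_solution NC (\<sigma> \<pi>) (\<sigma> ` R.teich) q a p d r (k \<sigma>)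
        (\<lambda>w. if w \<in> lists (\<sigma> ` R.teich) then vertex_poly f (map (inv \<sigma>) w @ w0) else 0) M (NF \<pi> powi int n)"
      using hecke_solution_of_ball_plus_lattice[OF f_c_ind f_supp eq words(2) uw(2)] .
    have "map \<sigma> u \<in> lists (\<sigma> ` R.teich)" using words(1) by auto
    with hecke_solution.gauss_f_le_uniform[OF M, of "map \<sigma> u"] assms
    have "C.gauss (vertex_poly f w) \<le> NF \<pi> powi int n / b"
      by (simp add: uw(1) b_def N_\<sigma> o_def inv_f_f[OF \<sigma>.inj])
    also have "\<dots> \<le> NF \<pi> powi int n / NF \<pi> ^ \<epsilon>"
      using \<epsilon> \<open>0 < b\<close> F.N_unif_pos by (intro divide_left_mono) simp_all
    also have "\<dots> = NF \<pi> powi (int n - int \<epsilon>)" using F.unif_nonzero by (simp add: power_int_diff)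
    finally show "C.gauss (vertex_poly f w) \<le> NF \<pi> powi (int n - int \<epsilon>)" .
  qed
  then show ?thesis unfolding separated_def by (intro exI[of _ 1]) auto
qed

end

theorem theorem4p19:
  fixes D :: "('k::field_char_0, 'f::field, 'c::field) padic_data"
    and k :: "('f \<Rightarrow> 'c) \<Rightarrow> nat"
    and \<sigma> :: "'f \<Rightarrow> 'c"
    and a :: 'c
    and d r :: nat
  assumes "padic_setting D"
    and "\<sigma> \<in> embeddings D"
    and "\<forall>\<tau>\<in>embeddings D. \<tau> \<noteq> \<sigma> \<longrightarrow> k \<tau> = 0"
    and "real (k \<sigma>) \<le> (real (res_card D))\<^sup>2 / 2"
    and "k \<sigma> = d * res_card D + r"
    and "int r < int (res_card D) - int d"
    and "a \<in> int_ring (absC D)"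
    and "0 < valF D a" and "valF D a \<le> ereal (real (ram_index D))"
    and "(0 < valF D a \<and> valF D a \<le> 1) \<or> 2 * valF D a - 1 \<le> ereal (real r)"
  shows "separated D k a"
proof -
  interpret padic_setting D by fact
  have a: "a \<noteq> 0" "NC a < 1"
    using assms(8,9) valF_le_iff[of a] by (simp_all add: valF_pos_iff)
  interpret hecke_weight D k \<sigma> a d r
  proof
    show "NF (of_nat p) \<le> NC a" by (rule N_p_le_of_valF_le[OF assms(9)])
    show "r + d < res_card D" "0 < res_card D" using assms(6) by linarith+
  qed (use assms(2,3,5) a in auto)
  have "NF \<pi> \<le> NC a \<or> NF \<pi> ^ Suc r \<le> NC a * NC a"
    using assms(10) N_unif_le_of_valF_le N_unif_power_le_of_valF_le[OF a(1)] by blast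
  then show ?thesis by (rule separated_of_N_unif_le)
qed

end
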